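(* Let $d>2$ and let $\mathcal{U}\in\mathcal{T}_d^2=(\mathbb{C}^2)^{\otimes d}$ be a generic tensor. Then $\mathcal{U}$ has at least $d-2$ and at most $5d-10$ Hermitian eigenvalues. In particular, for the Veronese variety $v_d\mathbb{C}^2$ of rank one symmetric tensors, $$d-2\le\min\operatorname{HDdeg}(v_d\mathbb{C}^2)\le\max\operatorname{HDdeg}(v_d\mathbb{C}^2)\le 5d-10 .$$
   Context: $\mathcal{T}_d^2=(\mathbb{C}^2)^{\otimes d}$ carries the Hermitian inner product $\langle\mathcal{A},\mathcal{B}\rangle_{\mathbb{C}}=\sum a_{j_1\ldots j_d}\overline{b_{j_1\ldots j_d}}$. For vectors $\mathbf{x}^{(1)},\dots,\mathbf{x}^{(d)}\in\mathbb{C}^2$, $\mathcal{U}\times(\mathbf{x}^{(1)}\otimes\dots\otimes\mathbf{x}^{(d)})=\sum_{j_1,\dots,j_d}u_{j_1\ldots j_d}x^{(1)}_{j_1}\cdots x^{(d)}_{j_d}$ (no conjugation). A Hermitian eigenvector of $\mathcal{U}\in\mathcal{T}_d^2$ is a unit vector $\mathbf{z}\in\mathbb{C}^2$ such that, for $i=1,2$, $$\frac1d\sum_{k=1}^d\mathcal{U}\times\left(\bar{\mathbf{z}}^{\otimes(k-1)}\otimes e_i\otimes\bar{\mathbf{z}}^{\otimes(d-k)}\right)=\langle\mathcal{U},\mathbf{z}^{\otimes d}\rangle_{\mathbb{C}}\,z_i ,$$ with $\langle\mathcal{U},\mathbf{z}^{\otimes d}\rangle_{\mathbb{C}}$ real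 and nonnegative; this scalar is the associated Hermitian eigenvalue ($e_1,e_2$ is the canonical basis). Hermitian eigenvalues are counted through the critical points $\langle\mathcal{U},\mathbf{z}^{\otimes d}\rangle_{\mathbb{C}}\,\mathbf{z}^{\otimes d}$ that they produce; multiplying $\mathbf{z}$ by a $d$-th root of unity does not change the critical point. "Generic" means outside a negligible (nowhere dense) exceptional set of tensors. $v_d\mathbb{C}^2$ is the affine cone $\{\mu\,\mathbf{z}^{\otimes d}:\mu\in\mathbb{C},\ \mathbf{z}\in\mathbb{C}^2\}$ inside the space $\mathcal{S}_d^2\subseteq\mathcal{T}_d^2$ of symmetric tensors, with the restricted Hermitian inner product. For an algebraic variety $X$ in a finite-dimensional complex Hermitian vector space $\mathbb{V}$ and $\mathbf{u}\in\mathbb{V}$, a critical point of $q_{\mathbf{u}}\colon X\to\mathbb{R}$, $q_{\mathbf{u}}(\mathbf{z})=\|\mathbf{u}-\mathbf{z}\|^2$, is a regular point $\mathbf{z}\in X$ such that $\mathbf{u}-\mathbf{z}$ is Hermitian-orthogonal to the tangent space $T_{\mathbf{z}}X$. The Hermitian Distance degree $\operatorname{HDdeg}(X)\subseteq\mathbb{N}$ is the set of all $m$ for which there is a nonempty Euclidean-open subset of $\mathbb{V}$ such that $q_{\mathbf{u}}$ has exactly $m$ critical points for every $\mathbf{u}$ in it. *)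

theory Defs
  imports "HOL-Analysis.Analysis"
begin

section \<open>Binary tensors and Hermitian eigenvectors\<close>

text \<open>A tensor in the \<open>d\<close>-fold tensor power of \<open>\<complex>\<^sup>2\<close> is its array of coordinates in the canonical
  basis. The \<open>d\<close> tensor slots are labelled by a type \<open>'d\<close> with \<open>CARD('d) = d\<close>; a multi-index
  \<open>(j\<^sub>1, \<dots>, j\<^sub>d)\<close> is a function \<open>'d \<Rightarrow> 2\<close>. The topology and the norm are the library's Euclidean
  ones on \<open>complex ^ 'n\<close>.\<close>

type_synonym 'd tensor = "(complex, 'd \<Rightarrow> 2) vec"

definition herm :: "complex ^ 'n \<Rightarrow> complex ^ 'n \<Rightarrow> complex"
  where "herm A B = (\<Sum>j\<in>UNIV. A $ j * cnj (B $ j))"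

lemma herm_self: "herm A A = of_real ((norm A)\<^sup>2)"
  by (simp add: herm_def norm_vec_def L2_set_def complex_norm_square sum_nonneg
           del: of_real_power flip: of_real_power)

definition tensor_prod :: "('d::finite \<Rightarrow> complex ^ 2) \<Rightarrow> 'd tensor"
  where "tensor_prod x = (\<chi> j. \<Prod>k\<in>UNIV. x k $ j k)"

abbreviation tensor_power :: "complex ^ 2 \<Rightarrow> ('d::finite) tensor"
  where "tensor_power z \<equiv> tensor_prod (\<lambda>_. z)"

definition contract :: "('d::finite) tensor \<Rightarrow> ('d \<Rightarrow> complex ^ 2) \<Rightarrow> complex"
  where "contract U x = (\<Sum>j\<in>UNIV. U $ j * (\<Prod>k\<in>UNIV. x k $ j k))"

definition vcnj :: "complex ^ 'n \<Rightarrow> complex ^ 'n"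
  where "vcnj z = (\<chi> i. cnj (z $ i))"

lemma contract_vcnj: "contract U (\<lambda>_. vcnj z) = herm U (tensor_power z)"
  by (simp add: contract_def herm_def tensor_prod_def vcnj_def)

text \<open>In the \<open>k\<close>-th summand, slot \<open>k\<close> holds \<open>e\<^sub>i\<close> and every other slot holds the conjugate of \<open>z\<close>.\<close>

definition hermitian_eigenvector :: "('d::finite) tensor \<Rightarrow> complex ^ 2 \<Rightarrow> bool"
  where "hermitian_eigenvector U z \<longleftrightarrow>
    norm z = 1 \<and>
    (\<forall>i. 1 / of_nat CARD('d) * (\<Sum>k\<in>UNIV. contract U ((\<lambda>_. vcnj z)(k := axis i 1)))
         = herm U (tensor_power z) * z $ i) \<and>
    herm U (tensor_power z) \<in> \<real> \<and> 0 \<le> Re (herm U (tensor_power z))"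

text \<open>Hermitian eigenvalues are counted through the critical points they produce: two eigenvectors
  yielding the same tensor below count once, while distinct tensors count separately even when
  the values \<open>herm U (tensor_power z)\<close> coincide.\<close>

definition eigen_points :: "('d::finite) tensor \<Rightarrow> 'd tensor set"
  where "eigen_points U =
    {herm U (tensor_power z) *s tensor_power z | z. hermitian_eigenvector U z}"

definition symmetric_tensors :: "('d::finite) tensor set"
  where "symmetric_tensors = {A. \<forall>p::'d \<Rightarrow> 'd. bij p \<longrightarrow> (\<forall>j. A $ (j \<circ> p) = A $ j)}"

definition veronese_cone :: "('d::finite) tensor set"
  where "veronese_cone = {\<mu> *s tensor_power z | \<mu> z. True}"

definition nowhere_dense :: "'a::topological_space set \<Rightarrow> bool"
  where "nowhere_dense E \<longleftrightarrow> interior (closure E) = {}"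


section \<open>Affine varieties, tangent spaces and regular points\<close>

inductive poly_fun :: "(complex ^ 'n \<Rightarrow> complex) \<Rightarrow> bool" where
  const: "poly_fun (\<lambda>_. c)"
| coord: "poly_fun (\<lambda>x. x $ i)"
| add: "poly_fun f \<Longrightarrow> poly_fun g \<Longrightarrow> poly_fun (\<lambda>x. f x + g x)"
| mult: "poly_fun f \<Longrightarrow> poly_fun g \<Longrightarrow> poly_fun (\<lambda>x. f x * g x)"

definition algebraic_set :: "(complex ^ 'n) set \<Rightarrow> bool"
  where "algebraic_set X \<longleftrightarrow> (\<exists>F. (\<forall>f\<in>F. poly_fun f) \<and> X = {x. \<forall>f\<in>F. f x = 0})"

definition irreducible_variety :: "(complex ^ 'n) set \<Rightarrow> bool"
  where "irreducible_variety X \<longleftrightarrow> algebraic_set X \<and> X \<noteq> {} \<and>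
    (\<forall>Y Z. algebraic_set Y \<and> algebraic_set Z \<and> X = Y \<union> Z \<longrightarrow> X = Y \<or> X = Z)"

text \<open>The tangent space is the common kernel of the differentials of all polynomials vanishing on
  \<open>X\<close>. If \<open>X\<close> lies in a linear subspace \<open>V\<close>, the linear forms vanishing on \<open>V\<close> are among these, so
  the tangent space lies in \<open>V\<close> and is the one computed inside \<open>V\<close>.\<close>

definition tangent_space :: "(complex ^ 'n) set \<Rightarrow> complex ^ 'n \<Rightarrow> (complex ^ 'n) set"
  where "tangent_space X z =
    {v. \<forall>f. poly_fun f \<and> (\<forall>x\<in>X. f x = 0) \<longrightarrow> frechet_derivative f (at z) v = 0}"

text \<open>The dimension of an irreducible variety is the least dimension of its tangent spaces, and
  the dimension of \<open>X\<close> at \<open>z\<close> is the largest dimension of an irreducible subvariety through \<open>z\<close>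
  (see Shafarevich, Basic Algebraic Geometry I, Chapter II, Section 1.4). All dimensions are over
  the complex numbers: \<open>vec.dim\<close> is the dimension for the scalar multiplication \<open>*s\<close>, whereas
  \<open>dim\<close> would be the real one.\<close>

definition variety_dim :: "(complex ^ 'n) set \<Rightarrow> nat"
  where "variety_dim Y = (LEAST r. \<exists>w\<in>Y. r = vec.dim (tangent_space Y w))"

definition local_dim :: "(complex ^ 'n) set \<Rightarrow> complex ^ 'n \<Rightarrow> nat"
  where "local_dim X z = Max {variety_dim Y | Y. irreducible_variety Y \<and> Y \<subseteq> X \<and> z \<in> Y}"

definition regular_point :: "(complex ^ 'n) set \<Rightarrow> complex ^ 'n \<Rightarrow> bool"
  where "regular_point X z \<longleftrightarrow> z \<in> X \<and> vec.dim (tangent_space X z) = local_dim X z"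


section \<open>The Hermitian distance degree\<close>

definition critical_points :: "(complex ^ 'n) set \<Rightarrow> complex ^ 'n \<Rightarrow> (complex ^ 'n) set"
  where "critical_points X u =
    {z. regular_point X z \<and> (\<forall>v\<in>tangent_space X z. herm (u - z) v = 0)}"

text \<open>The ambient Hermitian space is a complex linear subspace \<open>V\<close> of \<open>complex ^ 'n\<close> containing \<open>X\<close>,
  with the restricted inner product. Finiteness is explicit because \<open>card\<close> of an infinite set is 0.\<close>

definition HDdeg :: "(complex ^ 'n) set \<Rightarrow> (complex ^ 'n) set \<Rightarrow> nat set"
  where "HDdeg V X = {m. \<exists>G. openin (top_of_set V) G \<and> G \<noteq> {} \<and>
    (\<forall>u\<in>G. finite (critical_points X u) \<and> card (critical_points X u) = m)}"

end

theory Submission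
  imports Defs "HOL-Complex_Analysis.Complex_Analysis" "HOL-Computational_Algebra.Fundamental_Theorem_Algebra"
begin

text \<open>
  In the affine chart \<open>w\<close> of the projective line, Hermitian eigenvectors correspond to the solutions of
  \<open>p w = cnj w * q w\<close>, where \<open>p\<close> and \<open>q\<close> are the dehomogenized partial derivatives of the binary form
  of degree \<open>d\<close> defined by the tensor, so that \<open>p / q\<close> is rational of degree \<open>n = d - 1\<close>. For generic tensors
  all solutions are nondegenerate. Those with \<open>\<bar>(p / q)'\<bar> > 1\<close> have index \<open>1\<close>, the others index \<open>- 1\<close>, and
  the index at infinity is \<open>n - 1\<close>; hence there are at least \<open>n - 1\<close> of the first kind, and exactly \<open>n - 1\<close>
  more than of the second kind. The latter are attracting fixed points of \<open>w \<mapsto> cnj (p w / q w)\<close>, so by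
  Fatou each attracts one of the at most \<open>2 * n - 2\<close> critical points (Khavinson and Neumann). Together
  this leaves between \<open>n - 1 = d - 2\<close> and \<open>(n - 1) + 2 * (2 * n - 2) = 5 * d - 10\<close> solutions.
\<close>

section \<open>Winding indices without paths\<close>

text \<open>Both claims reduce to one count. The condition \<open>generic\<close> excludes infinity
  as a solution as well as all degenerate solutions; for such tensors \<open>eigen_points\<close>
  and the critical points on the Veronese cone are the same set, in bijection with the solutions
  \<open>w\<close>. The condition is open, and dense by perturbations that preserve symmetry, so it
  serves for all tensors and for symmetric ones alike.

  The index is a factorization \<open>(w - s) powi m * exp (L w)\<close> with continuous
  \<open>L\<close>, not an integral: the function involved is only real differentiable, and points
  can then be removed one at a time without deforming curves.

  Fatou's theorem lives on the sphere. To stay in the plane, a fixed point is sent to infinity; a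
  repelling one, whose existence the index count guarantees, leaves every attracting one in the
  plane.

  A priori \<open>HDdeg\<close> might be empty, leaving \<open>Min\<close> and \<open>Max\<close>
  without meaning; the persistence of nondegenerate solutions under perturbation is proved for that
  reason.\<close>

lemma has_field_derivative_lift:
  fixes g r h :: "complex \<Rightarrow> complex"
  assumes g: "isCont g x" and r: "(r has_field_derivative r') (at (g x))"
    and h: "(h has_field_derivative h') (at x)" and "r' \<noteq> 0"
    and lift: "\<forall>\<^sub>F z in nhds x. r (g z) = h z"
  shows "(g has_field_derivative h' / r') (at x)"
proof -
  \<comment> \<open>Caratheodory's slope function of \<open>r\<close> at \<open>g x\<close>: the
    difference quotient of \<open>g\<close> is that of \<open>h\<close> divided by
    \<open>\<phi> (g z)\<close>, so continuity of \<open>g\<close> suffices and no inverse function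
    is constructed.\<close>
  obtain \<phi> where \<phi>: "\<And>z. r z - r (g x) = \<phi> z * (z - g x)" "isCont \<phi> (g x)" "\<phi> (g x) = r'"
    using r unfolding CARAT_DERIV by blast
  have cont: "isCont (\<lambda>z. \<phi> (g z)) x"
    using g \<phi>(2) by (rule isCont_o2)
  then have nz: "\<forall>\<^sub>F z in at x. \<phi> (g z) \<noteq> 0"
    using \<phi>(3) \<open>r' \<noteq> 0\<close> by (intro tendsto_imp_eventually_ne[where c = r']) (auto simp: isCont_def)
  have hx: "r (g x) = h x"
    using lift by (rule eventually_nhds_x_imp_x)
  have "((\<lambda>z. ((h z - h x) / (z - x)) / \<phi> (g z)) \<longlongrightarrow> h' / r') (at x)"
    using h cont \<phi>(3) \<open>r' \<noteq> 0\<close>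
    by (intro tendsto_divide) (auto simp: has_field_derivative_iff isCont_def)
  moreover have "\<forall>\<^sub>F z in at x. ((h z - h x) / (z - x)) / \<phi> (g z) = (g z - g x) / (z - x)"
    using nz lift[unfolded eventually_nhds_conv_at, THEN conjunct1] eventually_neq_at_within[of x]
  proof eventually_elim
    case (elim z)
    have "h z - h x = \<phi> (g z) * (g z - g x)"
      using \<phi>(1)[of "g z"] elim hx by simp
    then show ?case using elim by simp
  qed
  ultimately show ?thesis
    unfolding has_field_derivative_iff by (rule Lim_transform_eventually)
qed

text \<open>A continuous logarithm of \<open>w powi k\<close> is a primitive of
  \<open>k / w\<close>, but the integral of \<open>k / w\<close> over a circle around 0 is 2 pi i
  k.\<close>

lemma powi_log_at_infinity_imp_0:
  fixes K :: "complex \<Rightarrow> complex" and k :: int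
  assumes cont: "continuous_on {w. norm w > R} K"
    and eq: "\<And>w. norm w > R \<Longrightarrow> w powi k = exp (K w)"
  shows "k = 0"
proof -
  define \<rho> where "\<rho> = \<bar>R\<bar> + 1"
  have \<rho>: "\<rho> > 0" "\<rho> > R" by (auto simp: \<rho>_def)
  have op: "open {w::complex. norm w > R}"
    by (intro open_Collect_less continuous_intros)
  have der: "(K has_field_derivative (of_int k / w)) (at w)" if w: "norm w > R" "w \<noteq> 0" for w
  proof -
    have "(K has_field_derivative (of_int k * w powi (k - 1) * 1) / exp (K w)) (at w)"
    proof (rule has_field_derivative_lift)
      show "isCont K w"
        using cont op w by (simp add: continuous_on_eq_continuous_at)
      show "(exp has_field_derivative exp (K w)) (at (K w))" by (rule DERIV_exp)
      show "((\<lambda>w. w powi k) has_field_derivative of_int k * w powi (k - 1) * 1) (at w)"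
        by (rule DERIV_power_int) (auto simp: w)
      show "\<forall>\<^sub>F z in nhds w. exp (K z) = z powi k"
        using eventually_nhds_in_open[OF op, of w] w by (auto simp: eq elim!: eventually_mono)
    qed auto
    also have "(of_int k * w powi (k - 1) * 1) / exp (K w) = of_int k / w"
      using eq[OF w(1), symmetric] w(2) by (simp add: power_int_diff)
    finally show ?thesis .
  qed
  have 1: "((\<lambda>w. of_int k / (w - 0)) has_contour_integral 0) (circlepath 0 \<rho>)"
  proof (rule Cauchy_theorem_primitive)
    show "(K has_field_derivative (of_int k / (w - 0))) (at w within sphere 0 \<rho>)" if "w \<in> sphere 0 \<rho>" for w
      using der[of w] that \<rho> by (auto intro: has_field_derivative_at_within)
  qed (use \<rho> in auto)
  have "((\<lambda>w. of_int k / (w - 0)) has_contour_integral (2 * of_real pi * \<i> * of_int k)) (circlepath 0 \<rho>)"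
    using \<rho> by (intro Cauchy_integral_circlepath_simple[of "\<lambda>_. of_int k"]) auto
  then have "(2 * of_real pi * \<i> * of_int k) = (0::complex)"
    by (rule has_contour_integral_unique[OF _ 1])
  then show ?thesis by simp
qed

text \<open>The winding number of \<open>f\<close> along small circles around \<open>s\<close>. The
  value \<open>f s\<close> does not enter, so \<open>s\<close> may be a zero, a pole or a
  discontinuity.\<close>

definition index_at :: "(complex \<Rightarrow> complex) \<Rightarrow> complex \<Rightarrow> int \<Rightarrow> bool"
  where "index_at f s m \<longleftrightarrow> (\<exists>e>0. \<exists>L. continuous_on (ball s e - {s}) L \<and>
    (\<forall>w\<in>ball s e - {s}. f w = (w - s) powi m * exp (L w)))"

definition index_at_infinity :: "(complex \<Rightarrow> complex) \<Rightarrow> int \<Rightarrow> bool"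
  where "index_at_infinity f m \<longleftrightarrow> (\<exists>R L. continuous_on {w. norm w > R} L \<and>
    (\<forall>w. norm w > R \<longrightarrow> f w = w powi m * exp (L w)))"

text \<open>A nonvanishing continuous function on a disc has a continuous logarithm, which is
  absorbed into \<open>L\<close>.\<close>

lemma index_at_mult_nonvanishing:
  assumes f: "index_at f s m" and "e > 0" and g: "continuous_on (ball s e) g"
    and "\<And>w. w \<in> ball s e \<Longrightarrow> g w \<noteq> 0"
    and h: "\<And>w. w \<in> ball s e - {s} \<Longrightarrow> h w = f w * g w"
  shows "index_at h s m"
proof -
  obtain L where L: "continuous_on (ball s e) L" "\<And>w. w \<in> ball s e \<Longrightarrow> g w = exp (L w)"
    using continuous_logarithm_on_ball[OF g] assms(4) by blast
  obtain e' L' where e': "e' > 0" "continuous_on (ball s e' - {s}) L'"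
    "\<And>w. w \<in> ball s e' - {s} \<Longrightarrow> f w = (w - s) powi m * exp (L' w)"
    using f unfolding index_at_def by blast
  have "continuous_on (ball s (min e e') - {s}) (\<lambda>w. L w + L' w)"
    by (intro continuous_intros continuous_on_subset[OF L(1)] continuous_on_subset[OF e'(2)]) auto
  moreover have "h w = (w - s) powi m * exp (L w + L' w)" if "w \<in> ball s (min e e') - {s}" for w
    using that h[of w] L(2)[of w] e'(3)[of w] by (simp add: exp_add)
  ultimately show ?thesis
    unfolding index_at_def using \<open>e > 0\<close> e'(1) by (intro exI[of _ "min e e'"]) auto
qed

text \<open>For \<open>norm w > norm s\<close> the number \<open>1 - s / w\<close> stays in the
  right half-plane, so its principal logarithm turns \<open>(w - s) powi k\<close> into
  \<open>w powi k\<close> times an exponential.\<close>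

lemma index_at_infinity_mult_powi:
  assumes "index_at_infinity f M" and h: "\<And>w. norm w > B \<Longrightarrow> h w = f w * (w - s) powi k"
  shows "index_at_infinity h (M + k)"
proof -
  obtain R L where R: "continuous_on {w. norm w > R} L"
    "\<And>w. norm w > R \<Longrightarrow> f w = w powi M * exp (L w)"
    using assms(1) unfolding index_at_infinity_def by blast
  define R' where "R' = Max {R, B, norm s}"
  have R': "norm w > R" "norm w > B" "norm w > norm s" "w \<noteq> 0" if "norm w > R'" for w
    using that by (auto simp: R'_def)
  have Re: "Re (1 - s / w) > 0" if "norm w > R'" for w
  proof -
    have "\<bar>Re (s / w)\<bar> \<le> norm (s / w)" by (rule abs_Re_le_cmod)
    also have "\<dots> < 1" using R'(3,4)[OF that] by (simp add: norm_divide)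
    finally show ?thesis by simp
  qed
  let ?L = "\<lambda>w. L w + of_int k * Ln (1 - s / w)"
  have "continuous_on {w. norm w > R'} ?L"
    using R'(1,4) Re 
    by (intro continuous_intros continuous_on_subset[OF R(1)])
      (fastforce simp: complex_nonpos_Reals_iff)+
  moreover have "h w = w powi (M + k) * exp (?L w)" if "norm w > R'" for w
  proof -
    note w = R'[OF that]
    have ne: "1 - s / w \<noteq> 0" using Re[OF that] by (metis less_irrefl zero_complex.sel(1))
    have "exp (of_int k * Ln (1 - s / w)) = (1 - s / w) powi k"
      using ne by (simp flip: exp_power_int)
    moreover have "(w - s) powi k = w powi k * (1 - s / w) powi k"
      using w(4) by (simp flip: power_int_mult_distrib add: right_diff_distrib)
    ultimately show ?thesis
      using h[OF w(2)] R(2)[OF w(1)] w(4) by (simp add: exp_add power_int_add)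
  qed
  ultimately show ?thesis unfolding index_at_infinity_def by blast
qed

text \<open>Dividing by \<open>(w - s)\<^sup>m\<close> leaves a function with a logarithm around \<open>s\<close>; cutting this logarithm
  off removes the zero or singularity.\<close>

lemma index_at_remove:
  assumes ind: "index_at f s m" and S: "finite S" "s \<notin> S"
    and cont: "continuous_on (- insert s S) f" and nz: "\<And>w. w \<notin> insert s S \<Longrightarrow> f w \<noteq> 0"
  obtains h e where "e > 0" "cball s e \<inter> S = {}" "continuous_on (- S) h" "\<And>w. w \<notin> S \<Longrightarrow> h w \<noteq> 0"
    "\<And>w. w \<notin> ball s e \<Longrightarrow> h w = f w * (w - s) powi (- m)"
proof -
  obtain e0 L where e0: "e0 > 0" "continuous_on (ball s e0 - {s}) L"
    "\<And>w. w \<in> ball s e0 - {s} \<Longrightarrow> f w = (w - s) powi m * exp (L w)"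
    using ind unfolding index_at_def by blast
  obtain e1 where e1: "e1 > 0" "\<forall>x\<in>S. x \<noteq> s \<longrightarrow> e1 \<le> dist s x"
    using finite_set_avoid[OF S(1), of s] by blast
  define e where "e = min e0 e1 / 2"
  have e: "e > 0" "e \<le> e0" "cball s e \<inter> S = {}"
    using e0 e1 S(2) by (force simp: e_def)+
  \<comment> \<open>A cutoff equal to 0 up to distance \<open>e / 4\<close> and to 1 from
    \<open>e / 2\<close> on. Thus \<open>h\<close> is 1 near \<open>s\<close>, whatever
    \<open>L\<close> is at \<open>s\<close>, and agrees with the quotient beyond
    \<open>e / 2\<close>.\<close>
  define \<phi> :: "complex \<Rightarrow> real" where "\<phi> w = max 0 (min 1 (4 * dist s w / e - 1))" for w
  have \<phi>0: "\<phi> w = 0" if "dist s w < e / 4" for w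
    using that e by (simp add: \<phi>_def field_simps)
  have \<phi>1: "\<phi> w = 1" if "dist s w > e / 2" for w
    using that e by (simp add: \<phi>_def field_simps)
  define h where "h w = (if w \<in> ball s e then exp (\<phi> w * L w) else f w * (w - s) powi (- m))" for w
  have h_out: "h w = f w * (w - s) powi (- m)" if "dist s w > e / 2" for w
    using that e e0(3)[of w] \<phi>1[of w] by (cases "w = s") (auto simp: h_def power_int_minus field_simps)
  have "continuous_on (- S) h"
  proof (rule continuous_at_imp_continuous_on, rule ballI)
    fix w assume w: "w \<in> - S"
    consider "dist s w < e / 4" | "dist s w > e / 2" | "w \<in> ball s e - {s}"
      using e by force
    then show "isCont h w"
    proof cases
      case 1
      have "\<forall>\<^sub>F z in nhds w. z \<in> ball s (e / 4)"
        using 1 by (intro eventually_nhds_in_open) auto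
      then have "\<forall>\<^sub>F z in nhds w. h z = 1"
        using e by (auto simp: h_def \<phi>0 elim!: eventually_mono)
      then show ?thesis
        by (subst isCont_cong[where g = "\<lambda>_. 1"]) auto
    next
      case 2
      have o: "open (- cball s (e / 2) - S)" using S by (auto intro: open_Diff finite_imp_closed)
      have "continuous_on (- cball s (e / 2) - S) (\<lambda>w. f w * (w - s) powi (- m))"
        using e by (intro continuous_intros continuous_on_subset[OF cont]) auto
      then have "isCont (\<lambda>w. f w * (w - s) powi (- m)) w"
        using 2 w o by (auto simp: continuous_on_eq_continuous_at)
      moreover have "\<forall>\<^sub>F z in nhds w. z \<in> - cball s (e / 2)"
        using 2 by (intro eventually_nhds_in_open) auto
      then have "\<forall>\<^sub>F z in nhds w. h z = f z * (z - s) powi (- m)"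
        by (rule eventually_mono) (auto intro!: h_out)
      ultimately show ?thesis by (simp add: isCont_cong)
    next
      case 3
      have "continuous_on (ball s e - {s}) (\<lambda>w. exp (\<phi> w * L w))"
        using e unfolding \<phi>_def by (intro continuous_intros continuous_on_subset[OF e0(2)]) auto
      then have "isCont (\<lambda>w. exp (\<phi> w * L w)) w"
        using 3 by (subst (asm) continuous_on_eq_continuous_at) (auto intro: open_Diff)
      moreover have "\<forall>\<^sub>F z in nhds w. z \<in> ball s e"
        using 3 by (intro eventually_nhds_in_open) auto
      then have "\<forall>\<^sub>F z in nhds w. h z = exp (\<phi> z * L z)"
        by (rule eventually_mono) (auto simp: h_def)
      ultimately show ?thesis by (simp add: isCont_cong)
    qed
  qed
  moreover have "h w \<noteq> 0" if "w \<notin> S" for w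
    using that nz[of w] e by (cases "w = s") (auto simp: h_def)
  ultimately show ?thesis
    using that e by (auto simp: h_def)
qed

lemma index_at_cong:
  assumes "index_at f s m" "e > 0" "\<And>w. w \<in> ball s e - {s} \<Longrightarrow> h w = f w"
  shows "index_at h s m"
  using assms by (intro index_at_mult_nonvanishing[OF assms(1,2), of "\<lambda>_. 1"]) auto

text \<open>The argument principle, by induction over the points. Removing \<open>s\<close> divides
  \<open>f\<close> by \<open>(w - s) powi m s\<close> outside a small disc: the other indices stay
  and the index at infinity drops by \<open>m s\<close>. Once no point is left, \<open>f\<close> has
  a logarithm on the whole plane, so its index at infinity is 0.\<close>

theorem sum_index_eq_index_at_infinity:
  assumes "finite S" "continuous_on (- S) f" "\<And>w. w \<notin> S \<Longrightarrow> f w \<noteq> 0"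
    and "\<And>s. s \<in> S \<Longrightarrow> index_at f s (m s)" and "index_at_infinity f M"
  shows "(\<Sum>s\<in>S. m s) = M"
  using assms
proof (induction S arbitrary: f M)
  case empty
  then obtain L where L: "continuous_on UNIV L" "\<And>w. f w = exp (L w)"
    using continuous_logarithm_on_contractible[of UNIV f] convex_imp_contractible by auto
  obtain R K where K: "continuous_on {w. norm w > R} K"
    "\<And>w. norm w > R \<Longrightarrow> f w = w powi M * exp (K w)"
    using empty(4) unfolding index_at_infinity_def by blast
  have "M = 0"
  proof (rule powi_log_at_infinity_imp_0)
    show "continuous_on {w. norm w > R} (\<lambda>w. L w - K w)"
      by (intro continuous_intros K continuous_on_subset[OF L(1)]) auto
    show "w powi M = exp (L w - K w)" if "norm w > R" for w
      using K(2)[OF that] L(2)[of w] by (simp add: exp_diff)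
  qed
  then show ?case by simp
next
  case (insert s S)
  obtain h e where h: "e > 0" "cball s e \<inter> S = {}" "continuous_on (- S) h"
    "\<And>w. w \<notin> S \<Longrightarrow> h w \<noteq> 0" "\<And>w. w \<notin> ball s e \<Longrightarrow> h w = f w * (w - s) powi (- m s)"
    using index_at_remove[of f s "m s" S] insert by (metis insertI1)
  have "(\<Sum>s\<in>S. m s) = M + (- m s)"
  proof (rule insert.IH[OF h(3,4)])
    show "index_at h t (m t)" if t: "t \<in> S" for t
    proof -
      have ts: "dist s t > e" using t h(2) by (auto simp: disjoint_iff not_le)
      have "index_at (\<lambda>w. f w * (w - s) powi (- m s)) t (m t)"
        by (rule index_at_mult_nonvanishing[where f = f and e = "dist s t" and g = "\<lambda>w. (w - s) powi (- m s)"])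
          (use t insert ts h(1) in \<open>auto intro!: continuous_intros simp: dist_commute\<close>)
      then show ?thesis
      proof (rule index_at_cong)
        show "h w = f w * (w - s) powi (- m s)" if "w \<in> ball t (dist s t - e) - {t}" for w
          using that dist_triangle[of s t w] by (intro h(5)) (auto simp: dist_commute)
      qed (use ts in auto)
    qed
    show "index_at_infinity h (M + - m s)"
    proof (rule index_at_infinity_mult_powi[OF insert.prems(4), of "norm s + e"])
      fix w :: complex assume "norm w > norm s + e"
      then have "w \<notin> ball s e" 
        by (smt (verit) dist_commute dist_norm mem_ball norm_triangle_sub)
      then show "h w = f w * (w - s) powi (- m s)" by (rule h(5))
    qed
  qed
  then show ?case using insert by simp
qed

section \<open>Local indices and index at infinity of \<open>cnj w * q w - p w\<close>\<close>

lemma exp_of_real_ln: "x > 0 \<Longrightarrow> exp (of_real (ln x) :: complex) = of_real x"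
  by (simp add: exp_of_real)

lemma poly_eq_sum_of_degree_le:
  fixes r :: "complex poly"
  assumes "degree r \<le> n"
  shows "poly r w = (\<Sum>i\<le>n. coeff r i * w ^ i)"
  unfolding poly_altdef using assms
  by (intro sum.mono_neutral_left) (auto simp: coeff_eq_0)

text \<open>Since \<open>\<alpha>\<close> dominates \<open>\<beta>\<close>, the quotient of
  \<open>f\<close> by \<open>\<alpha> * (w - a)\<close> stays within distance 1 of 1 near
  \<open>a\<close> and has a principal logarithm there.\<close>

lemma index_at_1:
  assumes der: "(f has_derivative (\<lambda>v. \<alpha> * v + \<beta> * cnj v)) (at a)" and "f a = 0"
    and "norm \<beta> < norm \<alpha>" and cont: "continuous_on UNIV f"
  shows "index_at f a 1"
proof -
  \<comment> \<open>Half of the gap, so that the linearization error together with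
    \<open>\<beta>\<close> still stays below \<open>\<alpha>\<close>.\<close>
  define \<eta> where "\<eta> = (norm \<alpha> - norm \<beta>) / 2"
  have \<eta>: "\<eta> > 0" "norm \<beta> + \<eta> < norm \<alpha>" using assms(3) by (auto simp: \<eta>_def field_simps)
  have \<alpha>: "\<alpha> \<noteq> 0" using assms(3) by auto
  obtain e where e: "e > 0" and lin: "\<And>w. norm (w - a) < e \<Longrightarrow>
      norm (f w - f a - (\<alpha> * (w - a) + \<beta> * cnj (w - a))) \<le> \<eta> * norm (w - a)"
    using der \<eta>(1) unfolding has_derivative_at_alt by blast
  let ?q = "\<lambda>w. f w / (\<alpha> * (w - a))"
  have Re: "Re (?q w) > 0" if w: "w \<in> ball a e - {a}" for w
  proof -
    have w': "norm (w - a) < e" "w \<noteq> a" using w by (auto simp: dist_norm norm_minus_commute)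
    have "norm (f w - \<alpha> * (w - a)) \<le> norm (f w - (\<alpha> * (w - a) + \<beta> * cnj (w - a))) + norm (\<beta> * cnj (w - a))"
      by (rule order_trans[OF _ norm_triangle_ineq]) (simp add: algebra_simps)
    also have "\<dots> \<le> \<eta> * norm (w - a) + norm \<beta> * norm (w - a)"
      using lin[OF w'(1)] assms(2) complex_mod_cnj[of "w - a"] by (simp add: norm_mult)
    also have "\<dots> < norm (\<alpha> * (w - a))"
      using \<eta>(2) w'(2) by (simp add: norm_mult flip: distrib_right)
    finally have "norm (f w - \<alpha> * (w - a)) / norm (\<alpha> * (w - a)) < 1"
      using w'(2) \<alpha> by simp
    moreover have "?q w - 1 = (f w - \<alpha> * (w - a)) / (\<alpha> * (w - a))"
      using w'(2) \<alpha> by (simp add: field_simps)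
    ultimately have "norm (?q w - 1) < 1"
      by (simp add: norm_divide)
    then show ?thesis
      using abs_Re_le_cmod[of "?q w - 1"] by simp
  qed
  have q0: "?q w \<noteq> 0" if "w \<in> ball a e - {a}" for w
    using Re[OF that] by (metis less_irrefl zero_complex.sel(1))
  let ?L = "\<lambda>w. Ln (?q w) + Ln \<alpha>"
  have "continuous_on (ball a e - {a}) ?L"
    using Re \<alpha> by (intro continuous_intros continuous_on_subset[OF cont])
      (fastforce simp: complex_nonpos_Reals_iff)+
  moreover have "f w = (w - a) powi 1 * exp (?L w)" if "w \<in> ball a e - {a}" for w
    using q0[OF that] \<alpha> that by (simp add: exp_add)
  ultimately show ?thesis
    unfolding index_at_def using e by blast
qed

text \<open>Conjugation exchanges the roles of \<open>\<alpha>\<close> and \<open>\<beta>\<close>.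
  Conjugating back, \<open>cnj (w - a)\<close> is \<open>1 / (w - a)\<close> times
  \<open>(norm (w - a))\<^sup>2\<close>, and the latter has a real logarithm.\<close>

lemma index_at_minus_1:
  assumes der: "(f has_derivative (\<lambda>v. \<alpha> * v + \<beta> * cnj v)) (at a)" and "f a = 0"
    and "norm \<alpha> < norm \<beta>" and cont: "continuous_on UNIV f"
  shows "index_at f a (- 1)"
proof -
  have "index_at (\<lambda>w. cnj (f w)) a 1"
  proof (rule index_at_1)
    show "((\<lambda>w. cnj (f w)) has_derivative (\<lambda>v. cnj \<beta> * v + cnj \<alpha> * cnj v)) (at a)"
      using has_derivative_cnj[OF der] by (simp add: add.commute)
  qed (use assms in \<open>auto intro!: continuous_intros\<close>)
  then obtain e L where e: "e > 0" "continuous_on (ball a e - {a}) L"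
    "\<And>w. w \<in> ball a e - {a} \<Longrightarrow> cnj (f w) = (w - a) powi 1 * exp (L w)"
    unfolding index_at_def by blast
  let ?L = "\<lambda>w. cnj (L w) + of_real (ln ((norm (w - a))\<^sup>2))"
  have "continuous_on (ball a e - {a}) ?L"
    by (intro continuous_intros e) auto
  moreover have "f w = (w - a) powi (- 1) * exp (?L w)" if w: "w \<in> ball a e - {a}" for w
  proof -
    have "f w = cnj (cnj (f w))" by simp
    also have "\<dots> = cnj (w - a) * exp (cnj (L w))"
      using e(3)[OF w] by (simp add: exp_cnj)
    also have "cnj (w - a) = (w - a) powi (- 1) * of_real ((norm (w - a))\<^sup>2)"
      using w unfolding complex_norm_square[of "w - a"] by (simp add: power_int_minus)
    also have "of_real ((norm (w - a))\<^sup>2) = exp (of_real (ln ((norm (w - a))\<^sup>2)) :: complex)"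
      using w by (intro exp_of_real_ln[symmetric]) auto
    finally show ?thesis by (simp add: exp_add mult_ac)
  qed
  ultimately show ?thesis
    unfolding index_at_def using e(1) by blast
qed

definition wronskian :: "complex poly \<Rightarrow> complex poly \<Rightarrow> complex poly"
  where "wronskian p q = pderiv p * q - p * pderiv q"

text \<open>The zeros of \<open>cnj w * q w - p w\<close> are the solutions of \<open>p w / q w = cnj w\<close>, the poles having
  been cleared.\<close>

definition hpoly :: "complex poly \<Rightarrow> complex poly \<Rightarrow> complex \<Rightarrow> complex"
  where "hpoly p q w = cnj w * poly q w - poly p w"

lemma continuous_on_hpoly [continuous_intros]:
  "continuous_on S g \<Longrightarrow> continuous_on S (\<lambda>x. hpoly p q (g x))"
  unfolding hpoly_def by (intro continuous_intros)

lemma has_derivative_hpoly: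
  "(hpoly p q has_derivative
    (\<lambda>v. (cnj a * poly (pderiv q) a - poly (pderiv p) a) * v + poly q a * cnj v)) (at a)"
proof -
  have q: "(poly q has_derivative (\<lambda>v. poly (pderiv q) a * v)) (at a)" for q :: "complex poly"
    using poly_DERIV[of q a] by (simp add: has_field_derivative_def)
  show ?thesis
    unfolding hpoly_def by (auto intro!: derivative_eq_intros q simp: algebra_simps)
qed

text \<open>Links the two real-linear coefficients in \<open>has_derivative_hpoly\<close> with the
  derivative of \<open>p / q\<close>: comparing the norm of the first with that of
  \<open>poly q a\<close> amounts to comparing the norm of \<open>(p / q)'\<close> with 1.\<close>

lemma hpoly_zero_wronskian:
  assumes "hpoly p q a = 0"
  shows "poly q a * (cnj a * poly (pderiv q) a - poly (pderiv p) a) = - poly (wronskian p q) a"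
  using assms by (simp add: hpoly_def wronskian_def algebra_simps)

lemma index_at_hpoly:
  assumes "hpoly p q a = 0" "norm (poly (wronskian p q) a) \<noteq> (norm (poly q a))\<^sup>2"
  shows "index_at (hpoly p q) a
    (if norm (poly (wronskian p q) a) > (norm (poly q a))\<^sup>2 then 1 else - 1)"
proof -
  let ?\<alpha> = "cnj a * poly (pderiv q) a - poly (pderiv p) a"
  have "norm (poly q a) * norm ?\<alpha> = norm (poly (wronskian p q) a)"
    using hpoly_zero_wronskian[OF assms(1)] by (metis norm_minus_cancel norm_mult)
  \<comment> \<open>At a common zero of \<open>p\<close> and \<open>q\<close> both sides of the
    second assumption would be 0.\<close>
  moreover have "poly q a \<noteq> 0"
  proof
    assume q: "poly q a = 0"
    then have "poly p a = 0" using assms(1) by (simp add: hpoly_def)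
    then show False using assms(2) q by (simp add: wronskian_def)
  qed
  ultimately have "norm (poly (wronskian p q) a) > (norm (poly q a))\<^sup>2 \<longleftrightarrow> norm ?\<alpha> > norm (poly q a)"
    "norm (poly (wronskian p q) a) < (norm (poly q a))\<^sup>2 \<longleftrightarrow> norm ?\<alpha> < norm (poly q a)"
    by (auto simp: power2_eq_square simp flip: \<open>_ = norm (poly (wronskian p q) a)\<close>)
  then show ?thesis
    using index_at_1[OF has_derivative_hpoly assms(1)] index_at_minus_1[OF has_derivative_hpoly assms(1)]
      assms(2) continuous_on_hpoly[OF continuous_on_id, of UNIV p q] by auto
qed

text \<open>At infinity \<open>cnj w * poly q w\<close> has order \<open>n + 1\<close> and
  \<open>p\<close> has order at most \<open>n\<close>, so the leading term of \<open>q\<close> times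
  \<open>cnj w\<close> governs.\<close>

lemma hpoly_asymptotics:
  assumes "degree p \<le> n" "degree q = n" "q \<noteq> 0"
  obtains R where "R > 0" "\<And>w. norm w > R \<Longrightarrow> norm (hpoly p q w / (lead_coeff q * cnj w * w ^ n) - 1) < 1"
proof -
  have tend: "((\<lambda>w. poly r w / w ^ n) \<longlongrightarrow> coeff r n) at_infinity" if "degree r \<le> n" for r :: "complex poly"
  proof -
    have "((\<lambda>w. \<Sum>i\<le>n. coeff r i * (if i = n then 1 else (1 / w) ^ (n - i))) \<longlongrightarrow>
        (\<Sum>i\<le>n. coeff r i * (if i = n then 1 else 0))) at_infinity"
    proof (intro tendsto_intros)
      fix i assume i: "i \<in> {..n}"
      show "((\<lambda>w::complex. if i = n then 1 else (1 / w) ^ (n - i)) \<longlongrightarrow> (if i = n then 1 else 0)) at_infinity"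
      proof (cases "i = n")
        case False
        have "((\<lambda>w::complex. (1 / w) ^ (n - i)) \<longlongrightarrow> 0 ^ (n - i)) at_infinity"
          by (intro tendsto_intros tendsto_divide_0[OF tendsto_const] filterlim_ident)
        then show ?thesis using False i by (simp add: zero_power)
      qed auto
    qed
    also have "(\<Sum>i\<le>n. coeff r i * (if i = n then 1 else 0)) = coeff r n"
      by (simp add: if_distrib cong: if_cong)
    finally show ?thesis
    proof (rule Lim_transform_eventually)
      have "\<forall>\<^sub>F w::complex in at_infinity. w \<noteq> 0"
        by (rule eventually_not_equal_at_infinity)
      then show "\<forall>\<^sub>F w in at_infinity. (\<Sum>i\<le>n. coeff r i * (if i = n then 1 else (1 / w) ^ (n - i))) = poly r w / w ^ n"
      proof eventually_elim
        case (elim w)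
        have "poly r w = (\<Sum>i\<le>n. coeff r i * w ^ i)"
          using that by (rule poly_eq_sum_of_degree_le)
        moreover have "w ^ i / w ^ n = (if i = n then 1 else (1 / w) ^ (n - i))" if "i \<le> n" for i
          using that elim by (auto simp: power_diff power_one_over field_simps)
        ultimately show ?case
          by (simp add: sum_divide_distrib flip: times_divide_eq_right)
      qed
    qed
  qed
  have inv: "((\<lambda>w::complex. inverse (cnj w)) \<longlongrightarrow> 0) at_infinity"
  proof -
    have "((\<lambda>w::complex. cnj (inverse w)) \<longlongrightarrow> cnj 0) at_infinity"
      by (intro tendsto_intros tendsto_inverse_0)
    then show ?thesis by simp
  qed
  have "((\<lambda>w. (poly q w / w ^ n) / lead_coeff q - (poly p w / w ^ n) * inverse (cnj w) / lead_coeff q - 1) \<longlongrightarrow>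
      coeff q n / lead_coeff q - coeff p n * 0 / lead_coeff q - 1) at_infinity"
    using assms by (intro tendsto_intros tend inv) auto
  then have "((\<lambda>w. (poly q w / w ^ n) / lead_coeff q - (poly p w / w ^ n) * inverse (cnj w) / lead_coeff q - 1) \<longlongrightarrow> 0) at_infinity"
    using assms(2,3) leading_coeff_0_iff[of q] by simp
  then have "\<forall>\<^sub>F w in at_infinity. norm ((poly q w / w ^ n) / lead_coeff q - (poly p w / w ^ n) * inverse (cnj w) / lead_coeff q - 1) < 1"
    by (auto dest!: tendstoD[where e = 1])
  then obtain R where R: "\<And>w. norm w \<ge> R \<Longrightarrow> norm ((poly q w / w ^ n) / lead_coeff q - (poly p w / w ^ n) * inverse (cnj w) / lead_coeff q - 1) < 1"
    unfolding eventually_at_infinity by blast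
  show ?thesis
  proof (rule that[of "\<bar>R\<bar> + 1"])
    fix w :: complex assume w: "norm w > \<bar>R\<bar> + 1"
    then have "w \<noteq> 0" by auto
    moreover have "coeff q n \<noteq> 0" using assms(2,3) leading_coeff_0_iff[of q] by simp
    ultimately have "hpoly p q w / (lead_coeff q * cnj w * w ^ n) =
        (poly q w / w ^ n) / lead_coeff q - (poly p w / w ^ n) * inverse (cnj w) / lead_coeff q"
      using assms by (simp add: hpoly_def field_simps)
    then show "norm (hpoly p q w / (lead_coeff q * cnj w * w ^ n) - 1) < 1"
      using R[of w] w by simp
  qed auto
qed

lemma bounded_hpoly_zeros:
  assumes "degree p \<le> n" "degree q = n" "q \<noteq> 0"
  shows "bounded {w. hpoly p q w = 0}"
proof -
  obtain R where R: "\<And>w. norm w > R \<Longrightarrow> norm (hpoly p q w / (lead_coeff q * cnj w * w ^ n) - 1) < 1"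
    using hpoly_asymptotics[OF assms] by metis
  show ?thesis
    unfolding bounded_iff using R by (intro exI[of _ R]) (force simp: not_less[symmetric])
qed

text \<open>The dominating term is \<open>lead_coeff q * cnj w * w ^ n\<close>, and
  \<open>cnj w\<close> is \<open>(norm w)\<^sup>2 / w\<close>: the power contributes
  \<open>n\<close>, the conjugate \<open>- 1\<close>.\<close>

lemma index_at_infinity_hpoly:
  assumes "degree p \<le> n" "degree q = n" "q \<noteq> 0"
  shows "index_at_infinity (hpoly p q) (int n - 1)"
proof -
  let ?c = "lead_coeff q"
  obtain R where R: "R > 0" "\<And>w. norm w > R \<Longrightarrow> norm (hpoly p q w / (?c * cnj w * w ^ n) - 1) < 1"
    using hpoly_asymptotics[OF assms] by metis
  let ?q = "\<lambda>w. hpoly p q w / (?c * cnj w * w ^ n)"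
  have Re: "Re (?q w) > 0" if "norm w > R" for w
    using R(2)[OF that] abs_Re_le_cmod[of "?q w - 1"] by simp
  have q0: "?q w \<noteq> 0" if "norm w > R" for w
    using Re[OF that] by (metis less_irrefl zero_complex.sel(1))
  let ?L = "\<lambda>w. Ln (?q w) + Ln ?c + of_real (ln ((norm w)\<^sup>2))"
  have "continuous_on {w. norm w > R} ?L"
    using Re R(1) assms(3) by (intro continuous_intros)
      (fastforce simp: complex_nonpos_Reals_iff)+
  moreover have "hpoly p q w = w powi (int n - 1) * exp (?L w)" if w: "norm w > R" for w
  proof -
    have w0: "w \<noteq> 0" using w R(1) by auto
    have "exp (of_real (ln ((norm w)\<^sup>2)) :: complex) = of_real ((norm w)\<^sup>2)"
      using w0 by (intro exp_of_real_ln) auto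
    also have "\<dots> = w * cnj w" by (rule complex_norm_square)
    finally have E: "exp (?L w) = ?q w * ?c * (w * cnj w)"
      using q0[OF w] assms(3) by (simp add: exp_add)
    have K: "w powi (int n - 1) = w ^ n / w"
      using w0 by (simp add: power_int_diff)
    show ?thesis
      unfolding E K using w0 assms(3) by (simp add: field_simps)
  qed
  ultimately show ?thesis unfolding index_at_infinity_def by blast
qed

text \<open>The zeros form a compact set, and none of them is an accumulation point, because a
  function with an index at \<open>a\<close> does not vanish in a punctured disc around
  \<open>a\<close>.\<close>

lemma finite_hpoly_zeros:
  assumes "degree p \<le> n" "degree q = n" "q \<noteq> 0"
    and nd: "\<And>w. hpoly p q w = 0 \<Longrightarrow> norm (poly (wronskian p q) w) \<noteq> (norm (poly q w))\<^sup>2"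
  shows "finite {w. hpoly p q w = 0}"
proof (rule ccontr)
  let ?Z = "{w. hpoly p q w = 0}"
  assume "infinite ?Z"
  moreover have "compact ?Z"
  proof -
    have "closed ?Z" by (intro closed_Collect_eq continuous_intros)
    then show ?thesis using bounded_hpoly_zeros[OF assms(1-3)] by (simp add: compact_eq_bounded_closed)
  qed
  ultimately obtain a where a: "a \<in> ?Z" "a islimpt ?Z"
    using Heine_Borel_imp_Bolzano_Weierstrass[of ?Z ?Z] by auto
  obtain m where "index_at (hpoly p q) a m"
    using index_at_hpoly a(1) nd by blast
  then obtain e L where e: "e > 0" "\<And>w. w \<in> ball a e - {a} \<Longrightarrow> hpoly p q w = (w - a) powi m * exp (L w)"
    unfolding index_at_def by blast
  obtain w where "w \<in> ?Z" "w \<noteq> a" "dist w a < e"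
    using a(2) e(1) unfolding islimpt_approachable by blast
  then show False using e(2)[of w] by (auto simp: dist_commute)
qed

theorem card_hpoly_zeros_saddle:
  assumes "degree p \<le> n" "degree q = n" "q \<noteq> 0"
    and nd: "\<And>w. hpoly p q w = 0 \<Longrightarrow> norm (poly (wronskian p q) w) \<noteq> (norm (poly q w))\<^sup>2"
  shows "int (card {w. hpoly p q w = 0 \<and> norm (poly (wronskian p q) w) > (norm (poly q w))\<^sup>2}) =
    int (card {w. hpoly p q w = 0 \<and> norm (poly (wronskian p q) w) < (norm (poly q w))\<^sup>2}) + (int n - 1)"
proof -
  let ?Z = "{w. hpoly p q w = 0}"
  let ?P = "\<lambda>w. norm (poly (wronskian p q) w) > (norm (poly q w))\<^sup>2"
  have fin: "finite ?Z" by (rule finite_hpoly_zeros[OF assms])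
  have "(\<Sum>w\<in>?Z. if ?P w then 1 else - 1) = int n - 1"
  proof (rule sum_index_eq_index_at_infinity[OF fin])
    show "index_at_infinity (hpoly p q) (int n - 1)"
      by (rule index_at_infinity_hpoly[OF assms(1-3)])
    show "index_at (hpoly p q) s (if ?P s then 1 else - 1)" if "s \<in> ?Z" for s
      using that nd by (intro index_at_hpoly) auto
  qed (auto intro!: continuous_intros)
  moreover have "(\<Sum>w\<in>?Z. if ?P w then 1 else - 1) = int (card (?Z \<inter> {w. ?P w})) - int (card (?Z \<inter> - {w. ?P w}))"
    using fin by (simp add: sum.If_cases)
  moreover have "?Z \<inter> - {w. ?P w} = {w. hpoly p q w = 0 \<and> norm (poly (wronskian p q) w) < (norm (poly q w))\<^sup>2}"
    using nd by force
  moreover have "?Z \<inter> {w. ?P w} = {w. hpoly p q w = 0 \<and> ?P w}" by auto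
  ultimately show ?thesis by simp
qed

section \<open>Attracting fixed points of antiholomorphic rational maps\<close>

lemma card_roots_squarefree:
  fixes g :: "complex poly"
  assumes "\<And>z. poly g z = 0 \<Longrightarrow> poly (pderiv g) z \<noteq> 0"
  shows "card {z. poly g z = 0} = degree g"
proof -
  have sf: "rsquarefree g" using assms by (auto simp: rsquarefree_roots)
  then have "g \<noteq> 0" by (auto simp: rsquarefree_def)
  have "degree g = degree (smult (lead_coeff g) (\<Prod>z|poly g z = 0. [:-z, 1:]))"
    using complex_poly_decompose_rsquarefree[OF sf] by simp
  also have "\<dots> = degree (\<Prod>z|poly g z = 0. [:-z, 1:])"
    using \<open>g \<noteq> 0\<close> by simp
  also have "\<dots> = (\<Sum>z|poly g z = 0. degree [:-z, 1:])"
    by (rule degree_prod_eq_sum_degree) auto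
  finally show ?thesis by simp
qed

text \<open>By \<open>deg_less\<close>, infinity is a fixed point of \<open>p / q\<close> on the
  sphere: orbits through a pole are lost to infinity, and every fibre over a finite value consists
  of \<open>degree p\<close> finite points, counted with multiplicity.\<close>

locale antirational =
  fixes p q :: "complex poly"
  assumes deg_less: "degree q < degree p"
    and no_common_root: "poly p z \<noteq> 0 \<or> poly q z \<noteq> 0"
begin

definition rat :: "complex \<Rightarrow> complex" where "rat z = poly p z / poly q z"

definition F :: "complex \<Rightarrow> complex" where "F z = cnj (rat z)"

text \<open>Poles are excluded explicitly, since division by zero would let \<open>F\<close> send a
  pole to 0 and continue the orbit there.\<close>

definition basin :: "complex \<Rightarrow> complex set"
  where "basin a = {z. (\<forall>k. poly q ((F ^^ k) z) \<noteq> 0) \<and> (\<lambda>k. (F ^^ k) z) \<longlonglongrightarrow> a}"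

definition attracting :: "complex \<Rightarrow> bool"
  where "attracting a \<longleftrightarrow> poly q a \<noteq> 0 \<and> F a = a \<and> norm (poly (wronskian p q) a) < (norm (poly q a))\<^sup>2"

lemma rat_has_field_derivative:
  assumes "poly q z \<noteq> 0"
  shows "(rat has_field_derivative poly (wronskian p q) z / (poly q z)\<^sup>2) (at z)"
  unfolding rat_def using assms
  by (auto intro!: derivative_eq_intros poly_DERIV simp: wronskian_def power2_eq_square)

lemma open_nonpole: "open {z. poly q z \<noteq> 0}"
  by (intro open_Collect_neq continuous_intros)

lemma rat_holomorphic_on: "(\<And>z. z \<in> A \<Longrightarrow> poly q z \<noteq> 0) \<Longrightarrow> rat holomorphic_on A"
  unfolding holomorphic_on_def field_differentiable_def
  using rat_has_field_derivative has_field_derivative_at_within by blast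

lemma rat_eq_iff: "poly q z \<noteq> 0 \<and> rat z = y \<longleftrightarrow> poly (p - smult y q) z = 0"
  using no_common_root[of z] by (auto simp: rat_def field_simps)

lemma degree_fibre: "degree (p - smult y q) = degree p"
  using deg_less by (metis degree_add_eq_left degree_minus degree_smult_le diff_conv_add_uminus le_less_trans)

lemma rat_surj:
  obtains z where "poly q z \<noteq> 0" "rat z = y"
proof -
  have "\<not> constant (poly (p - smult y q))"
    using degree_fibre deg_less by (simp add: constant_degree)
  then show ?thesis using fundamental_theorem_of_algebra that rat_eq_iff by blast
qed

text \<open>The fibre over \<open>y\<close> consists of \<open>degree p\<close> simple roots, which persist nearby and leave no room
  for further preimages.\<close>

lemma covering_space_rat:
  assumes "open T" and crit: "\<And>z. poly q z \<noteq> 0 \<Longrightarrow> rat z \<in> T \<Longrightarrow> poly (wronskian p q) z \<noteq> 0"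
  shows "covering_space {z. poly q z \<noteq> 0 \<and> rat z \<in> T} rat T"
proof -
  define C where "C = {z. poly q z \<noteq> 0 \<and> rat z \<in> T}"
  have cont: "continuous_on A rat" if "A \<subseteq> {z. poly q z \<noteq> 0}" for A
    using that by (intro holomorphic_on_imp_continuous_on rat_holomorphic_on) auto
  have "C = {z. poly q z \<noteq> 0} \<inter> rat -` T" by (auto simp: C_def)
  then have "open C"
    using continuous_open_preimage[OF cont open_nonpole \<open>open T\<close>] by simp
  have "rat ` C = T" 
  proof
    show "T \<subseteq> rat ` C"
    proof
      fix y assume "y \<in> T"
      obtain z where "poly q z \<noteq> 0" "rat z = y" by (rule rat_surj)
      then show "y \<in> rat ` C" using \<open>y \<in> T\<close> by (auto simp: C_def)
    qed
  qed (auto simp: C_def)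
  moreover have "\<exists>V. y \<in> V \<and> openin (top_of_set T) V \<and>
      (\<exists>v. \<Union> v = C \<inter> rat -` V \<and> (\<forall>u\<in>v. openin (top_of_set C) u) \<and> pairwise disjnt v \<and>
        (\<forall>u\<in>v. \<exists>g. homeomorphism u V rat g))" if y: "y \<in> T" for y
  proof -
    define g where "g = p - smult y q"
    define Z where "Z = {z. poly g z = 0}"
    have Z: "poly q z \<noteq> 0" "rat z = y" "z \<in> C" if "z \<in> Z" for z
      using that rat_eq_iff[of z y] y by (auto simp: Z_def g_def C_def)
    have "card Z = degree p"
    proof -
      \<comment> \<open>A zero of \<open>g\<close> satisfies \<open>p = y * q\<close>, hence
        \<open>wronskian p q = q * pderiv g\<close> there, which is nonzero by
        \<open>crit\<close>.\<close>
      have "poly (pderiv g) z \<noteq> 0" if "poly g z = 0" for z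
      proof -
        have z: "z \<in> Z" using that by (simp add: Z_def)
        have "poly (wronskian p q) z = poly q z * poly (pderiv g) z"
          using Z[OF z] by (simp add: wronskian_def g_def pderiv_diff pderiv_smult rat_def field_simps)
        then show ?thesis using crit[of z] Z[OF z] y by auto
      qed
      then show ?thesis
        using card_roots_squarefree[of g] degree_fibre[of y] by (simp add: Z_def g_def)
    qed
    then have finZ: "finite Z" and "Z \<noteq> {}"
      using deg_less card_gt_0_iff by fastforce+
    have "\<exists>e>0. ball z e \<subseteq> C \<and> inj_on rat (ball z e) \<and> (\<forall>x\<in>Z. x \<noteq> z \<longrightarrow> 2 * e \<le> dist z x)" if z: "z \<in> Z" for z
    proof -
      have "deriv rat z \<noteq> 0"
        using rat_has_field_derivative[of z] Z[OF z] crit[of z] y by (auto dest!: DERIV_imp_deriv)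
      then obtain e where e: "e > 0" "ball z e \<subseteq> C" "inj_on rat (ball z e)"
        using has_complex_derivative_locally_injective[of rat C z] rat_holomorphic_on[of C] Z(3)[OF z] \<open>open C\<close>
        by (auto simp: C_def)
      obtain d where d: "d > 0" "\<forall>x\<in>Z. x \<noteq> z \<longrightarrow> d \<le> dist z x"
        using finite_set_avoid[OF finZ] by blast
      show ?thesis
      proof (intro exI[of _ "min e (d / 2)"] conjI ballI impI)
        show "inj_on rat (ball z (min e (d / 2)))" by (rule inj_on_subset[OF e(3)]) auto
      qed (use e d in auto)
    qed
    then obtain e where e: "\<And>z. z \<in> Z \<Longrightarrow> e z > 0" "\<And>z. z \<in> Z \<Longrightarrow> ball z (e z) \<subseteq> C"
      "\<And>z. z \<in> Z \<Longrightarrow> inj_on rat (ball z (e z))"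
      "\<And>z x. z \<in> Z \<Longrightarrow> x \<in> Z \<Longrightarrow> x \<noteq> z \<Longrightarrow> 2 * e z \<le> dist z x"
      by metis
    have disj: "z = x" if "z \<in> Z" "x \<in> Z" "w \<in> ball z (e z)" "w \<in> ball x (e x)" for z x w
    proof (rule ccontr)
      assume "z \<noteq> x"
      then show False
        using e(4)[of z x] e(4)[of x z] that dist_triangle[of z x w] by (auto simp: dist_commute)
    qed
    define V where "V = (\<Inter>z\<in>Z. rat ` ball z (e z)) \<inter> T"
    have "open (rat ` ball z (e z))" if "z \<in> Z" for z
      using e(2)[OF that] by (intro open_mapping_thm3[OF rat_holomorphic_on _ e(3)[OF that]]) (auto simp: C_def)
    then have "open V"
      unfolding V_def using finZ \<open>open T\<close> by (intro open_Int open_INT) auto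
    have "y \<in> V"
      unfolding V_def using y Z(2) e(1) by (force simp: image_iff)
    define u where "u z = ball z (e z) \<inter> rat -` V" for z
    have u: "open (u z)" "u z \<subseteq> C" if "z \<in> Z" for z
    proof -
      have "continuous_on (ball z (e z)) rat" using e(2)[OF that] by (intro cont) (auto simp: C_def)
      then show "open (u z)" unfolding u_def by (rule continuous_open_preimage) (auto simp: \<open>open V\<close>)
      show "u z \<subseteq> C" using e(2)[OF that] unfolding u_def by blast
    qed
    have "\<Union> (u ` Z) = C \<inter> rat -` V"
    proof
      show "\<Union> (u ` Z) \<subseteq> C \<inter> rat -` V" using u(2) by (auto simp: u_def)
      show "C \<inter> rat -` V \<subseteq> \<Union> (u ` Z)"
      proof
        fix w assume w: "w \<in> C \<inter> rat -` V"
        have "\<forall>z\<in>Z. \<exists>x\<in>ball z (e z). rat x = rat w"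
        proof
          fix z assume "z \<in> Z"
          then have "rat w \<in> rat ` ball z (e z)" using w unfolding V_def by blast
          then show "\<exists>x\<in>ball z (e z). rat x = rat w" by (metis imageE)
        qed
        then obtain \<zeta> where \<zeta>: "\<And>z. z \<in> Z \<Longrightarrow> \<zeta> z \<in> ball z (e z)" "\<And>z. z \<in> Z \<Longrightarrow> rat (\<zeta> z) = rat w"
          by metis
        define g' where "g' = p - smult (rat w) q"
        have "g' \<noteq> 0" using degree_fibre[of "rat w"] deg_less by (auto simp: g'_def)
        have g': "poly g' x = 0 \<longleftrightarrow> poly q x \<noteq> 0 \<and> rat x = rat w" for x
          using rat_eq_iff by (simp add: g'_def)
        have "inj_on \<zeta> Z"
          using disj \<zeta>(1) by (metis inj_onI)
        then have "card (\<zeta> ` Z) = degree p" using \<open>card Z = degree p\<close> by (simp add: card_image)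
        moreover have sub: "\<zeta> ` Z \<subseteq> {x. poly g' x = 0}"
          using \<zeta> e(2) by (auto simp: g' C_def subset_iff)
        moreover have "card {x. poly g' x = 0} \<le> degree p"
          using card_poly_roots_bound[OF \<open>g' \<noteq> 0\<close>] degree_fibre[of "rat w"] by (simp add: g'_def)
        ultimately have "\<zeta> ` Z = {x. poly g' x = 0}"
          using poly_roots_finite[OF \<open>g' \<noteq> 0\<close>] card_mono[OF _ sub] by (intro card_subset_eq) auto
        then obtain z where "z \<in> Z" "w = \<zeta> z" using w g'[of w] by (auto simp: C_def)
        then show "w \<in> \<Union> (u ` Z)" using \<zeta>(1)[of z] w by (auto simp: u_def)
      qed
    qed
    moreover have "\<exists>g. homeomorphism (u z) V rat g" if z: "z \<in> Z" for z
    proof -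
      have "V \<subseteq> rat ` ball z (e z)" using z by (auto simp: V_def)
      then have "rat ` u z = V" unfolding u_def by auto
      moreover have "inj_on rat (u z)" by (rule inj_on_subset[OF e(3)[OF z]]) (auto simp: u_def)
      moreover have "continuous_on (u z) rat" using u(2)[OF z] by (intro cont) (auto simp: C_def)
      ultimately show ?thesis
        using invariance_of_domain_homeomorphism[of "u z" rat] u(1)[OF z] by (metis order_refl)
    qed
    moreover have "pairwise disjnt (u ` Z)"
      unfolding pairwise_def disjnt_def u_def using disj by blast
    ultimately show ?thesis
      using \<open>open V\<close> \<open>open C\<close> \<open>y \<in> V\<close> u
      by (intro exI[of _ V] exI[of _ "u ` Z"] conjI) (auto simp: V_def open_subset)
  qed
  ultimately show ?thesis
    unfolding covering_space_def C_def[symmetric] using cont[of C] by (auto simp: C_def)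
qed

text \<open>A disc is simply connected, so \<open>h\<close> lifts through the covering, and the lift
  is holomorphic because \<open>rat\<close> has nonzero derivative along it. The formula for the
  derivative is what makes it grow in Fatou's argument.\<close>

lemma lift_through_rat:
  assumes "open T" and crit: "\<And>z. poly q z \<noteq> 0 \<Longrightarrow> rat z \<in> T \<Longrightarrow> poly (wronskian p q) z \<noteq> 0"
    and h: "h holomorphic_on ball c \<epsilon>" "h ` ball c \<epsilon> \<subseteq> T" and "\<epsilon> > 0"
    and z0: "poly q z0 \<noteq> 0" "rat z0 = h c"
  obtains g where "g holomorphic_on ball c \<epsilon>" "g ` ball c \<epsilon> \<subseteq> {z. poly q z \<noteq> 0 \<and> rat z \<in> T}" "g c = z0"
    "deriv g c = deriv h c / (poly (wronskian p q) z0 / (poly q z0)\<^sup>2)"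
proof -
  let ?C = "{z. poly q z \<noteq> 0 \<and> rat z \<in> T}"
  have c: "c \<in> ball c \<epsilon>" using \<open>\<epsilon> > 0\<close> by simp
  obtain g where g: "continuous_on (ball c \<epsilon>) g" "g \<in> ball c \<epsilon> \<rightarrow> ?C" "g c = z0"
    "\<And>y. y \<in> ball c \<epsilon> \<Longrightarrow> rat (g y) = h y"
  proof (rule covering_space_lift_strong[OF covering_space_rat[OF assms(1) crit], of z0 c "ball c \<epsilon>" h])
    show "z0 \<in> ?C" using z0 h(2) c by auto
    show "simply_connected (ball c \<epsilon>)" by (simp add: convex_imp_simply_connected)
    show "locally path_connected (ball c \<epsilon>)" by (simp add: convex_imp_locally_path_connected)
  qed (use h c z0 in \<open>auto intro: holomorphic_on_imp_continuous_on\<close>)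
  have der: "(g has_field_derivative deriv h z / (poly (wronskian p q) (g z) / (poly q (g z))\<^sup>2)) (at z)"
    if z: "z \<in> ball c \<epsilon>" for z
  proof (rule has_field_derivative_lift)
    have gz: "poly q (g z) \<noteq> 0" "rat (g z) \<in> T" using g(2) z by auto
    show "(rat has_field_derivative poly (wronskian p q) (g z) / (poly q (g z))\<^sup>2) (at (g z))"
      using gz by (rule_tac rat_has_field_derivative)
    show "poly (wronskian p q) (g z) / (poly q (g z))\<^sup>2 \<noteq> 0" using gz crit by simp
    show "isCont g z" using g(1) z by (simp add: continuous_on_eq_continuous_at)
    show "(h has_field_derivative deriv h z) (at z)"
      using h(1) z by (simp add: holomorphic_derivI)
    show "\<forall>\<^sub>F x in nhds z. rat (g x) = h x"
      using eventually_nhds_in_open[OF open_ball z] by (rule eventually_mono) (rule g(4))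
  qed
  show ?thesis
  proof (rule that[of g])
    show "g holomorphic_on ball c \<epsilon>"
      unfolding holomorphic_on_def field_differentiable_def
      using der has_field_derivative_at_within by blast
    show "deriv g c = deriv h c / (poly (wronskian p q) z0 / (poly q z0)\<^sup>2)"
      using DERIV_imp_deriv[OF der[OF c]] g(3) by simp
  qed (use g in auto)
qed

section \<open>Basins of attraction and Fatou's theorem\<close>

lemma basin_step: "z \<in> basin a \<longleftrightarrow> poly q z \<noteq> 0 \<and> F z \<in> basin a"
proof -
  have "(F ^^ k) (F z) = (F ^^ Suc k) z" for k
    by (simp add: funpow_swap1)
  moreover have "(\<forall>k. poly q ((F ^^ k) z) \<noteq> 0) \<longleftrightarrow> poly q z \<noteq> 0 \<and> (\<forall>k. poly q ((F ^^ Suc k) z) \<noteq> 0)"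
    by (metis funpow_0 not0_implies_Suc)
  ultimately show ?thesis
    unfolding basin_def using filterlim_sequentially_Suc[of "\<lambda>k. (F ^^ k) z"]
    by (simp only: mem_Collect_eq conj_assoc)
qed

text \<open>Complete invariance of the basin, written for the holomorphic \<open>rat\<close> instead
  of \<open>F\<close>: the basin is the full preimage of its conjugate, so the covering theorem
  applies over the conjugated basin.\<close>

lemma basin_iff_rat: "z \<in> basin a \<longleftrightarrow> poly q z \<noteq> 0 \<and> rat z \<in> cnj ` basin a"
  using basin_step[of z a] by (auto simp: F_def image_iff) (metis complex_cnj_cnj)

lemma basin_disjoint: "z \<in> basin a \<Longrightarrow> z \<in> basin b \<Longrightarrow> a = b"
  unfolding basin_def by (auto intro: LIMSEQ_unique)

lemma attracting_imp_ball_subset_basin: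
  assumes "attracting a"
  obtains e where "e > 0" "ball a e \<subseteq> basin a"
proof -
  define \<rho> where "\<rho> = poly (wronskian p q) a / (poly q a)\<^sup>2"
  have a: "poly q a \<noteq> 0" "F a = a" "norm \<rho> < 1"
    using assms by (auto simp: attracting_def \<rho>_def norm_divide norm_power)
  \<comment> \<open>Midway between \<open>norm \<rho>\<close> and 1: the slack
    \<open>\<kappa> - norm \<rho>\<close> absorbs the linearization error.\<close>
  define \<kappa> where "\<kappa> = (norm \<rho> + 1) / 2"
  have \<kappa>: "norm \<rho> < \<kappa>" "\<kappa> < 1" "\<kappa> > 0" using a(3) norm_ge_zero[of \<rho>] by (auto simp: \<kappa>_def simp del: norm_ge_zero)
  have "(rat has_derivative (\<lambda>v. \<rho> * v)) (at a)"
    using rat_has_field_derivative[OF a(1)] unfolding has_field_derivative_def \<rho>_def .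
  then obtain e1 where e1: "e1 > 0" "\<And>z. norm (z - a) < e1 \<Longrightarrow>
      norm (rat z - rat a - \<rho> * (z - a)) \<le> (\<kappa> - norm \<rho>) * norm (z - a)"
    using \<kappa>(1) unfolding has_derivative_at_alt by (metis diff_gt_0_iff_gt)
  obtain e2 where e2: "e2 > 0" "ball a e2 \<subseteq> {z. poly q z \<noteq> 0}"
    using open_nonpole a(1) open_contains_ball by blast
  define e where "e = min e1 e2"
  have contr: "dist a (F z) \<le> \<kappa> * dist a z" if "z \<in> ball a e" for z
  proof -
    have "dist a (F z) = norm (cnj (rat z - rat a))"
      using a(2) by (metis F_def complex_cnj_diff dist_norm norm_minus_commute)
    also have "\<dots> = norm ((rat z - rat a - \<rho> * (z - a)) + \<rho> * (z - a))"
      by (simp only: complex_mod_cnj) simp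
    also have "\<dots> \<le> norm (rat z - rat a - \<rho> * (z - a)) + norm (\<rho> * (z - a))"
      by (rule norm_triangle_ineq)
    also have "\<dots> \<le> (\<kappa> - norm \<rho>) * norm (z - a) + norm \<rho> * norm (z - a)"
      using that e1(2)[of z] by (simp add: e_def dist_norm norm_minus_commute norm_mult)
    finally show ?thesis by (simp add: dist_norm norm_minus_commute algebra_simps)
  qed
  have it: "(F ^^ k) z \<in> ball a e \<and> dist a ((F ^^ k) z) \<le> \<kappa> ^ k * dist a z" if z: "z \<in> ball a e" for z k
  proof (induction k)
    case (Suc k)
    have "dist a ((F ^^ Suc k) z) \<le> \<kappa> * dist a ((F ^^ k) z)"
      using contr Suc by simp
    also have "\<dots> \<le> \<kappa> * (\<kappa> ^ k * dist a z)"
      using Suc \<kappa> by (intro mult_left_mono) auto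
    finally have 1: "dist a ((F ^^ Suc k) z) \<le> \<kappa> ^ Suc k * dist a z" by (simp add: mult_ac)
    also have "\<dots> \<le> 1 * dist a z"
      using \<kappa> by (intro mult_right_mono power_le_one) auto
    finally show ?case using 1 z by simp
  qed (use z in auto)
  show ?thesis
  proof (rule that[of e])
    show "ball a e \<subseteq> basin a"
    proof
      fix z assume z: "z \<in> ball a e"
      have "(\<lambda>k. \<kappa> ^ k * dist a z) \<longlonglongrightarrow> 0 * dist a z"
        using \<kappa> by (intro tendsto_mult_right LIMSEQ_power_zero) auto
      then have "(\<lambda>k. dist ((F ^^ k) z) a) \<longlonglongrightarrow> 0"
        using it[OF z] by (rule_tac tendsto_sandwich[where f = "\<lambda>_. 0" and h = "\<lambda>k. \<kappa> ^ k * dist a z"])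
          (auto simp: dist_commute)
      then have "(\<lambda>k. (F ^^ k) z) \<longlonglongrightarrow> a" by (subst tendsto_dist_iff)
      moreover have "poly q ((F ^^ k) z) \<noteq> 0" for k
        using it[OF z, of k] e2(2) by (auto simp: e_def)
      ultimately show "z \<in> basin a" by (simp add: basin_def)
    qed
  qed (use e1 e2 in \<open>auto simp: e_def\<close>)
qed

text \<open>Every orbit in the basin enters a disc around \<open>a\<close> inside the basin, and
  openness is pulled back from there by one application of \<open>F\<close> at a time.\<close>

lemma open_basin:
  assumes "attracting a"
  shows "open (basin a)"
proof -
  obtain e where e: "e > 0" "ball a e \<subseteq> basin a"
    using attracting_imp_ball_subset_basin[OF assms] .
  have step: "z \<in> interior (basin a)" if z: "poly q z \<noteq> 0" "F z \<in> interior (basin a)" for z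
  proof -
    have "continuous_on {z. poly q z \<noteq> 0} F"
      unfolding F_def by (intro continuous_intros holomorphic_on_imp_continuous_on rat_holomorphic_on) auto
    then have "open ({z. poly q z \<noteq> 0} \<inter> F -` interior (basin a))"
      using open_nonpole by (rule continuous_open_preimage) auto
    moreover have "{z. poly q z \<noteq> 0} \<inter> F -` interior (basin a) \<subseteq> basin a"
      using interior_subset basin_step by auto
    ultimately show ?thesis using z by (auto simp: interior_def)
  qed
  have "basin a \<subseteq> interior (basin a)"
  proof
    fix z assume z: "z \<in> basin a"
    have "(\<lambda>k. (F ^^ k) z) \<longlonglongrightarrow> a" using z by (simp add: basin_def)
    then obtain k where k: "(F ^^ k) z \<in> ball a e"
      using topological_tendstoD[of _ a sequentially "ball a e"] e(1)
      by (auto simp: eventually_sequentially)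
    have "(F ^^ k) z \<in> interior (basin a)"
      using k e(2) open_ball by (meson interior_maximal subsetD)
    then show "z \<in> interior (basin a)"
      using z
    proof (induction k arbitrary: z)
      case (Suc k)
      then have "F z \<in> interior (basin a)"
        using basin_step[of z a] by (auto simp: funpow_swap1)
      then show ?case using step Suc.prems(2) basin_step by blast
    qed auto
  qed
  then show ?thesis by (metis interior_subset open_interior subset_antisym)
qed

text \<open>Fatou's argument: without a critical point in the basin, the branches of the inverse iterates
  fixing \<open>a\<close> would live on discs of one size, with exploding derivatives but values avoiding a disc.\<close>

lemma basin_contains_critical_point:
  assumes a: "attracting a" and b: "\<delta> > 0" "ball b \<delta> \<inter> basin a = {}"
  obtains z where "z \<in> basin a" "poly (wronskian p q) z = 0"
proof (rule ccontr)
  assume "\<not> thesis"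
  with that have nocrit: "\<And>z. z \<in> basin a \<Longrightarrow> poly (wronskian p q) z \<noteq> 0" by blast
  obtain \<epsilon> where \<epsilon>: "\<epsilon> > 0" "ball a \<epsilon> \<subseteq> basin a"
    using attracting_imp_ball_subset_basin[OF a] .
  have aa: "a \<in> basin a" using \<epsilon> by auto
  have fix_a: "poly q a \<noteq> 0" "rat a = cnj a"
    using a by (auto simp: attracting_def F_def) (metis complex_cnj_cnj)
  define \<rho> where "\<rho> = poly (wronskian p q) a / (poly q a)\<^sup>2"
  \<comment> \<open>The absence of critical points in the basin excludes the superattracting
    case.\<close>
  have \<rho>: "\<rho> \<noteq> 0" "norm \<rho> < 1"
    using a nocrit[OF aa] by (auto simp: attracting_def \<rho>_def norm_divide norm_power)
  let ?T = "cnj ` basin a"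
  have T: "open ?T"
    unfolding image_cnj_conv_vimage_cnj using open_basin[OF a] by (intro open_vimage continuous_intros)
  \<comment> \<open>Here \<open>h\<close> is built as an inverse branch of the \<open>k\<close>-th
    iterate of \<open>F\<close>. As \<open>F\<close> is antiholomorphic, holomorphy is kept by
    conjugating the variable at each step, and the centre \<open>c\<close> alternates between
    \<open>a\<close> and \<open>cnj a\<close>.\<close>
  have branch: "\<exists>c h. h holomorphic_on ball c \<epsilon> \<and> h ` ball c \<epsilon> \<subseteq> basin a \<and> h c = a \<and>
      norm (deriv h c) = (1 / norm \<rho>) ^ k" for k
  proof (induction k)
    case 0
    show ?case using \<epsilon> by (intro exI[of _ a] exI[of _ "\<lambda>z. z"]) (auto intro: holomorphic_intros)
  next
    case (Suc k)
    then obtain c h where h: "h holomorphic_on ball c \<epsilon>" "h ` ball c \<epsilon> \<subseteq> basin a" "h c = a"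
      "norm (deriv h c) = (1 / norm \<rho>) ^ k" by blast
    have cb: "cnj ` ball (cnj c) \<epsilon> \<subseteq> ball c \<epsilon>"
      by (auto simp: dist_norm simp flip: complex_cnj_diff) (metis complex_cnj_cnj complex_cnj_diff complex_mod_cnj)
    let ?h = "\<lambda>z. cnj (h (cnj z))"
    have dh: "(?h has_field_derivative cnj (deriv h c)) (at (cnj c))"
    proof -
      have "(h has_field_derivative deriv h c) (at (cnj (cnj c)))"
        using holomorphic_derivI[OF h(1) open_ball, of c] \<epsilon>(1) by simp
      from has_field_derivative_cnj_cnj[OF this] show ?thesis by (simp add: o_def)
    qed
    obtain g where g: "g holomorphic_on ball (cnj c) \<epsilon>"
      "g ` ball (cnj c) \<epsilon> \<subseteq> {z. poly q z \<noteq> 0 \<and> rat z \<in> ?T}" "g (cnj c) = a"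
      "deriv g (cnj c) = deriv ?h (cnj c) / \<rho>"
    proof (rule lift_through_rat[OF T, of ?h "cnj c" \<epsilon> a])
      show "?h holomorphic_on ball (cnj c) \<epsilon>"
        using holomorphic_on_compose_cnj_cnj[OF holomorphic_on_subset[OF h(1) cb]] by (simp add: o_def)
      show "?h ` ball (cnj c) \<epsilon> \<subseteq> ?T" using cb h(2) by blast
      show "poly (wronskian p q) z \<noteq> 0" if "poly q z \<noteq> 0" "rat z \<in> ?T" for z
        using nocrit basin_iff_rat that by blast
      show "rat a = ?h (cnj c)" using fix_a(2) h(3) by simp
    qed (use \<epsilon>(1) fix_a(1) that in \<open>auto simp: \<rho>_def\<close>)
    have "norm (deriv g (cnj c)) = (1 / norm \<rho>) ^ Suc k"
      using g(4) DERIV_imp_deriv[OF dh] h(4) by (simp add: norm_divide)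
    moreover have "g ` ball (cnj c) \<epsilon> \<subseteq> basin a"
      using g(2) basin_iff_rat by blast
    ultimately show ?case
      using g by blast
  qed
  have "(1 / norm \<rho>) ^ k \<le> (norm (a - b))\<^sup>2 * (2 / (\<delta> * \<epsilon>))" for k
  proof -
    obtain c h where h: "h holomorphic_on ball c \<epsilon>" "h ` ball c \<epsilon> \<subseteq> basin a" "h c = a"
      "norm (deriv h c) = (1 / norm \<rho>) ^ k" using branch[of k] by blast
    have hb: "norm (h z - b) \<ge> \<delta>" if "z \<in> ball c \<epsilon>" for z
    proof -
      have "h z \<in> basin a" using that h(2) by blast
      then have "h z \<notin> ball b \<delta>" using b(2) by blast
      then show ?thesis by (simp add: dist_norm norm_minus_commute)
    qed
    have hb0: "h z \<noteq> b" if "z \<in> ball c \<epsilon>" for z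
      using hb[OF that] b(1) by auto
    \<comment> \<open>Inversion about \<open>b\<close> turns avoiding a disc into the bound
      \<open>1 / \<delta>\<close>, so Cauchy's estimate on the disc of half the radius bounds
      \<open>deriv h c\<close> independently of \<open>k\<close>.\<close>
    define g where "g z = 1 / (h z - b)" for z
    have g: "g holomorphic_on ball c \<epsilon>"
      unfolding g_def using hb0 by (intro holomorphic_intros h) auto
    have "norm ((deriv ^^ 1) g c) \<le> fact 1 * (1 / \<delta>) / (\<epsilon> / 2) ^ 1"
    proof (rule Cauchy_inequality)
      show "g holomorphic_on ball c (\<epsilon> / 2)"
        using \<epsilon>(1) by (intro holomorphic_on_subset[OF g]) auto
      show "continuous_on (cball c (\<epsilon> / 2)) g"
        using \<epsilon>(1) by (intro holomorphic_on_imp_continuous_on holomorphic_on_subset[OF g]) auto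
      show "norm (g x) \<le> 1 / \<delta>" if "norm (c - x) = \<epsilon> / 2" for x
        using hb[of x] that \<epsilon>(1) b(1) by (auto simp: g_def dist_norm norm_divide intro!: divide_left_mono mult_pos_pos)
    qed (use \<epsilon> in auto)
    moreover have "deriv g c = - deriv h c / (a - b)\<^sup>2"
    proof (rule DERIV_imp_deriv)
      have "(h has_field_derivative deriv h c) (at c)"
        using h(1) \<epsilon>(1) by (intro holomorphic_derivI[OF _ open_ball]) auto
      then show "(g has_field_derivative - deriv h c / (a - b)\<^sup>2) (at c)"
        unfolding g_def using hb0[of c] \<epsilon>(1) h(3)
        by (auto intro!: derivative_eq_intros simp: power2_eq_square)
    qed
    ultimately have "(1 / norm \<rho>) ^ k / (norm (a - b))\<^sup>2 \<le> 2 / (\<delta> * \<epsilon>)"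
      using h(4) by (simp add: norm_divide norm_power mult_ac)
    moreover have "(norm (a - b))\<^sup>2 > 0" using hb0[of c] h(3) \<epsilon>(1) by auto
    ultimately show ?thesis by (simp only: pos_divide_le_eq mult.commute)
  qed
  moreover obtain k where "(norm (a - b))\<^sup>2 * (2 / (\<delta> * \<epsilon>)) < (1 / norm \<rho>) ^ k"
    using real_arch_pow[of "1 / norm \<rho>"] \<rho> by auto
  ultimately show False by (metis not_less)
qed

text \<open>Its coefficient in degree \<open>degree p - 1 + degree q\<close> is
  \<open>degree p - degree q\<close> times both leading coefficients, which does not vanish by
  \<open>deg_less\<close>.\<close>

lemma wronskian_nonzero:
  assumes "q \<noteq> 0"
  shows "wronskian p q \<noteq> 0"
proof
  assume W: "wronskian p q = 0"
  have p: "coeff (pderiv p) (degree p - 1) = of_nat (degree p) * lead_coeff p" "degree (pderiv p) = degree p - 1"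
    using deg_less by (auto simp: coeff_pderiv degree_pderiv)
  have 1: "coeff (pderiv p * q) (degree p - 1 + degree q) = of_nat (degree p) * lead_coeff p * lead_coeff q"
    using coeff_mult_degree_sum[of "pderiv p" q] p by simp
  have 2: "coeff (p * pderiv q) (degree p - 1 + degree q) = of_nat (degree q) * lead_coeff p * lead_coeff q"
  proof (cases "degree q = 0")
    case True
    then have "pderiv q = 0" by (simp add: pderiv_eq_0_iff)
    then show ?thesis using True by simp
  next
    case False
    then have "coeff (pderiv q) (degree q - 1) = of_nat (degree q) * lead_coeff q" "degree (pderiv q) = degree q - 1"
      by (auto simp: coeff_pderiv degree_pderiv)
    then show ?thesis
      using coeff_mult_degree_sum[of p "pderiv q"] deg_less False by simp
  qed
  have "coeff (wronskian p q) (degree p - 1 + degree q) = (of_nat (degree p) - of_nat (degree q)) * (lead_coeff p * lead_coeff q)"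
    unfolding wronskian_def coeff_diff 1 2 by (simp add: algebra_simps)
  moreover have "p \<noteq> 0" using deg_less by auto
  ultimately show False using W assms deg_less by simp
qed

text \<open>This is the Riemann-Hurwitz bound on the number of critical points of a rational map of
  degree \<open>degree p\<close>.\<close>

lemma degree_wronskian_le: "degree (wronskian p q) \<le> 2 * degree p - 2"
proof -
  have "degree (pderiv p * q) \<le> 2 * degree p - 2"
    using degree_mult_le[of "pderiv p" q] deg_less by (simp add: degree_pderiv)
  moreover have "degree (p * pderiv q) \<le> 2 * degree p - 2"
  proof (cases "degree q = 0")
    case True
    then have "pderiv q = 0" by (simp add: pderiv_eq_0_iff)
    then show ?thesis by simp
  next
    case False
    then show ?thesis
      using degree_mult_le[of p "pderiv q"] deg_less by (simp add: degree_pderiv)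
  qed
  ultimately show ?thesis unfolding wronskian_def by (rule degree_diff_le)
qed

text \<open>Each basin avoids a disc in the basin of another attracting point, so it contains a
  critical point; disjoint basins give different ones. With at most one attracting point no such
  disc is at hand, but the bound is at least 2.\<close>

theorem card_attracting:
  assumes "q \<noteq> 0" "degree p \<ge> 2"
  shows "finite {a. attracting a} \<and> card {a. attracting a} \<le> 2 * degree p - 2"
proof (cases "\<exists>a. {a. attracting a} \<subseteq> {a}")
  case True
  then obtain a where "{a. attracting a} \<subseteq> {a}" by blast
  moreover from this have "card {a. attracting a} \<le> 1"
    using card_mono[of "{a}"] by fastforce
  ultimately show ?thesis using assms(2) by (auto dest: finite_subset)
next
  case False
  let ?R = "{z. poly (wronskian p q) z = 0}"
  have "\<exists>z\<in>basin a. poly (wronskian p q) z = 0" if a: "attracting a" for a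
  proof -
    obtain b where b: "attracting b" "a \<noteq> b" using False by blast
    obtain \<delta> where \<delta>: "\<delta> > 0" "ball b \<delta> \<subseteq> basin b"
      using attracting_imp_ball_subset_basin[OF b(1)] .
    then have "ball b \<delta> \<inter> basin a = {}" using basin_disjoint b(2) by blast
    then show ?thesis using basin_contains_critical_point[OF a \<delta>(1)] by blast
  qed
  then obtain c where c: "\<And>a. attracting a \<Longrightarrow> c a \<in> basin a" "\<And>a. attracting a \<Longrightarrow> poly (wronskian p q) (c a) = 0"
    by metis
  have inj: "inj_on c {a. attracting a}"
    using c(1) basin_disjoint by (metis (mono_tags, lifting) inj_onI mem_Collect_eq)
  have sub: "c ` {a. attracting a} \<subseteq> ?R" using c(2) by auto
  have fin: "finite ?R" and "card ?R \<le> degree (wronskian p q)"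
    using poly_roots_finite card_poly_roots_bound wronskian_nonzero[OF assms(1)] by auto
  then have "card {a. attracting a} \<le> 2 * degree p - 2"
    using card_inj_on_le[OF inj sub fin] degree_wronskian_le by linarith
  then show ?thesis using inj_on_finite[OF inj sub fin] by simp
qed

end

section \<open>Moving a fixed point to infinity\<close>

text \<open>Reversal with respect to the formal degree \<open>n\<close>: the exchange of the two
  variables in a binary form of degree \<open>n\<close>.\<close>

definition reverse_poly :: "nat \<Rightarrow> complex poly \<Rightarrow> complex poly"
  where "reverse_poly n p = (\<Sum>k\<le>n. monom (coeff p k) (n - k))"

lemma coeff_reverse_poly: "coeff (reverse_poly n p) i = (if i \<le> n then coeff p (n - i) else 0)"
proof -
  have "coeff (reverse_poly n p) i = (\<Sum>k\<le>n. if k = n - i then (if i \<le> n then coeff p k else 0) else 0)"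
    unfolding reverse_poly_def coeff_sum coeff_monom by (intro sum.cong) auto
  then show ?thesis by simp
qed

lemma poly_reverse_poly:
  assumes "degree p \<le> n" "z \<noteq> 0"
  shows "poly (reverse_poly n p) z = z ^ n * poly p (1 / z)"
  unfolding reverse_poly_def poly_sum poly_monom poly_eq_sum_of_degree_le[OF assms(1)] sum_distrib_left
  using assms(2) by (intro sum.cong) (auto simp: power_diff power_one_over field_simps)

lemma poly_pderiv_reverse_poly:
  assumes "degree p \<le> n" "z \<noteq> 0"
  shows "z\<^sup>2 * poly (pderiv (reverse_poly n p)) z =
    of_nat n * z ^ (n + 1) * poly p (1 / z) - z ^ n * poly (pderiv p) (1 / z)"
proof -
  have "((\<lambda>z. z ^ n * poly p (1 / z)) has_field_derivative
      of_nat n * z ^ (n - 1) * poly p (1 / z) - z ^ n * (poly (pderiv p) (1 / z) / z\<^sup>2)) (at z)"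
    using assms(2)
    by (auto intro!: derivative_eq_intros DERIV_chain2[OF poly_DERIV] simp: power2_eq_square)
  moreover have "(poly (reverse_poly n p) has_field_derivative poly (pderiv (reverse_poly n p)) z) (at z)"
    by (rule poly_DERIV)
  then have "((\<lambda>z. z ^ n * poly p (1 / z)) has_field_derivative poly (pderiv (reverse_poly n p)) z) (at z)"
    by (rule has_field_derivative_transform_within_open[of _ _ _ "- {0}"])
      (use assms poly_reverse_poly in auto)
  ultimately have "poly (pderiv (reverse_poly n p)) z =
      of_nat n * z ^ (n - 1) * poly p (1 / z) - z ^ n * (poly (pderiv p) (1 / z) / z\<^sup>2)"
    using DERIV_unique by blast
  moreover have "z\<^sup>2 * (of_nat n * z ^ (n - 1) * c) = of_nat n * z ^ (n + 1) * c" for c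
    by (cases n) (auto simp: power2_eq_square)
  ultimately show ?thesis
    using assms(2) by (simp add: right_diff_distrib)
qed

lemma coeff_pcompose_linear_0: "coeff (pcompose p [:b, 1:]) 0 = poly p b"
  by (simp flip: poly_0_coeff_0 add: poly_pcompose)

text \<open>Moving a repelling fixed point \<open>b\<close> of \<open>w \<mapsto> cnj (p w / q w)\<close> to infinity by \<open>z = 1 / (w - b)\<close>
  puts all basins of attraction into the plane.\<close>

theorem card_hpoly_zeros_extremal:
  assumes "degree p \<le> n" "degree q = n" "n \<ge> 2"
    and nd: "\<And>w. hpoly p q w = 0 \<Longrightarrow> norm (poly (wronskian p q) w) \<noteq> (norm (poly q w))\<^sup>2"
  shows "card {w. hpoly p q w = 0 \<and> norm (poly (wronskian p q) w) < (norm (poly q w))\<^sup>2} \<le> 2 * n - 2"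
    (is "card ?A \<le> _")
proof -
  have q0: "q \<noteq> 0" using assms(2,3) by auto
  let ?S = "{w. hpoly p q w = 0 \<and> norm (poly (wronskian p q) w) > (norm (poly q w))\<^sup>2}"
  have "int (card ?S) \<ge> 1"
    using card_hpoly_zeros_saddle[OF assms(1,2) q0 nd] assms(3) by linarith
  then have "?S \<noteq> {}" by (metis card.empty of_nat_0 not_one_le_zero)
  then obtain b where b: "hpoly p q b = 0" "norm (poly (wronskian p q) b) > (norm (poly q b))\<^sup>2"
    by blast
  have common: "poly p w \<noteq> 0 \<or> poly q w \<noteq> 0" for w
    using nd[of w] by (auto simp: hpoly_def wronskian_def)
  have qb: "poly q b \<noteq> 0" "poly p b = cnj b * poly q b"
    using b(1) common[of b] by (auto simp: hpoly_def)
  \<comment> \<open>With \<open>w = b + 1 / z\<close> the equation \<open>p w = cnj w * q w\<close>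
    becomes \<open>s w = cnj (1 / z) * q w\<close>, that is \<open>q w / s w = cnj z\<close>. Hence
    \<open>P\<close> comes from \<open>q\<close> and \<open>Q\<close> from \<open>s\<close>.\<close>
  define s where "s = p - smult (cnj b) q"
  define p1 where "p1 = pcompose q [:b, 1:]"
  define s1 where "s1 = pcompose s [:b, 1:]"
  have deg_s: "degree s \<le> n" unfolding s_def
    using assms(1,2) by (intro degree_diff_le) auto
  have deg: "degree p1 = n" "degree s1 \<le> n"
    using assms(2) deg_s by (auto simp: p1_def s1_def degree_pcompose)
  define P where "P = reverse_poly n p1"
  define Q where "Q = reverse_poly n s1"
  have "coeff P n \<noteq> 0"
    using qb(1) by (simp add: P_def coeff_reverse_poly p1_def coeff_pcompose_linear_0)
  then have dP: "degree P = n"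
    by (intro antisym degree_le le_degree) (auto simp: P_def coeff_reverse_poly)
  \<comment> \<open>\<open>s\<close> vanishes at \<open>b\<close> because \<open>b\<close> is a
    solution; this lowers the degree of \<open>Q\<close> and makes infinity a fixed point.\<close>
  have Qn: "coeff Q n = 0"
    using qb(2) by (simp add: Q_def coeff_reverse_poly s1_def coeff_pcompose_linear_0 s_def)
  have dQ: "degree Q < n"
  proof -
    have "degree Q \<le> n - 1"
    proof (rule degree_le, intro allI impI)
      fix i assume "n - 1 < i"
      then show "coeff Q i = 0"
        using Qn by (cases "i = n") (auto simp: Q_def coeff_reverse_poly)
    qed
    then show ?thesis using assms(3) by linarith
  qed
  have ev: "poly P z = z ^ n * poly q (b + 1 / z)" "poly Q z = z ^ n * poly s (b + 1 / z)" if "z \<noteq> 0" for z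
    using that deg by (simp_all add: P_def Q_def poly_reverse_poly p1_def s1_def poly_pcompose)
  have "Q \<noteq> 0"
  proof
    assume Q: "Q = 0"
    have "s1 = 0"
    proof (rule poly_eqI)
      fix k
      show "coeff s1 k = coeff 0 k"
      proof (cases "k \<le> n")
        case True
        then have "coeff s1 k = coeff Q (n - k)" by (simp add: Q_def coeff_reverse_poly)
        then show ?thesis using Q by simp
      next
        case False
        then show ?thesis using deg(2) by (simp add: coeff_eq_0)
      qed
    qed
    then have "s = 0" unfolding s1_def by (subst (asm) pcompose_eq_0_iff) auto
    then have "p = smult (cnj b) q" by (simp add: s_def)
    then have "wronskian p q = 0" by (simp add: wronskian_def pderiv_smult mult.commute)
    then show False using b(2) by (metis norm_zero not_less poly_0 zero_le_power2)
  qed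
  interpret antirational P Q
  proof
    fix z
    show "poly P z \<noteq> 0 \<or> poly Q z \<noteq> 0"
    proof (cases "z = 0")
      case True
      have "coeff p1 n \<noteq> 0" using deg(1) assms(3) by (metis leading_coeff_0_iff degree_0 not_numeral_le_zero)
      then show ?thesis using True by (simp add: P_def poly_0_coeff_0 coeff_reverse_poly)
    next
      case False
      then show ?thesis using common[of "b + 1 / z"] by (auto simp: ev s_def)
    qed
  qed (use dP dQ in simp)
  \<comment> \<open>The terms with \<open>of_nat n\<close> cancel, and the sign from the derivative
    of \<open>1 / z\<close> is undone by the exchange of numerator and denominator.\<close>
  have W: "z\<^sup>2 * poly (wronskian P Q) z = z ^ (2 * n) * poly (wronskian p q) (b + 1 / z)" if z: "z \<noteq> 0" for z
  proof -
    let ?w = "b + 1 / z"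
    have dP': "z\<^sup>2 * poly (pderiv P) z = of_nat n * z ^ (n + 1) * poly q ?w - z ^ n * poly (pderiv q) ?w"
      using poly_pderiv_reverse_poly[of p1 n z] z deg
      by (simp add: P_def p1_def poly_pcompose pderiv_pcompose pderiv_pCons)
    have dQ': "z\<^sup>2 * poly (pderiv Q) z = of_nat n * z ^ (n + 1) * poly s ?w - z ^ n * poly (pderiv s) ?w"
      using poly_pderiv_reverse_poly[of s1 n z] z deg
      by (simp add: Q_def s1_def poly_pcompose pderiv_pcompose pderiv_pCons)
    have "z\<^sup>2 * poly (wronskian P Q) z =
        (z\<^sup>2 * poly (pderiv P) z) * poly Q z - poly P z * (z\<^sup>2 * poly (pderiv Q) z)"
      by (simp add: wronskian_def algebra_simps)
    also have "\<dots> = z ^ n * z ^ n * (poly q ?w * poly (pderiv s) ?w - poly (pderiv q) ?w * poly s ?w)"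
      unfolding dP' dQ' ev[OF z] by (simp add: algebra_simps)
    also have "poly q ?w * poly (pderiv s) ?w - poly (pderiv q) ?w * poly s ?w = poly (wronskian p q) ?w"
      by (simp add: s_def wronskian_def pderiv_diff pderiv_smult algebra_simps)
    also have "z ^ n * z ^ n = z ^ (2 * n)" by (simp add: mult_2 power_add)
    finally show ?thesis .
  qed
  have "attracting (1 / (a - b))" if a: "a \<in> ?A" for a
  proof -
    define z where "z = 1 / (a - b)"
    have ab: "a \<noteq> b" using a b by auto
    then have z: "z \<noteq> 0" and w: "b + 1 / z = a" by (auto simp: z_def)
    have qa: "poly q a \<noteq> 0" "poly p a = cnj a * poly q a"
      using a common[of a] by (auto simp: hpoly_def)
    have sa: "poly s a = cnj (a - b) * poly q a"
      using qa by (simp add: s_def algebra_simps)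
    have Qz: "poly Q z \<noteq> 0" using ev(2)[OF z] w sa qa ab z by simp
    have "rat z = poly q a / (cnj (a - b) * poly q a)"
      unfolding rat_def ev[OF z] w sa using z by simp
    also have "\<dots> = cnj z" using qa ab by (simp add: z_def)
    finally have "F z = z" by (simp add: F_def)
    have nz: "norm z * norm (a - b) = 1"
      using ab by (simp add: z_def norm_divide)
    have "(norm z)\<^sup>2 * norm (poly (wronskian P Q) z) = norm z ^ (2 * n) * norm (poly (wronskian p q) a)"
      using arg_cong[OF W[OF z], of norm] w by (simp add: norm_mult norm_power)
    also have "\<dots> < norm z ^ (2 * n) * (norm (poly q a))\<^sup>2"
      using a z by (intro mult_strict_left_mono) auto
    also have "\<dots> = (norm z)\<^sup>2 * (norm (poly Q z))\<^sup>2"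
    proof -
      have "norm (poly Q z) = norm z ^ n * (norm (a - b) * norm (poly q a))"
        unfolding ev(2)[OF z] w sa by (simp only: norm_mult norm_power complex_mod_cnj)
      then have "(norm z)\<^sup>2 * (norm (poly Q z))\<^sup>2 = (norm z * norm (a - b))\<^sup>2 * (norm z ^ n)\<^sup>2 * (norm (poly q a))\<^sup>2"
        by (simp add: power_mult_distrib mult_ac)
      then show ?thesis by (simp add: nz power_mult[symmetric] mult.commute)
    qed
    finally have "norm (poly (wronskian P Q) z) < (norm (poly Q z))\<^sup>2"
      using z by simp
    then show ?thesis
      using Qz \<open>F z = z\<close> by (simp add: attracting_def z_def)
  qed
  then have sub: "(\<lambda>a. 1 / (a - b)) ` ?A \<subseteq> {a. attracting a}" by blast
  have inj: "inj_on (\<lambda>a. 1 / (a - b)) ?A"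
    by (rule inj_onI) simp
  have "finite {a. attracting a} \<and> card {a. attracting a} \<le> 2 * n - 2"
    using card_attracting[OF \<open>Q \<noteq> 0\<close>] dP assms(3) by simp
  then show ?thesis
    using card_inj_on_le[OF inj sub] by linarith
qed

theorem card_hpoly_zeros_bounds:
  assumes "degree p \<le> n" "degree q = n" "n \<ge> 2"
    and nd: "\<And>w. hpoly p q w = 0 \<Longrightarrow> norm (poly (wronskian p q) w) \<noteq> (norm (poly q w))\<^sup>2"
  shows "n - 1 \<le> card {w. hpoly p q w = 0}" "card {w. hpoly p q w = 0} \<le> 5 * n - 5"
proof -
  let ?Z = "{w. hpoly p q w = 0}"
  let ?S = "{w. hpoly p q w = 0 \<and> norm (poly (wronskian p q) w) > (norm (poly q w))\<^sup>2}"
  let ?A = "{w. hpoly p q w = 0 \<and> norm (poly (wronskian p q) w) < (norm (poly q w))\<^sup>2}"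
  have q0: "q \<noteq> 0" using assms(2,3) by auto
  have "finite ?Z" by (rule finite_hpoly_zeros[OF assms(1,2) q0 nd])
  moreover have "?Z = ?S \<union> ?A" using nd by force
  ultimately have "card ?Z = card ?S + card ?A"
    by (metis (no_types, lifting) card_Un_disjoint disjoint_iff finite_Un mem_Collect_eq order_less_asym)
  then show "n - 1 \<le> card ?Z" "card ?Z \<le> 5 * n - 5"
    using card_hpoly_zeros_saddle[OF assms(1,2) q0 nd] card_hpoly_zeros_extremal[OF assms] assms(3)
    by linarith+
qed

section \<open>Binary forms and Hermitian eigenvectors\<close>

no_notation fps_nth (infixl "$" 75)

text \<open>Coordinates of a tensor power depend on the multi-index only through this number, so
  sums over multi-indices become sums over exponents.\<close>

definition ones :: "('d::finite \<Rightarrow> 2) \<Rightarrow> nat"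
  where "ones j = card {k. j k = 1}"

lemma ones_le: "ones (j :: 'd::finite \<Rightarrow> 2) \<le> CARD('d)"
  unfolding ones_def by (rule card_mono) auto

lemma ones_exists:
  assumes "m \<le> CARD('d::finite)"
  obtains j :: "'d::finite \<Rightarrow> 2" where "ones j = m"
proof -
  obtain A :: "'d set" where A: "card A = m"
    using obtain_subset_with_card_n[OF assms] by metis
  have "ones (\<lambda>k. if k \<in> A then 1 else 2 :: 2) = m"
    using A by (simp add: ones_def)
  then show ?thesis by (rule that)
qed

lemma prod_index:
  fixes j :: "'d::finite \<Rightarrow> 2" and x :: "complex ^ 2"
  assumes "finite A"
  shows "(\<Prod>k\<in>A. x $ j k) = x $ 1 ^ card {k \<in> A. j k = 1} * x $ 2 ^ card {k \<in> A. j k \<noteq> 1}"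
proof -
  have "(\<Prod>k\<in>A. x $ j k) = (\<Prod>k\<in>A. if j k = 1 then x $ 1 else x $ 2)"
    by (intro prod.cong refl) (metis exhaust_2)
  also have "\<dots> = x $ 1 ^ card {k \<in> A. j k = 1} * x $ 2 ^ card {k \<in> A. j k \<noteq> 1}"
    using assms by (simp add: prod.If_cases Int_def)
  finally show ?thesis .
qed

lemma card_not_1: "card {k. j k \<noteq> 1} = CARD('d) - ones j" for j :: "'d::finite \<Rightarrow> 2"
proof -
  have "{k. j k \<noteq> 1} = - {k. j k = 1}" by auto
  then show ?thesis by (simp add: ones_def Compl_eq_Diff_UNIV card_Diff_subset)
qed

lemma prod_index_UNIV:
  fixes j :: "'d::finite \<Rightarrow> 2" and x :: "complex ^ 2"
  shows "(\<Prod>k\<in>UNIV. x $ j k) = x $ 1 ^ ones j * x $ 2 ^ (CARD('d) - ones j)"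
  using prod_index[of UNIV x j] by (simp add: card_not_1 ones_def[symmetric])

text \<open>The slot sums in the eigenvector equation are the partial derivatives of the binary form of
  \<open>U\<close>; here for a single coordinate.\<close>

lemma slot_sum_index:
  fixes j :: "'d::finite \<Rightarrow> 2" and x v :: "complex ^ 2"
  shows "(\<Sum>k\<in>UNIV. \<Prod>l\<in>UNIV. ((\<lambda>_. x)(k := v)) l $ j l) =
    v $ 1 * (of_nat (ones j) * x $ 1 ^ (ones j - 1) * x $ 2 ^ (CARD('d) - ones j)) +
    v $ 2 * (of_nat (CARD('d) - ones j) * x $ 1 ^ ones j * x $ 2 ^ (CARD('d) - ones j - 1))"
    (is "_ = v $ 1 * (_ * ?A1 * ?A2) + v $ 2 * (_ * ?B1 * ?B2)")
proof -
  have summand: "(\<Prod>l\<in>UNIV. ((\<lambda>_. x)(k := v)) l $ j l) =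
      (if j k = 1 then v $ 1 * (?A1 * ?A2) else v $ 2 * (?B1 * ?B2))" for k
  proof -
    have "(\<Prod>l\<in>UNIV. ((\<lambda>_. x)(k := v)) l $ j l) = v $ j k * (\<Prod>l\<in>UNIV - {k}. x $ j l)"
      by (subst prod.remove[of UNIV k]) (auto intro!: prod.cong)
    also have "(\<Prod>l\<in>UNIV - {k}. x $ j l) =
        x $ 1 ^ card ({l. j l = 1} - {k}) * x $ 2 ^ card ({l. j l \<noteq> 1} - {k})"
    proof -
      have "{l \<in> UNIV - {k}. j l = 1} = {l. j l = 1} - {k}" "{l \<in> UNIV - {k}. j l \<noteq> 1} = {l. j l \<noteq> 1} - {k}"
        by auto
      then show ?thesis by (simp add: prod_index)
    qed
    also have "v $ j k * \<dots> = (if j k = 1 then v $ 1 * (?A1 * ?A2) else v $ 2 * (?B1 * ?B2))"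
    proof (cases "j k = 1")
      case True
      then have "card ({l. j l = 1} - {k}) = ones j - 1" "card ({l. j l \<noteq> 1} - {k}) = CARD('d) - ones j"
        by (simp_all add: ones_def card_Diff_singleton card_not_1)
      then show ?thesis using True by simp
    next
      case False
      then have "card ({l. j l = 1} - {k}) = ones j" "card ({l. j l \<noteq> 1} - {k}) = CARD('d) - ones j - 1"
        by (simp_all add: ones_def card_Diff_singleton card_not_1)
      moreover have "j k = 2" using False exhaust_2 by metis
      ultimately show ?thesis using False by simp
    qed
    finally show ?thesis .
  qed
  have c: "- {k. j k = 1} = {k. j k \<noteq> 1}" by auto
  show ?thesis
    unfolding summand by (simp add: sum.If_cases c card_not_1 ones_def[symmetric] mult_ac)
qed

text \<open>These sums are all that a contraction with a power sees of \<open>U\<close>: they are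
  the coefficients of its binary form.\<close>

definition form_coeff :: "('d::finite) tensor \<Rightarrow> nat \<Rightarrow> complex"
  where "form_coeff U m = (\<Sum>j | ones j = m. U $ j)"

definition form :: "('d::finite) tensor \<Rightarrow> complex poly"
  where "form U = (\<Sum>m\<le>CARD('d). monom (form_coeff U m) m)"

definition form_x :: "('d::finite) tensor \<Rightarrow> complex poly"
  where "form_x U = pderiv (form U)"

text \<open>The partial derivative in the second variable, evaluated where that variable is 1;
  Euler's relation expresses it through the form and its other derivative.\<close>

definition form_y :: "('d::finite) tensor \<Rightarrow> complex poly"
  where "form_y U = smult (of_nat CARD('d)) (form U) - pCons 0 (pderiv (form U))"

lemma coeff_form: "coeff (form (U :: 'd::finite tensor)) m = (if m \<le> CARD('d) then form_coeff U m else 0)"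
  by (simp add: form_def coeff_sum coeff_monom)

lemma degree_form_x: "degree (form_x (U :: 'd::finite tensor)) \<le> CARD('d) - 1"
proof -
  have "degree (form U) \<le> CARD('d)" by (rule degree_le) (simp add: coeff_form)
  then show ?thesis by (simp add: form_x_def degree_pderiv)
qed

lemma coeff_form_y:
  "coeff (form_y (U :: 'd::finite tensor)) m = (if m \<le> CARD('d) then of_nat (CARD('d) - m) * form_coeff U m else 0)"
  by (cases m) (auto simp: form_y_def coeff_form coeff_pderiv of_nat_diff algebra_simps)

lemma degree_form_y:
  assumes "form_coeff (U :: 'd::finite tensor) (CARD('d) - 1) \<noteq> 0"
  shows "degree (form_y U) = CARD('d) - 1"
proof (rule antisym)
  show "degree (form_y U) \<le> CARD('d) - 1" by (rule degree_le) (auto simp: coeff_form_y)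
  show "CARD('d) - 1 \<le> degree (form_y U)" using assms by (intro le_degree) (simp add: coeff_form_y)
qed

lemma sum_by_ones:
  fixes U :: "'d::finite tensor"
  shows "(\<Sum>j\<in>UNIV. U $ j * g (ones j)) = (\<Sum>m\<le>CARD('d). form_coeff U m * g m)"
proof -
  have "(\<Sum>j\<in>UNIV. U $ j * g (ones j)) = (\<Sum>m\<le>CARD('d). \<Sum>j\<in>{j \<in> UNIV. ones j = m}. U $ j * g (ones j))"
    by (rule sum.group[symmetric]) (auto simp: ones_le)
  also have "\<dots> = (\<Sum>m\<le>CARD('d). form_coeff U m * g m)"
    unfolding form_coeff_def sum_distrib_right by (intro sum.cong) auto
  finally show ?thesis .
qed

lemma poly_form: "poly (form (U :: 'd::finite tensor)) w = (\<Sum>m\<le>CARD('d). form_coeff U m * w ^ m)"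
  by (simp add: form_def poly_sum poly_monom)

lemma poly_form_x:
  "poly (form_x (U :: 'd::finite tensor)) w = (\<Sum>m\<le>CARD('d). form_coeff U m * (of_nat m * w ^ (m - 1)))"
proof -
  have "(poly (form U) has_field_derivative (\<Sum>m\<le>CARD('d). form_coeff U m * (of_nat m * w ^ (m - 1)))) (at w)"
    unfolding poly_form by (auto intro!: derivative_eq_intros sum.cong)
  then show ?thesis
    unfolding form_x_def using poly_DERIV DERIV_unique by blast
qed

lemma poly_form_y:
  "poly (form_y (U :: 'd::finite tensor)) w = (\<Sum>m\<le>CARD('d). form_coeff U m * (of_nat (CARD('d) - m) * w ^ m))"
proof -
  have "degree (form_y U) \<le> CARD('d)" by (rule degree_le) (simp add: coeff_form_y)
  then show ?thesis
    by (subst poly_eq_sum_of_degree_le) (auto simp: coeff_form_y intro!: sum.cong)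
qed

lemma contract_power:
  fixes U :: "'d::finite tensor" and x :: "complex ^ 2"
  assumes "x $ 2 \<noteq> 0"
  shows "contract U (\<lambda>_. x) = x $ 2 ^ CARD('d) * poly (form U) (x $ 1 / x $ 2)"
proof -
  have "contract U (\<lambda>_. x) = (\<Sum>m\<le>CARD('d). form_coeff U m * (x $ 1 ^ m * x $ 2 ^ (CARD('d) - m)))"
    unfolding contract_def prod_index_UNIV by (rule sum_by_ones)
  also have "\<dots> = x $ 2 ^ CARD('d) * poly (form U) (x $ 1 / x $ 2)"
    unfolding poly_form sum_distrib_left using assms
    by (intro sum.cong) (auto simp: power_diff power_divide)
  finally show ?thesis .
qed

text \<open>The differential at \<open>x\<close> of the binary form, in direction \<open>v\<close>;
  at \<open>x = vcnj z\<close> and on basis vectors it is \<open>CARD('d)\<close> times the left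
  side of the eigenvector equation.\<close>

definition grad :: "('d::finite) tensor \<Rightarrow> complex ^ 2 \<Rightarrow> complex ^ 2 \<Rightarrow> complex"
  where "grad U x v = (\<Sum>k\<in>UNIV. contract U ((\<lambda>_. x)(k := v)))"

lemma grad_eq:
  fixes U :: "'d::finite tensor"
  shows "grad U x v =
    v $ 1 * (\<Sum>m\<le>CARD('d). form_coeff U m * (of_nat m * x $ 1 ^ (m - 1) * x $ 2 ^ (CARD('d) - m))) +
    v $ 2 * (\<Sum>m\<le>CARD('d). form_coeff U m * (of_nat (CARD('d) - m) * x $ 1 ^ m * x $ 2 ^ (CARD('d) - m - 1)))"
proof -
  have "grad U x v = (\<Sum>j\<in>UNIV. U $ j * (\<Sum>k\<in>UNIV. \<Prod>l\<in>UNIV. ((\<lambda>_. x)(k := v)) l $ j l))"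
    unfolding grad_def contract_def by (subst sum.swap) (simp add: sum_distrib_left)
  also have "\<dots> = (\<Sum>m\<le>CARD('d). form_coeff U m * (v $ 1 * (of_nat m * x $ 1 ^ (m - 1) * x $ 2 ^ (CARD('d) - m)) +
      v $ 2 * (of_nat (CARD('d) - m) * x $ 1 ^ m * x $ 2 ^ (CARD('d) - m - 1))))"
    unfolding slot_sum_index by (rule sum_by_ones)
  finally show ?thesis
    by (simp add: sum.distrib sum_distrib_left distrib_left mult_ac)
qed

lemma grad_dehomogenize:
  fixes U :: "'d::finite tensor" and x :: "complex ^ 2"
  assumes "x $ 2 \<noteq> 0"
  shows "grad U x v = x $ 2 ^ (CARD('d) - 1) *
    (v $ 1 * poly (form_x U) (x $ 1 / x $ 2) + v $ 2 * poly (form_y U) (x $ 1 / x $ 2))"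
proof -
  have 1: "form_coeff U m * (of_nat m * x $ 1 ^ (m - 1) * x $ 2 ^ (CARD('d) - m)) =
      x $ 2 ^ (CARD('d) - 1) * (form_coeff U m * (of_nat m * (x $ 1 / x $ 2) ^ (m - 1)))" if "m \<le> CARD('d)" for m
  proof (cases m)
    case (Suc l)
    then have "x $ 2 ^ (CARD('d) - 1) = x $ 2 ^ (CARD('d) - m) * x $ 2 ^ l"
      using that by (simp flip: power_add)
    then show ?thesis using Suc assms by (simp add: power_divide)
  qed auto
  have 2: "form_coeff U m * (of_nat (CARD('d) - m) * x $ 1 ^ m * x $ 2 ^ (CARD('d) - m - 1)) =
      x $ 2 ^ (CARD('d) - 1) * (form_coeff U m * (of_nat (CARD('d) - m) * (x $ 1 / x $ 2) ^ m))" if "m \<le> CARD('d)" for m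
  proof (cases "m = CARD('d)")
    case False
    then have "x $ 2 ^ (CARD('d) - 1) = x $ 2 ^ (CARD('d) - m - 1) * x $ 2 ^ m"
      using that by (simp flip: power_add)
    then show ?thesis using assms by (simp add: power_divide)
  qed auto
  show ?thesis
    unfolding grad_eq poly_form_x poly_form_y distrib_left sum_distrib_left
    using 1 2 by (intro arg_cong2[where f = "(+)"] sum.cong) (auto simp: mult.left_commute)
qed

text \<open>In the direction missing from the affine chart, the second eigenvector equation says
  that this coefficient vanishes; hence the first condition in \<open>generic\<close>.\<close>

lemma grad_infinity:
  fixes U :: "'d::finite tensor" and x :: "complex ^ 2"
  assumes "x $ 2 = 0"
  shows "grad U x (axis 2 1) = form_coeff U (CARD('d) - 1) * x $ 1 ^ (CARD('d) - 1)"
proof -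
  have "grad U x (axis 2 1) = (\<Sum>m\<le>CARD('d). form_coeff U m * (of_nat (CARD('d) - m) * x $ 1 ^ m * x $ 2 ^ (CARD('d) - m - 1)))"
    by (simp add: grad_eq axis_def)
  also have "\<dots> = (\<Sum>m\<le>CARD('d). if m = CARD('d) - 1 then form_coeff U m * x $ 1 ^ m else 0)"
    using assms by (intro sum.cong) (auto simp: zero_power)
  finally show ?thesis by simp
qed

section \<open>Solutions of the planar equation and Hermitian eigenvectors\<close>

text \<open>The first condition makes the degree of \<open>form_y U\<close> exactly
  \<open>CARD('d) - 1\<close> and keeps infinity from being a solution. The second, nondegeneracy,
  also excludes common zeros of \<open>form_x U\<close> and \<open>form_y U\<close>, since both
  sides would be 0 there.\<close>

definition generic :: "('d::finite) tensor \<Rightarrow> bool"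
  where "generic U \<longleftrightarrow> form_coeff U (CARD('d) - 1) \<noteq> 0 \<and>
    (\<forall>w. hpoly (form_x U) (form_y U) w = 0 \<longrightarrow>
      norm (poly (wronskian (form_x U) (form_y U)) w) \<noteq> (norm (poly (form_y U) w))\<^sup>2)"

definition hpoly_zeros :: "('d::finite) tensor \<Rightarrow> complex set"
  where "hpoly_zeros U = {w. hpoly (form_x U) (form_y U) w = 0}"

lemma form_y_eq: "poly (form_y (U :: 'd::finite tensor)) w = of_nat CARD('d) * poly (form U) w - w * poly (form_x U) w"
  by (simp add: form_y_def form_x_def)

text \<open>This is Euler's relation in the affine chart.\<close>

lemma hpoly_zero_euler:
  fixes U :: "'d::finite tensor"
  assumes "w \<in> hpoly_zeros U"
  shows "poly (form_y U) w * (1 + w * cnj w) = of_nat CARD('d) * poly (form U) w"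
    and "poly (form_x U) w = cnj w * poly (form_y U) w"
  using assms by (auto simp: hpoly_zeros_def hpoly_def form_y_eq algebra_simps)

lemma one_plus_norm_square: "1 + w * cnj w = of_real (1 + (norm w)\<^sup>2)"
  by (simp flip: complex_norm_square)

lemma one_plus_ne_0: "1 + w * cnj w \<noteq> 0"
  unfolding one_plus_norm_square of_real_eq_0_iff by (smt (verit) zero_le_power2)

text \<open>By Euler's relation, a zero of the form among the solutions would be a common zero of
  both derivatives.\<close>

lemma generic_form_nonzero:
  fixes U :: "'d::finite tensor"
  assumes "generic U" "w \<in> hpoly_zeros U"
  shows "poly (form U) w \<noteq> 0"
proof
  assume "poly (form U) w = 0"
  then have "poly (form_y U) w = 0" "poly (form_x U) w = 0"
    using hpoly_zero_euler[OF assms(2)] one_plus_ne_0[of w] by auto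
  then show False using assms by (auto simp: generic_def hpoly_zeros_def wronskian_def)
qed

text \<open>The eigenvector of a solution \<open>w\<close> is proportional to
  \<open>(cnj w, 1)\<close>, of squared norm \<open>1 + w * cnj w\<close>; the denominator comes
  from normalizing it in the contraction and in the tensor power. The conjugate appears because
  tensors are contracted with \<open>vcnj z\<close>.\<close>

definition point :: "('d::finite) tensor \<Rightarrow> complex \<Rightarrow> 'd tensor"
  where "point U w = (poly (form U) w / (1 + w * cnj w) ^ CARD('d)) *s tensor_power (vector [cnj w, 1])"

lemma point_nth: "point (U :: 'd::finite tensor) w $ j = poly (form U) w / (1 + w * cnj w) ^ CARD('d) * cnj w ^ ones j"
  by (simp add: point_def tensor_prod_def prod_index_UNIV)

lemma scaled_tensor_power_nth:
  "(c *s tensor_power z :: 'd::finite tensor) $ j = c * (z $ 1 ^ ones j * z $ 2 ^ (CARD('d) - ones j))"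
  by (simp add: tensor_prod_def prod_index_UNIV)

lemma tensor_power_eq_point:
  fixes U :: "'d::finite tensor" and z :: "complex ^ 2"
  assumes "z $ 2 \<noteq> 0" and w: "w = cnj (z $ 1 / z $ 2)"
    and c: "c * (z $ 2) ^ CARD('d) = poly (form U) w / (1 + w * cnj w) ^ CARD('d)"
  shows "c *s tensor_power z = point U w"
proof -
  have "z $ 1 = cnj w * z $ 2" using assms by simp
  then have "c * (z $ 1 ^ ones j * z $ 2 ^ (CARD('d) - ones j)) = (c * z $ 2 ^ CARD('d)) * cnj w ^ ones j" for j :: "'d \<Rightarrow> 2"
    using ones_le[of j] by (simp add: power_mult_distrib flip: power_add)
  then show ?thesis
    unfolding vec_eq_iff scaled_tensor_power_nth point_nth c by simp
qed

text \<open>The coordinates with \<open>ones j = 0\<close> and \<open>ones j = 1\<close> are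
  \<open>c\<close> and \<open>c * cnj w\<close> for the same nonzero scalar
  \<open>c\<close>.\<close>

lemma inj_on_point:
  fixes U :: "'d::finite tensor"
  assumes "generic U"
  shows "inj_on (point U) (hpoly_zeros U)"
proof (rule inj_onI)
  fix v w assume v: "v \<in> hpoly_zeros U" and w: "w \<in> hpoly_zeros U" and eq: "point U v = point U w"
  obtain j0 :: "'d \<Rightarrow> 2" where j0: "ones j0 = 0" by (rule ones_exists[of 0]) auto
  obtain j1 :: "'d \<Rightarrow> 2" where j1: "ones j1 = 1" by (rule ones_exists[of 1]) (simp add: Suc_le_eq)
  let ?c = "\<lambda>w. poly (form U) w / (1 + w * cnj w) ^ CARD('d)"
  have "?c v = ?c w" using arg_cong[OF eq, of "\<lambda>A. A $ j0"] by (simp add: point_nth j0)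
  moreover have "?c v * cnj v = ?c w * cnj w"
    using arg_cong[OF eq, of "\<lambda>A. A $ j1"] by (simp add: point_nth j1)
  moreover have "?c v \<noteq> 0" using generic_form_nonzero[OF assms(1) v] one_plus_ne_0[of v] by simp
  ultimately have "cnj v = cnj w" by (metis mult_left_cancel)
  then show "v = w" by simp
qed

lemma norm_eq_1_iff: "norm (z :: complex ^ 2) = 1 \<longleftrightarrow> z $ 1 * cnj (z $ 1) + z $ 2 * cnj (z $ 2) = 1"
proof -
  have "z $ 1 * cnj (z $ 1) + z $ 2 * cnj (z $ 2) = of_real ((norm z)\<^sup>2)"
    unfolding herm_self[symmetric] by (simp add: herm_def sum_2)
  moreover have "norm z = 1 \<longleftrightarrow> (norm z)\<^sup>2 = 1"
    using norm_ge_zero[of z] by (smt (verit) one_power2 power2_eq_1_iff)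
  ultimately show ?thesis by (simp only: of_real_eq_1_iff)
qed

lemma vcnj_nth [simp]: "vcnj z $ i = cnj (z $ i)"
  by (simp add: vcnj_def)

lemma eigenvector_iff:
  fixes U :: "'d::finite tensor"
  shows "hermitian_eigenvector U z \<longleftrightarrow> norm z = 1 \<and>
    grad U (vcnj z) (axis 1 1) = of_nat CARD('d) * contract U (\<lambda>_. vcnj z) * z $ 1 \<and>
    grad U (vcnj z) (axis 2 1) = of_nat CARD('d) * contract U (\<lambda>_. vcnj z) * z $ 2 \<and>
    contract U (\<lambda>_. vcnj z) \<in> \<real> \<and> 0 \<le> Re (contract U (\<lambda>_. vcnj z))"
  unfolding hermitian_eigenvector_def contract_vcnj forall_2 grad_def
  by (auto simp: field_simps)

text \<open>The planar equation fixes only the direction of \<open>z\<close>. Modulus and phase are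
  then chosen so that \<open>z\<close> is a unit vector with real nonnegative eigenvalue; what
  freedom remains does not change the tensor.\<close>

lemma eigen_points_eq:
  fixes U :: "'d::finite tensor"
  assumes g: "generic U"
  shows "eigen_points U = point U ` hpoly_zeros U"
proof
  show "eigen_points U \<subseteq> point U ` hpoly_zeros U"
  proof
    fix A assume "A \<in> eigen_points U"
    then obtain z where z: "hermitian_eigenvector U z" "A = contract U (\<lambda>_. vcnj z) *s tensor_power z"
      unfolding eigen_points_def contract_vcnj by blast
    define c where "c = contract U (\<lambda>_. vcnj z)"
    have e: "norm z = 1" "grad U (vcnj z) (axis 1 1) = of_nat CARD('d) * c * z $ 1"
      "grad U (vcnj z) (axis 2 1) = of_nat CARD('d) * c * z $ 2"
      using z(1) unfolding eigenvector_iff c_def by auto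
    have z2: "z $ 2 \<noteq> 0"
    proof
      assume z2: "z $ 2 = 0"
      then have "z $ 1 \<noteq> 0" using e(1) by (auto simp: norm_eq_1_iff)
      then show False
        using e(3) grad_infinity[of "vcnj z" U] g z2 by (simp add: generic_def)
    qed
    define w where "w = cnj (z $ 1 / z $ 2)"
    have q: "cnj (z $ 2) ^ (CARD('d) - 1) * poly (form_x U) w = of_nat CARD('d) * c * z $ 1"
      "cnj (z $ 2) ^ (CARD('d) - 1) * poly (form_y U) w = of_nat CARD('d) * c * z $ 2"
      using e(2,3) z2 by (simp_all add: grad_dehomogenize w_def axis_def)
    have z1: "z $ 1 = cnj w * z $ 2" using z2 by (simp add: w_def)
    have "cnj (z $ 2) ^ (CARD('d) - 1) * (cnj w * poly (form_y U) w) = cnj (z $ 2) ^ (CARD('d) - 1) * poly (form_x U) w"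
      using q z1 by (simp add: mult_ac)
    then have w: "w \<in> hpoly_zeros U" using z2 by (simp add: hpoly_zeros_def hpoly_def)
    have "z $ 2 * cnj (z $ 2) * (1 + w * cnj w) = 1"
      using e(1) unfolding norm_eq_1_iff z1 by (simp add: algebra_simps)
    then have "(z $ 2 * cnj (z $ 2)) ^ CARD('d) * (1 + w * cnj w) ^ CARD('d) = 1"
      by (simp flip: power_mult_distrib)
    then have "(z $ 2 * cnj (z $ 2)) ^ CARD('d) = 1 / (1 + w * cnj w) ^ CARD('d)"
      using one_plus_ne_0[of w] by (simp add: nonzero_eq_divide_eq)
    moreover have "c = cnj (z $ 2) ^ CARD('d) * poly (form U) w"
      using contract_power[of "vcnj z" U] z2 by (simp add: c_def w_def)
    ultimately have "c * z $ 2 ^ CARD('d) = poly (form U) w / (1 + w * cnj w) ^ CARD('d)"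
      by (simp add: power_mult_distrib mult_ac)
    then have "A = point U w"
      unfolding z(2) c_def[symmetric] using z2 w_def by (intro tensor_power_eq_point)
    then show "A \<in> point U ` hpoly_zeros U" using w by blast
  qed
  show "point U ` hpoly_zeros U \<subseteq> eigen_points U"
  proof
    fix A assume "A \<in> point U ` hpoly_zeros U"
    then obtain w where w: "w \<in> hpoly_zeros U" "A = point U w" by blast
    define r where "r = 1 / sqrt (1 + (norm w)\<^sup>2)"
    \<comment> \<open>The modulus normalizes \<open>z\<close>, and the phase is chosen so that the
      \<open>CARD('d)\<close>-th power of \<open>x\<close> cancels the argument of the value of the
      form.\<close>
    define x where "x = of_real r * cis (- Arg (poly (form U) w) / CARD('d))"
    define z :: "complex ^ 2" where "z = vector [cnj w * cnj x, cnj x]"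
    have r: "r > 0" unfolding r_def by (simp add: add_pos_nonneg)
    have x0: "x \<noteq> 0" using r by (simp add: x_def)
    have "x * cnj x = of_real (r\<^sup>2)"
      unfolding x_def by (simp add: cis_cnj power2_eq_square cis_mult)
    also have "r\<^sup>2 = 1 / (1 + (norm w)\<^sup>2)"
      by (simp add: r_def power_divide add_nonneg_nonneg)
    finally have xx: "x * cnj x * (1 + w * cnj w) = 1"
      unfolding one_plus_norm_square by (simp add: add_nonneg_eq_0_iff flip: of_real_mult del: of_real_add of_real_divide)
    have z: "z $ 1 = cnj w * cnj x" "z $ 2 = cnj x" "z $ 2 \<noteq> 0" "cnj (z $ 1 / z $ 2) = w"
      using x0 by (simp_all add: z_def)
    have "norm z = 1"
      unfolding norm_eq_1_iff z using xx by (simp add: algebra_simps)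
    have c: "contract U (\<lambda>_. vcnj z) = x ^ CARD('d) * poly (form U) w"
      using contract_power[of "vcnj z" U] z x0 by simp
    have "x ^ CARD('d) * poly (form U) w = of_real (r ^ CARD('d) * norm (poly (form U) w))"
    proof -
      have "x ^ CARD('d) = of_real (r ^ CARD('d)) * cis (- Arg (poly (form U) w))"
        unfolding x_def power_mult_distrib Complex.DeMoivre by simp
      moreover have "poly (form U) w = of_real (norm (poly (form U) w)) * cis (Arg (poly (form U) w))"
        by (metis rcis_cmod_Arg rcis_def)
      ultimately have "x ^ CARD('d) * poly (form U) w = of_real (r ^ CARD('d)) * cis (- Arg (poly (form U) w)) *
         (of_real (norm (poly (form U) w)) * cis (Arg (poly (form U) w)))" by metis
      then show ?thesis by (simp add: mult_ac cis_mult)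
    qed
    then have real: "contract U (\<lambda>_. vcnj z) \<in> \<real>" "0 \<le> Re (contract U (\<lambda>_. vcnj z))"
      using r unfolding c by (simp_all only: Reals_of_real Re_complex_of_real) simp
    have xd: "x ^ CARD('d) = x ^ (CARD('d) - 1) * x"
      by (metis power_minus_mult zero_less_card_finite)
    have y: "poly (form_y U) w = of_nat CARD('d) * poly (form U) w * (x * cnj x)"
      using hpoly_zero_euler(1)[OF w(1)] xx
      by (metis (no_types, opaque_lifting) mult.assoc mult.commute mult.right_neutral)
    have "grad U (vcnj z) (axis 2 1) = of_nat CARD('d) * contract U (\<lambda>_. vcnj z) * z $ 2"
      unfolding c using z x0 y by (simp add: grad_dehomogenize axis_def xd mult_ac)
    moreover have "grad U (vcnj z) (axis 1 1) = of_nat CARD('d) * contract U (\<lambda>_. vcnj z) * z $ 1"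
      unfolding c using z x0 y hpoly_zero_euler(2)[OF w(1)] by (simp add: grad_dehomogenize axis_def xd mult_ac)
    ultimately have "hermitian_eigenvector U z"
      unfolding eigenvector_iff using real \<open>norm z = 1\<close> by blast
    moreover have "contract U (\<lambda>_. vcnj z) *s tensor_power z = point U w"
    proof (rule tensor_power_eq_point)
      have "x ^ CARD('d) * cnj x ^ CARD('d) * (1 + w * cnj w) ^ CARD('d) = 1"
        using xx by (simp flip: power_mult_distrib)
      then have "x ^ CARD('d) * cnj x ^ CARD('d) = 1 / (1 + w * cnj w) ^ CARD('d)"
        using one_plus_ne_0[of w] by (simp add: nonzero_eq_divide_eq)
      then show "contract U (\<lambda>_. vcnj z) * z $ 2 ^ CARD('d) = poly (form U) w / (1 + w * cnj w) ^ CARD('d)"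
        unfolding c z(2) by (simp add: mult_ac)
    qed (use z in auto)
    ultimately show "A \<in> eigen_points U"
      unfolding eigen_points_def w(2) contract_vcnj by (intro CollectI exI[of _ z]) simp
  qed
qed

section \<open>Generic tensors\<close>

lemma bounded_linear_form_coeff: "bounded_linear (\<lambda>U :: 'd::finite tensor. form_coeff U m)"
  unfolding form_coeff_def by (intro bounded_linear_sum bounded_linear_vec_nth)

lemma continuous_on_form_coeff [continuous_intros]:
  "continuous_on S g \<Longrightarrow> continuous_on S (\<lambda>x. form_coeff (g x) m)"
  by (rule bounded_linear.continuous_on[OF bounded_linear_form_coeff])

text \<open>Joint continuity in tensor and point makes the set of degenerate pairs closed. The
  wronskian involves derivatives of the form up to order two.\<close>

lemma continuous_on_poly_pderiv_form:
  fixes g :: "'a::topological_space \<Rightarrow> ('d::finite) tensor"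
  assumes "continuous_on S g" "continuous_on S h"
  shows "continuous_on S (\<lambda>x. poly ((pderiv ^^ n) (form (g x))) (h x))"
proof -
  have "poly ((pderiv ^^ n) (form U)) w = (\<Sum>m\<le>CARD('d). form_coeff U m * poly ((pderiv ^^ n) (monom 1 m)) w)"
    for U :: "'d tensor" and w
  proof -
    have "form U = (\<Sum>m\<le>CARD('d). smult (form_coeff U m) (monom 1 m))"
      by (simp add: form_def smult_monom)
    then show ?thesis
      by (simp add: higher_pderiv_sum higher_pderiv_smult poly_sum)
  qed
  then show ?thesis
    using assms by (simp add: continuous_intros)
qed

lemma continuous_on_form [continuous_intros]:
  fixes g :: "'a::topological_space \<Rightarrow> ('d::finite) tensor"
  assumes "continuous_on S g" "continuous_on S h"
  shows "continuous_on S (\<lambda>x. poly (form (g x)) (h x))"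
    and "continuous_on S (\<lambda>x. poly (form_x (g x)) (h x))"
    and "continuous_on S (\<lambda>x. poly (form_y (g x)) (h x))"
    and "continuous_on S (\<lambda>x. poly (wronskian (form_x (g x)) (form_y (g x))) (h x))"
proof -
  note c = continuous_on_poly_pderiv_form[OF assms, of 0, simplified]
    continuous_on_poly_pderiv_form[OF assms, of 1, simplified]
    continuous_on_poly_pderiv_form[OF assms, of 2, simplified numeral_2_eq_2 funpow.simps o_apply id_apply]
  show "continuous_on S (\<lambda>x. poly (form (g x)) (h x))" by (rule c)
  show x: "continuous_on S (\<lambda>x. poly (form_x (g x)) (h x))" unfolding form_x_def by (rule c)
  show y: "continuous_on S (\<lambda>x. poly (form_y (g x)) (h x))"
    unfolding form_y_def using c assms by (auto intro!: continuous_intros)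
  show "continuous_on S (\<lambda>x. poly (wronskian (form_x (g x)) (form_y (g x))) (h x))"
    unfolding wronskian_def form_x_def form_y_def using c assms
    by (auto intro!: continuous_intros simp: pderiv_diff pderiv_smult pderiv_pCons)
qed

lemma hpoly_form_eq:
  fixes U :: "'d::finite tensor"
  shows "hpoly (form_x U) (form_y U) w =
    (\<Sum>m\<le>CARD('d). form_coeff U m * (of_nat (CARD('d) - m) * w ^ m * cnj w - of_nat m * w ^ (m - 1)))"
  unfolding hpoly_def poly_form_x poly_form_y
  by (simp add: sum_distrib_left sum_subtractf right_diff_distrib mult_ac)

text \<open>Only the summand \<open>m = CARD('d) - 1\<close> contains a term of order
  \<open>CARD('d)\<close> in \<open>norm w\<close>; all others have lower order. The bound is
  uniform near a given tensor and confines the zeros to one compact disc.\<close>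

lemma hpoly_zero_bound:
  fixes U :: "'d::finite tensor"
  assumes d: "CARD('d) \<ge> 2" and zero: "hpoly (form_x U) (form_y U) w = 0"
    and \<delta>: "\<delta> > 0" "norm (form_coeff U (CARD('d) - 1)) \<ge> \<delta>"
    and C: "\<And>m. m \<le> CARD('d) \<Longrightarrow> norm (form_coeff U m) \<le> C"
  shows "norm w \<le> max 1 (real (CARD('d) + 1) * (C * (2 * CARD('d))) / \<delta>)"
proof (cases "norm w \<le> 1")
  case False
  let ?d = "CARD('d)"
  let ?\<phi> = "\<lambda>m. of_nat (?d - m) * w ^ m * cnj w - of_nat m * w ^ (m - 1)"
  \<comment> \<open>\<open>?\<phi>\<close> without its dominating term. Each of these is at most
    \<open>2 * ?d * norm w ^ (?d - 1)\<close>, and there are \<open>?d + 1\<close> of them, which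
    explains the constant in the bound.\<close>
  let ?\<psi> = "\<lambda>m. if m = ?d - 1 then - of_nat m * w ^ (m - 1) else ?\<phi> m"
  let ?c = "form_coeff U"
  have w: "norm w > 1" using False by simp
  have le: "norm w ^ m \<le> norm w ^ (?d - 1)" if "m \<le> ?d - 1" for m
    using that w by (intro power_increasing) auto
  have b: "norm (?\<psi> m) \<le> 2 * ?d * norm w ^ (?d - 1)" if m: "m \<le> ?d" for m
  proof -
    have 1: "norm (of_nat m * w ^ (m - 1)) \<le> ?d * norm w ^ (?d - 1)"
      using m le[of "m - 1"] by (auto simp: norm_mult norm_power intro!: mult_mono)
    have 2: "norm (of_nat (?d - m) * w ^ m * cnj w) \<le> ?d * norm w ^ (?d - 1)" if "m \<noteq> ?d - 1"
    proof (cases "m = ?d")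
      case False
      then have "norm w ^ Suc m \<le> norm w ^ (?d - 1)" using that m by (intro le) linarith
      then have "real (?d - m) * norm w ^ Suc m \<le> ?d * norm w ^ (?d - 1)"
        by (intro mult_mono) auto
      then show ?thesis by (simp add: norm_mult norm_power mult_ac)
    qed auto
    show ?thesis
    proof (cases "m = ?d - 1")
      case True
      then have "norm (?\<psi> m) = norm (of_nat m * w ^ (m - 1))"
        by (simp only: simp_thms if_True mult_minus_left norm_minus_cancel)
      moreover have "0 \<le> ?d * norm w ^ (?d - 1)" by simp
      ultimately show ?thesis using 1 by linarith
    next
      case False
      have "norm (?\<phi> m) \<le> norm (of_nat (?d - m) * w ^ m * cnj w) + norm (of_nat m * w ^ (m - 1))"
        by (rule norm_triangle_ineq4)
      then show ?thesis using False 1 2[OF False] by simp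
    qed
  qed
  have "0 = (\<Sum>m\<le>?d. ?c m * ?\<phi> m)"
    using zero by (simp add: hpoly_form_eq)
  also have "\<dots> = (\<Sum>m\<le>?d. ?c m * ?\<psi> m + (if m = ?d - 1 then ?c m * (w ^ m * cnj w) else 0))"
    using d by (intro sum.cong) (auto simp: algebra_simps)
  also have "\<dots> = (\<Sum>m\<le>?d. ?c m * ?\<psi> m) + ?c (?d - 1) * (w ^ (?d - 1) * cnj w)"
    by (simp add: sum.distrib)
  finally have "(\<Sum>m\<le>?d. ?c m * ?\<psi> m) + ?c (?d - 1) * (w ^ (?d - 1) * cnj w) = 0" ..
  then have "- (\<Sum>m\<le>?d. ?c m * ?\<psi> m) = ?c (?d - 1) * (w ^ (?d - 1) * cnj w)"
    by (rule add.inverse_unique)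
  from arg_cong[OF this, of norm]
  have "norm (?c (?d - 1)) * (norm w ^ (?d - 1) * norm w) = norm (\<Sum>m\<le>?d. ?c m * ?\<psi> m)"
    by (simp only: norm_minus_cancel norm_mult norm_power complex_mod_cnj)
  also have "\<dots> \<le> (\<Sum>m\<le>?d. C * (2 * ?d * norm w ^ (?d - 1)))"
  proof (rule sum_norm_le)
    fix m assume "m \<in> {..?d}"
    then have m: "m \<le> ?d" by simp
    show "norm (?c m * ?\<psi> m) \<le> C * (2 * ?d * norm w ^ (?d - 1))"
      unfolding norm_mult using C[OF m] b[OF m]
      by (intro mult_mono) (auto intro: order_trans[OF norm_ge_zero])
  qed
  also have "\<dots> = (real (?d + 1) * (C * (2 * ?d))) * norm w ^ (?d - 1)"
    by simp
  finally have "norm w ^ (?d - 1) * (norm (?c (?d - 1)) * norm w) \<le> norm w ^ (?d - 1) * (real (?d + 1) * (C * (2 * ?d)))"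
    by (simp only: mult_ac)
  then have "norm (?c (?d - 1)) * norm w \<le> real (?d + 1) * (C * (2 * ?d))"
    using w by (subst (asm) mult_le_cancel_left_pos) (auto intro!: zero_less_power simp del: zero_less_norm_iff)
  moreover have "\<delta> * norm w \<le> norm (?c (?d - 1)) * norm w"
    using \<delta> by (intro mult_right_mono) auto
  ultimately have "\<delta> * norm w \<le> real (?d + 1) * (C * (2 * ?d))" by linarith
  then have "norm w \<le> real (?d + 1) * (C * (2 * ?d)) / \<delta>"
    unfolding pos_le_divide_eq[OF \<delta>(1)] by (simp only: mult.commute)
  then show ?thesis by (rule max.coboundedI2)
qed auto

text \<open>For tensors near \<open>U0\<close> all solutions lie in one compact disc. Projecting the
  closed set of degenerate pairs along this disc gives a closed set of tensors, which is then cut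
  out of the neighbourhood.\<close>

lemma open_generic:
  assumes d: "CARD('d::finite) \<ge> 2"
  shows "open {U :: 'd tensor. generic U}"
proof (subst open_subopen, intro ballI)
  fix U0 :: "'d tensor" assume "U0 \<in> {U. generic U}"
  then have U0: "generic U0" by simp
  let ?d = "CARD('d)"
  let ?c = "\<lambda>U :: 'd tensor. form_coeff U (?d - 1)"
  define \<delta> where "\<delta> = norm (?c U0) / 2"
  have \<delta>: "\<delta> > 0" "norm (?c U0) > \<delta>" using U0 by (auto simp: \<delta>_def generic_def)
  define C where "C = (\<Sum>m\<le>?d. norm (form_coeff U0 m)) + 1"
  have C: "norm (form_coeff U0 m) < C" if "m \<le> ?d" for m
    using that member_le_sum[of m "{..?d}" "\<lambda>m. norm (form_coeff U0 m)"] by (auto simp: C_def)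
  define N where "N = {U. norm (?c U) > \<delta>} \<inter> (\<Inter>m\<in>{..?d}. {U :: 'd tensor. norm (form_coeff U m) < C})"
  have "open N"
    unfolding N_def by (intro open_Int open_INT open_Collect_less continuous_intros ballI) auto
  define R where "R = max 1 (real (?d + 1) * (C * (2 * ?d)) / \<delta>)"
  define K where "K = {(w, U :: 'd tensor). hpoly (form_x U) (form_y U) w = 0 \<and>
    norm (poly (wronskian (form_x U) (form_y U)) w) = (norm (poly (form_y U) w))\<^sup>2}"
  have "closed K"
    unfolding K_def case_prod_beta hpoly_def
    by (intro closed_Collect_conj closed_Collect_eq continuous_intros)
  then have B: "closed {U. \<exists>w. w \<in> cball 0 R \<and> (w, U) \<in> K}"
    by (intro closed_compact_projection) auto
  let ?T = "N - {U. \<exists>w. w \<in> cball 0 R \<and> (w, U) \<in> K}"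
  have "open ?T" using \<open>open N\<close> B by (rule open_Diff)
  moreover have "U0 \<in> ?T"
    using U0 \<delta> C by (auto simp: N_def K_def generic_def)
  moreover have "generic U" if U: "U \<in> ?T" for U
  proof -
    have c: "norm (?c U) > \<delta>" "\<And>m. m \<le> ?d \<Longrightarrow> norm (form_coeff U m) < C"
      using U by (auto simp: N_def)
    have "norm (poly (wronskian (form_x U) (form_y U)) w) \<noteq> (norm (poly (form_y U) w))\<^sup>2"
      if w: "hpoly (form_x U) (form_y U) w = 0" for w
    proof -
      have "norm w \<le> R"
        unfolding R_def using c by (intro hpoly_zero_bound[OF d w \<delta>(1)]) (auto intro: less_imp_le)
      then show ?thesis using U w by (auto simp: K_def)
    qed
    then show ?thesis using c(1) \<delta>(1) by (auto simp: generic_def)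
  qed
  ultimately show "\<exists>T. open T \<and> U0 \<in> T \<and> T \<subseteq> {U. generic U}" by blast
qed

section \<open>Density of the generic condition\<close>

text \<open>The real determinant is \<open>(norm \<alpha>)\<^sup>2 - (norm \<beta>)\<^sup>2\<close>.
  If it is 0, then \<open>\<alpha> * \<beta> * cnj y = \<alpha> * cnj \<alpha> * y\<close> on the
  range, and \<open>y = 1\<close> together with \<open>y = \<i>\<close> forces both coefficients to
  vanish.\<close>

lemma real_linear_complex_not_surj:
  assumes "norm \<alpha> = norm \<beta>"
  shows "\<not> surj (\<lambda>v. \<alpha> * v + \<beta> * cnj v)"
proof
  assume s: "surj (\<lambda>v. \<alpha> * v + \<beta> * cnj v)"
  have on: "\<exists>v. y = \<alpha> * v + \<beta> * cnj v" for y
    using surjD[OF s, of y] .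
  have ab: "\<alpha> * cnj \<alpha> = \<beta> * cnj \<beta>"
    using assms by (simp flip: complex_norm_square)
  have eq: "\<alpha> * \<beta> * cnj y = \<alpha> * cnj \<alpha> * y" for y
  proof -
    obtain v where v: "y = \<alpha> * v + \<beta> * cnj v" using on by blast
    have "\<alpha> * \<beta> * cnj y = (\<alpha> * cnj \<alpha>) * \<beta> * cnj v + \<alpha> * (\<beta> * cnj \<beta>) * v"
      unfolding v by (simp add: algebra_simps)
    also have "\<dots> = \<alpha> * cnj \<alpha> * y"
      unfolding v ab[symmetric] by (simp add: algebra_simps)
    finally show ?thesis .
  qed
  have 1: "\<alpha> * \<beta> = \<alpha> * cnj \<alpha>" using eq[of 1] by simp
  have 2: "\<alpha> * cnj \<alpha> * (- \<i>) = \<alpha> * cnj \<alpha> * \<i>"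
    using eq[of \<i>] unfolding 1 by simp
  have "\<alpha> * cnj \<alpha> * (2 * \<i>) = \<alpha> * cnj \<alpha> * \<i> - \<alpha> * cnj \<alpha> * (- \<i>)"
    unfolding right_diff_distrib[symmetric] by simp
  then have "\<alpha> * cnj \<alpha> = 0" unfolding 2 by simp
  then have "\<alpha> = 0" "\<beta> = 0" using ab by auto
  then show False using on[of 1] by simp
qed

text \<open>Sard's theorem between spaces of equal dimension, carried over from
  \<open>real ^ 2\<close>; a negligible set has empty interior.\<close>

lemma complex_Sard:
  fixes f :: "complex \<Rightarrow> complex"
  assumes der: "\<And>x. x \<in> S \<Longrightarrow> (f has_derivative f' x) (at x)"
    and "\<And>x. x \<in> S \<Longrightarrow> \<not> surj (f' x)"
  shows "interior (f ` S) = {}"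
proof -
  define to_c :: "real ^ 2 \<Rightarrow> complex" where "to_c x = Complex (x $ 1) (x $ 2)" for x
  define of_c :: "complex \<Rightarrow> real ^ 2" where "of_c z = vector [Re z, Im z]" for z
  have inv: "to_c (of_c z) = z" "of_c (to_c x) = x" for z x
    by (auto simp: to_c_def of_c_def vec_eq_iff forall_2)
  have to_c_eq: "to_c x = of_real (x $ 1) + \<i> * of_real (x $ 2)" for x
    by (simp add: to_c_def Complex_eq)
  have bl1: "bounded_linear to_c"
    unfolding to_c_eq 
    by (intro bounded_linear_add bounded_linear_const_mult
      bounded_linear_compose[OF bounded_linear_of_real bounded_linear_vec_nth])
  have bl2: "bounded_linear of_c"
  proof -
    have "of_c = (\<lambda>z. Re z *\<^sub>R axis 1 1 + Im z *\<^sub>R axis 2 1)"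
      by (auto simp: of_c_def vec_eq_iff forall_2 axis_def fun_eq_iff)
    moreover have "bounded_linear \<dots>"
      by (intro bounded_linear_add bounded_linear_compose[OF bounded_linear_scaleR_left bounded_linear_Re]
        bounded_linear_compose[OF bounded_linear_scaleR_left bounded_linear_Im])
    ultimately show ?thesis by simp
  qed
  let ?g = "\<lambda>x. of_c (f (to_c x))"
  let ?g' = "\<lambda>x v. of_c (f' (to_c x) (to_c v))"
  have "negligible (?g ` (to_c -` S))"
  proof (rule baby_Sard)
    fix x assume x: "x \<in> to_c -` S"
    have "(?g has_derivative ?g' x) (at x)"
      using x by (intro bounded_linear.has_derivative[OF bl2]
        has_derivative_compose[OF bounded_linear.has_derivative[OF bl1 has_derivative_ident] der]) auto
    then show gd: "(?g has_derivative ?g' x) (at x within to_c -` S)"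
      by (rule has_derivative_at_withinI)
    have "\<not> surj (?g' x)"
    proof
      assume s: "surj (?g' x)"
      have "surj (f' (to_c x))"
      proof (rule surjI)
        fix y show "f' (to_c x) (to_c (inv (?g' x) (of_c y))) = y"
          using surj_f_inv_f[OF s, of "of_c y"] inv by metis
      qed
      then show False using assms(2) x by auto
    qed
    moreover have "(*v) (matrix (?g' x)) = ?g' x"
      using matrix_vector_mul(2)[OF has_derivative_linear[OF gd]] by simp
    ultimately have "rank (matrix (?g' x)) \<noteq> CARD(2)"
      unfolding full_rank_surjective by simp
    then show "rank (matrix (?g' x)) < CARD(2)"
      using rank_bound[of "matrix (?g' x)"] by simp
  qed auto
  moreover have "?g ` (to_c -` S) = of_c ` (f ` S)"
  proof -
    have "to_c ` (to_c -` S) = S" using inv by (intro surj_image_vimage_eq surjI)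
    then show ?thesis by (metis image_image)
  qed
  ultimately have neg: "negligible (of_c ` (f ` S))" by simp
  have "of_c ` interior (f ` S) = to_c -` interior (f ` S)"
  proof
    show "to_c -` interior (f ` S) \<subseteq> of_c ` interior (f ` S)"
      using inv(2) by (metis imageI subsetI vimageE)
  qed (auto simp: inv)
  moreover have "open (to_c -` interior (f ` S))"
    by (intro open_vimage) (auto intro: linear_continuous_on bl1)
  moreover have "negligible (of_c ` interior (f ` S))"
    by (rule negligible_subset[OF neg]) (use interior_subset in blast)
  ultimately have "of_c ` interior (f ` S) = {}"
    using open_not_negligible by metis
  then show ?thesis by simp
qed

text \<open>Adding a multiple of it changes exactly one coefficient of the form (for
  \<open>m \<le> CARD('d)\<close>) and preserves symmetry.\<close>

definition ones_tensor :: "nat \<Rightarrow> ('d::finite) tensor"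
  where "ones_tensor m = (\<chi> j. if ones j = m then 1 else 0)"

lemma form_coeff_perturb:
  "form_coeff (U + c *s ones_tensor m :: 'd::finite tensor) k =
    form_coeff U k + (if k = m then c * of_nat (card {j :: 'd \<Rightarrow> 2. ones j = m}) else 0)"
  by (auto simp: form_coeff_def ones_tensor_def sum.distrib)

lemma card_ones_pos: "m \<le> CARD('d::finite) \<Longrightarrow> card {j :: 'd \<Rightarrow> 2. ones j = m} > 0"
  using ones_exists[of m, where 'd = 'd] by (auto simp: card_gt_0_iff)

lemma symmetric_tensors_perturb:
  assumes "U \<in> symmetric_tensors"
  shows "U + c *s ones_tensor m \<in> (symmetric_tensors :: 'd::finite tensor set)"
proof -
  have "ones (j \<circ> p) = ones j" if "bij p" for j :: "'d \<Rightarrow> 2" and p :: "'d \<Rightarrow> 'd"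
  proof -
    have "{k. j k = 1} = p ` {k. j (p k) = 1}"
      using that by (auto simp: image_iff) (metis bij_pointE)
    then show ?thesis
      unfolding ones_def using card_image[OF inj_on_subset[OF bij_is_inj[OF that] subset_UNIV]]
      by (simp add: o_def)
  qed
  then show ?thesis using assms by (simp add: symmetric_tensors_def ones_tensor_def)
qed

lemma norm_scaled_ones_tensor: "norm (c *s ones_tensor m :: 'd::finite tensor) = norm c * norm (ones_tensor m :: 'd tensor)"
proof -
  have "norm (c *s ones_tensor m :: 'd tensor) = sqrt ((norm c)\<^sup>2 * (\<Sum>j\<in>UNIV. (norm ((ones_tensor m :: 'd tensor) $ j))\<^sup>2))"
    by (simp add: norm_vec_def L2_set_def norm_mult power_mult_distrib sum_distrib_left)
  then show ?thesis by (simp add: real_sqrt_mult norm_vec_def L2_set_def)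
qed

lemma perturb_coeff_nonzero:
  assumes "m \<le> CARD('d::finite)" "\<epsilon> > 0"
  obtains c where "form_coeff (U + c *s ones_tensor m :: 'd tensor) m \<noteq> 0"
    "norm (c *s ones_tensor m :: 'd tensor) < \<epsilon>"
proof (cases "form_coeff U m = 0")
  case False
  then show ?thesis using that[of 0] assms by simp
next
  case True
  define c where "c = \<epsilon> / 2 / (1 + norm (ones_tensor m :: 'd tensor))"
  have pos: "1 + norm (ones_tensor m :: 'd tensor) > 0" by (simp add: add_pos_nonneg)
  then have c: "c > 0" "c * (1 + norm (ones_tensor m :: 'd tensor)) = \<epsilon> / 2"
    using assms(2) nonzero_eq_divide_eq[of "1 + norm (ones_tensor m :: 'd tensor)" c "\<epsilon> / 2"]
    by (auto simp: c_def)
  show ?thesis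
  proof (rule that[of "of_real c"])
    show "form_coeff (U + of_real c *s ones_tensor m) m \<noteq> 0"
    proof -
      have "of_nat (card {j :: 'd \<Rightarrow> 2. ones j = m}) \<noteq> (0 :: complex)"
        using card_ones_pos[OF assms(1)] by (metis less_irrefl of_nat_eq_0_iff)
      then show ?thesis
        unfolding form_coeff_perturb True using c(1) by (simp del: of_nat_eq_0_iff)
    qed
    have "norm (of_real c *s ones_tensor m :: 'd tensor) = c * norm (ones_tensor m :: 'd tensor)"
      using c by (simp add: norm_scaled_ones_tensor)
    also have "\<dots> < \<epsilon>" using c assms(2) by (simp add: algebra_simps)
    finally show "norm (of_real c *s ones_tensor m :: 'd tensor) < \<epsilon>" .
  qed
qed

text \<open>Adding a constant \<open>c\<close> to the form, the equation is solved for \<open>c\<close>, and its degenerate solutions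
  are critical points of the resulting function of \<open>w\<close>.\<close>

lemma generic_perturb_const:
  fixes U :: "'d::finite tensor"
  assumes d: "CARD('d) \<ge> 2" and nz: "form_coeff U 1 \<noteq> 0" "form_coeff U (CARD('d) - 1) \<noteq> 0" and "\<epsilon> > 0"
  obtains c where "generic (U + c *s ones_tensor 0)" "norm c < \<epsilon>"
proof -
  define p where "p = form_x U"
  define q where "q = form_y U"
  define N where "N = complex_of_nat (CARD('d) * card {j :: 'd \<Rightarrow> 2. ones j = 0})"
  have "CARD('d) * card {j :: 'd \<Rightarrow> 2. ones j = 0} > 0"
    by (rule mult_pos_pos[OF zero_less_card_finite card_ones_pos]) simp
  then have N: "N \<noteq> 0" unfolding N_def by (metis of_nat_eq_0_iff less_irrefl)
  have fc: "form (U + c *s ones_tensor 0) = form U + [:c * of_nat (card {j :: 'd \<Rightarrow> 2. ones j = 0}):]" for c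
    by (rule poly_eqI) (simp add: coeff_form form_coeff_perturb coeff_pCons split: nat.split)
  have fx: "form_x (U + c *s ones_tensor 0) = p" for c
    by (simp add: form_x_def fc p_def pderiv_add pderiv_pCons)
  have fy: "form_y (U + c *s ones_tensor 0) = q + [:c * N:]" for c
    by (simp add: form_y_def fc q_def pderiv_add pderiv_pCons smult_add_right N_def mult_ac)
  \<comment> \<open>Since \<open>form_coeff U 1 \<noteq> 0\<close>, the origin is not a solution for
    any \<open>c\<close>, and dividing by \<open>cnj w\<close> is allowed.\<close>
  have p0: "poly p 0 \<noteq> 0"
    using nz(1) by (simp add: p_def form_x_def poly_0_coeff_0 coeff_pderiv coeff_form Suc_le_eq)
  define \<Phi> where "\<Phi> w = (poly p w / cnj w - poly q w) / N" for w
  define \<alpha> where "\<alpha> w = cnj w * poly (pderiv q) w - poly (pderiv p) w" for w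
  define \<beta> where "\<beta> w = poly p w / cnj w" for w
  \<comment> \<open>\<open>\<alpha> w\<close> and \<open>\<beta> w\<close> are the real-linear
    coefficients of the derivative of the equation at a solution, where \<open>\<beta> w\<close> is
    the value of the perturbed \<open>q\<close>. Equal norms mean that the derivative of
    \<open>\<Phi>\<close> is singular.\<close>
  define S where "S = {w. w \<noteq> 0 \<and> norm (\<alpha> w) = norm (\<beta> w)}"
  have int: "interior (\<Phi> ` S) = {}"
  proof (rule complex_Sard)
    fix w assume w: "w \<in> S"
    have q: "(poly r has_derivative (\<lambda>v. poly (pderiv r) w * v)) (at w)" for r :: "complex poly"
      using poly_DERIV[of r w] by (simp add: has_field_derivative_def)
    show "(\<Phi> has_derivative (\<lambda>v. (- 1 / (N * cnj w)) * (\<alpha> w * v + \<beta> w * cnj v))) (at w)"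
      unfolding \<Phi>_def using w N
      by (auto intro!: derivative_eq_intros q simp: S_def \<alpha>_def \<beta>_def field_simps)
    have "surj (\<lambda>v. \<alpha> w * v + \<beta> w * cnj v)"
      if s: "surj (\<lambda>v. (- 1 / (N * cnj w)) * (\<alpha> w * v + \<beta> w * cnj v))"
    proof -
      have "\<exists>v. y = \<alpha> w * v + \<beta> w * cnj v" for y
      proof -
        obtain v where v: "(- 1 / (N * cnj w)) * y = (- 1 / (N * cnj w)) * (\<alpha> w * v + \<beta> w * cnj v)"
          using surjD[OF s, of "(- 1 / (N * cnj w)) * y"] by blast
        moreover have "- 1 / (N * cnj w) \<noteq> 0" using w N by (simp add: S_def)
        ultimately show ?thesis by (metis mult_left_cancel)
      qed
      then show ?thesis unfolding surj_def by blast
    qed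
    then show "\<not> surj (\<lambda>v. (- 1 / (N * cnj w)) * (\<alpha> w * v + \<beta> w * cnj v))"
      using real_linear_complex_not_surj[of "\<alpha> w" "\<beta> w"] w by (auto simp: S_def)
  qed
  \<comment> \<open>These constants make \<open>p\<close> and the perturbed \<open>q\<close> share a
    zero. They are finitely many, and avoiding them allows cancelling \<open>poly ?q w\<close> at
    the end.\<close>
  define X where "X = (\<lambda>w. - poly q w / N) ` {w. poly p w = 0}"
  have "p \<noteq> 0" using p0 by auto
  then have "finite X" unfolding X_def by (intro finite_imageI poly_roots_finite)
  then have "open (ball 0 \<epsilon> - X)" by (intro open_Diff finite_imp_closed) auto
  moreover have "ball 0 \<epsilon> - X \<noteq> {}"
    using \<open>finite X\<close> uncountable_ball[OF \<open>\<epsilon> > 0\<close>, of "0 :: complex"]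
    by (metis Diff_eq_empty_iff countable_finite finite_subset)
  ultimately have "\<not> ball 0 \<epsilon> - X \<subseteq> \<Phi> ` S"
    using int interior_maximal[of "ball 0 \<epsilon> - X" "\<Phi> ` S"] by blast
  then obtain c where c: "c \<in> ball 0 \<epsilon>" "c \<notin> X" "c \<notin> \<Phi> ` S"
    by blast
  have "generic (U + c *s ones_tensor 0)"
    unfolding generic_def fx fy
  proof (intro conjI allI impI)
    show "form_coeff (U + c *s ones_tensor 0) (CARD('d) - 1) \<noteq> 0"
      using nz(2) d by (simp add: form_coeff_perturb)
    fix w assume z: "hpoly p (q + [:c * N:]) w = 0"
    let ?q = "q + [:c * N:]"
    have w: "w \<noteq> 0" using z p0 by (auto simp: hpoly_def)
    have pq: "poly p w = cnj w * poly ?q w" using z by (simp add: hpoly_def)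
    have \<beta>: "poly ?q w = \<beta> w" using pq w by (simp add: \<beta>_def)
    have "c * N = \<beta> w - poly q w" using \<beta> by (simp add: algebra_simps)
    then have cw: "c = \<Phi> w" using N by (simp add: \<Phi>_def \<beta>_def nonzero_eq_divide_eq)
    have "poly p w \<noteq> 0"
    proof
      assume p: "poly p w = 0"
      then have "c = - poly q w / N" using cw by (simp add: \<Phi>_def)
      then show False using c(2) p by (auto simp: X_def)
    qed
    then have q0: "poly ?q w \<noteq> 0" using pq by auto
    have "norm (\<alpha> w) \<noteq> norm (\<beta> w)" using c(3) cw w by (auto simp: S_def)
    moreover have "poly ?q w * \<alpha> w = - poly (wronskian p ?q) w"
      using hpoly_zero_wronskian[OF z] by (simp add: \<alpha>_def pderiv_add pderiv_pCons)
    then have "norm (poly (wronskian p ?q) w) = norm (poly ?q w) * norm (\<alpha> w)"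
      by (metis norm_minus_cancel norm_mult)
    ultimately show "norm (poly (wronskian p ?q) w) \<noteq> (norm (poly ?q w))\<^sup>2"
      using q0 \<beta> by (simp add: power2_eq_square)
  qed
  then show ?thesis using that c(1) by simp
qed

text \<open>Three perturbations, each below \<open>\<epsilon> / 3\<close>: the coefficients 1 and
  \<open>CARD('d) - 1\<close> are made nonzero, then \<open>generic_perturb_const\<close> applies.
  As \<open>CARD('d) \<ge> 3\<close>, these coefficients are different ones, so the second
  perturbation leaves the first intact.\<close>

lemma generic_dense:
  fixes U :: "'d::finite tensor"
  assumes d: "CARD('d) \<ge> 3" and "\<epsilon> > 0"
  obtains V where "generic V" "dist U V < \<epsilon>" "U \<in> symmetric_tensors \<Longrightarrow> V \<in> symmetric_tensors"
proof -
  let ?d = "CARD('d)"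
  have "\<epsilon> / 3 > 0" using \<open>\<epsilon> > 0\<close> by simp
  obtain c1 where c1: "form_coeff (U + c1 *s ones_tensor 1) 1 \<noteq> 0" "norm (c1 *s ones_tensor 1 :: 'd tensor) < \<epsilon> / 3"
    using perturb_coeff_nonzero[of 1 "\<epsilon> / 3" U] d \<open>\<epsilon> / 3 > 0\<close> by auto
  define U1 where "U1 = U + c1 *s ones_tensor 1"
  obtain c2 where c2: "form_coeff (U1 + c2 *s ones_tensor (?d - 1)) (?d - 1) \<noteq> 0"
    "norm (c2 *s ones_tensor (?d - 1) :: 'd tensor) < \<epsilon> / 3"
    using perturb_coeff_nonzero[of "?d - 1" "\<epsilon> / 3" U1] \<open>\<epsilon> / 3 > 0\<close> by auto
  define U2 where "U2 = U1 + c2 *s ones_tensor (?d - 1)"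
  have "form_coeff U2 1 \<noteq> 0" using c1(1) d by (simp add: U2_def U1_def form_coeff_perturb)
  define e where "e = \<epsilon> / 3 / (1 + norm (ones_tensor 0 :: 'd tensor))"
  have pos: "1 + norm (ones_tensor 0 :: 'd tensor) > 0" by (simp add: add_pos_nonneg)
  have "e > 0" using pos \<open>\<epsilon> > 0\<close> by (simp add: e_def)
  obtain c where c: "generic (U2 + c *s ones_tensor 0)" "norm c < e"
    using generic_perturb_const[of U2 e] \<open>form_coeff U2 1 \<noteq> 0\<close> c2(1) d \<open>e > 0\<close> by (auto simp: U2_def)
  have "norm (c *s ones_tensor 0 :: 'd tensor) \<le> norm c * (1 + norm (ones_tensor 0 :: 'd tensor))"
    unfolding norm_scaled_ones_tensor by (simp add: algebra_simps)
  also have "\<dots> < \<epsilon> / 3" using c(2) pos_less_divide_eq[OF pos, of "norm c" "\<epsilon> / 3"] unfolding e_def by blast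
  finally have c3: "norm (c *s ones_tensor 0 :: 'd tensor) < \<epsilon> / 3" .
  show ?thesis
  proof (rule that[OF c(1)])
    have "dist U (U2 + c *s ones_tensor 0) = norm (c1 *s ones_tensor 1 + c2 *s ones_tensor (?d - 1) + c *s ones_tensor 0 :: 'd tensor)"
      by (subst dist_commute, subst dist_norm) (simp add: U2_def U1_def add.assoc)
    then show "dist U (U2 + c *s ones_tensor 0) < \<epsilon>"
      using c1(2) c2(2) c3 norm_triangle_ineq[of "c1 *s ones_tensor 1 + c2 *s ones_tensor (?d - 1)" "c *s ones_tensor 0 :: 'd tensor"]
        norm_triangle_ineq[of "c1 *s ones_tensor 1" "c2 *s ones_tensor (?d - 1) :: 'd tensor"] by linarith
    show "U2 + c *s ones_tensor 0 \<in> symmetric_tensors" if "U \<in> symmetric_tensors"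
      using that by (simp add: U2_def U1_def symmetric_tensors_perturb)
  qed
qed

section \<open>Persistence of solutions under perturbation\<close>

lemma real_linear_complex_inverse:
  assumes "norm \<alpha> \<noteq> norm \<beta>"
  obtains g where "bounded_linear g" "\<And>y. \<alpha> * g y + \<beta> * cnj (g y) = y"
proof
  define D where "D = \<alpha> * cnj \<alpha> - \<beta> * cnj \<beta>"
  have D: "D \<noteq> 0" "cnj D = D"
    using assms by (auto simp: D_def simp flip: complex_norm_square of_real_power)
  let ?g = "\<lambda>y. (cnj \<alpha> * y - \<beta> * cnj y) / D"
  show "bounded_linear ?g"
    by (intro bounded_linear_divide[THEN bounded_linear_compose] bounded_linear_sub
      bounded_linear_const_mult bounded_linear_ident bounded_linear_cnj)
  show "\<alpha> * ?g y + \<beta> * cnj (?g y) = y" for y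
  proof -
    have "\<alpha> * ?g y + \<beta> * cnj (?g y) = (\<alpha> * cnj \<alpha> - \<beta> * cnj \<beta>) * y / D"
      by (simp add: D(2) add_divide_distrib[symmetric] algebra_simps diff_divide_distrib)
    then show ?thesis using D(1) by (simp add: D_def)
  qed
qed

text \<open>With \<open>f\<close> the left side of the equation, the map
  \<open>(U, w) \<mapsto> (U, f U w)\<close> has an invertible derivative at a nondegenerate
  solution, so the image of \<open>UNIV \<times> ball w0 e\<close> is a neighbourhood of
  \<open>(U0, 0)\<close>.\<close>

lemma hpoly_zero_persists:
  fixes U0 :: "'d::finite tensor"
  assumes "generic U0" "w0 \<in> hpoly_zeros U0" "e > 0"
  obtains \<delta> where "\<delta> > 0" "\<And>U. dist U0 U < \<delta> \<Longrightarrow> \<exists>w\<in>ball w0 e. w \<in> hpoly_zeros U"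
proof -
  define f where "f U w = hpoly (form_x U) (form_y U) w" for U :: "'d tensor" and w
  define \<alpha> where "\<alpha> = cnj w0 * poly (pderiv (form_y U0)) w0 - poly (pderiv (form_x U0)) w0"
  define \<beta> where "\<beta> = poly (form_y U0) w0"
  have zero: "f U0 w0 = 0" using assms(2) by (simp add: f_def hpoly_zeros_def)
  have L: "(f U0 has_derivative (\<lambda>v. \<alpha> * v + \<beta> * cnj v)) (at w0)"
    using has_derivative_hpoly[of "form_x U0" "form_y U0" w0] unfolding f_def \<alpha>_def \<beta>_def by simp
  have "norm (\<beta> * \<alpha>) = norm (poly (wronskian (form_x U0) (form_y U0)) w0)"
    using hpoly_zero_wronskian[of "form_x U0" "form_y U0" w0] zero
    unfolding f_def \<alpha>_def \<beta>_def by simp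
  moreover have "norm (poly (wronskian (form_x U0) (form_y U0)) w0) \<noteq> (norm \<beta>)\<^sup>2"
    using assms(1,2) by (simp add: generic_def hpoly_zeros_def \<beta>_def)
  ultimately have "norm \<alpha> \<noteq> norm \<beta>"
    by (auto simp: norm_mult power2_eq_square)
  then obtain g where g: "bounded_linear g" "\<And>y. \<alpha> * g y + \<beta> * cnj (g y) = y"
    using real_linear_complex_inverse by blast
  define \<phi> where "\<phi> m w = of_nat (CARD('d) - m) * w ^ m * cnj w - of_nat m * w ^ (m - 1)" for m and w :: complex
  have f_eq: "f U w = (\<Sum>m\<le>CARD('d). form_coeff U m * \<phi> m w)" for U :: "'d tensor" and w
    by (simp add: f_def hpoly_form_eq \<phi>_def)
  have "\<exists>D. (\<phi> m has_derivative D) (at w0)" for m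
    unfolding \<phi>_def by (rule exI) (rule derivative_eq_intros refl)+
  then obtain D where D: "\<And>m. (\<phi> m has_derivative D m) (at w0)" by metis
  \<comment> \<open>The derivatives \<open>D m\<close> stay abstract; uniqueness identifies their
    weighted sum with the known derivative of \<open>f U0\<close>.\<close>
  have "(f U0 has_derivative (\<lambda>v. \<Sum>m\<le>CARD('d). form_coeff U0 m * D m v)) (at w0)"
    unfolding f_eq by (intro has_derivative_sum has_derivative_mult_right D)
  then have LD: "(\<Sum>m\<le>CARD('d). form_coeff U0 m * D m v) = \<alpha> * v + \<beta> * cnj v" for v
    using has_derivative_unique[OF L] by metis
  let ?F = "\<lambda>x. (fst x, f (fst x) (snd x))"
  let ?F' = "\<lambda>x. (fst x, f (fst x) w0 + (\<alpha> * snd x + \<beta> * cnj (snd x)))"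
  let ?G = "\<lambda>y. (fst y, g (snd y - f (fst y) w0))"
  have "(?F has_derivative ?F') (at (U0, w0))"
  proof (rule has_derivative_Pair)
    show "(fst has_derivative fst) (at (U0, w0))" by (rule has_derivative_fst[OF has_derivative_ident])
    have "((\<lambda>x. form_coeff (fst x) m * \<phi> m (snd x)) has_derivative
        (\<lambda>x. form_coeff U0 m * D m (snd x) + form_coeff (fst x) m * \<phi> m w0)) (at (U0, w0))" for m
    proof -
      have 1: "((\<lambda>x::'d tensor \<times> complex. form_coeff (fst x) m) has_derivative (\<lambda>x. form_coeff (fst x) m)) (at (U0, w0))"
        by (intro bounded_linear.has_derivative[OF bounded_linear_form_coeff] has_derivative_fst has_derivative_ident)
      have 2: "((\<lambda>x::'d tensor \<times> complex. \<phi> m (snd x)) has_derivative (\<lambda>x. D m (snd x))) (at (U0, w0))"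
        by (rule has_derivative_compose[OF has_derivative_snd[OF has_derivative_ident]]) (simp add: D)
      show ?thesis using has_derivative_mult[OF 1 2] by simp
    qed
    then have "((\<lambda>x. f (fst x) (snd x)) has_derivative
        (\<lambda>x. \<Sum>m\<le>CARD('d). form_coeff U0 m * D m (snd x) + form_coeff (fst x) m * \<phi> m w0)) (at (U0, w0))"
      unfolding f_eq by (rule has_derivative_sum)
    then show "((\<lambda>x. f (fst x) (snd x)) has_derivative
        (\<lambda>x. f (fst x) w0 + (\<alpha> * snd x + \<beta> * cnj (snd x)))) (at (U0, w0))"
      by (simp add: sum.distrib LD f_eq[symmetric] add.commute)
  qed
  moreover have "bounded_linear ?G"
  proof -
    have "bounded_linear (\<lambda>y::'d tensor \<times> complex. f (fst y) w0)"
      unfolding f_eq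
      by (intro bounded_linear_sum bounded_linear_mult_const bounded_linear_compose[OF bounded_linear_form_coeff] bounded_linear_fst)
    then show ?thesis
      by (intro bounded_linear_Pair bounded_linear_fst bounded_linear_compose[OF g(1)] bounded_linear_sub bounded_linear_snd)
  qed
  moreover have "?F' \<circ> ?G = id"
    by (auto simp: fun_eq_iff g(2))
  moreover have "continuous_on UNIV ?F"
    unfolding f_def hpoly_def by (intro continuous_intros)
  moreover have "(U0, w0) \<in> interior (UNIV \<times> ball w0 e)"
    using assms(3) by (simp add: interior_Times)
  ultimately have "?F (U0, w0) \<in> interior (?F ` (UNIV \<times> ball w0 e))"
    by (intro sussmann_open_mapping[where S = UNIV and f' = ?F' and g' = ?G]) auto
  then obtain \<delta> where \<delta>: "\<delta> > 0" "ball (U0, 0) \<delta> \<subseteq> ?F ` (UNIV \<times> ball w0 e)"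
    using zero unfolding mem_interior by auto
  show ?thesis
  proof (rule that[OF \<delta>(1)])
    fix U assume "dist U0 U < \<delta>"
    then have "(U, 0) \<in> ball (U0, 0) \<delta>" by (simp add: dist_Pair_Pair)
    then obtain w where "w \<in> ball w0 e" "f U w = 0" using \<delta>(2) by force
    then show "\<exists>w\<in>ball w0 e. w \<in> hpoly_zeros U" by (auto simp: f_def hpoly_zeros_def)
  qed
qed

lemma finite_hpoly_zeros_generic:
  fixes U :: "'d::finite tensor"
  assumes "generic U" "CARD('d) \<ge> 2"
  shows "finite (hpoly_zeros U)"
  unfolding hpoly_zeros_def
proof (rule finite_hpoly_zeros[OF degree_form_x degree_form_y])
  show "form_y U \<noteq> 0" using assms degree_form_y[of U] by (auto simp: generic_def)
qed (use assms in \<open>auto simp: generic_def\<close>)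

text \<open>Each nondegenerate solution persists in a disc of its own, and the discs are
  disjoint.\<close>

lemma card_hpoly_zeros_lower_semicontinuous:
  fixes U0 :: "'d::finite tensor"
  assumes U0: "generic U0" and d: "CARD('d) \<ge> 2"
  obtains \<delta> where "\<delta> > 0"
    "\<And>U. dist U0 U < \<delta> \<Longrightarrow> generic U \<and> card (hpoly_zeros U0) \<le> card (hpoly_zeros U)"
proof -
  let ?Z = "hpoly_zeros U0"
  have fin: "finite ?Z" using finite_hpoly_zeros_generic[OF U0 d] .
  obtain \<delta>0 where \<delta>0: "\<delta>0 > 0" "ball U0 \<delta>0 \<subseteq> {U. generic U}"
    using open_generic[where 'd = 'd, OF d] U0 open_contains_ball by blast
  have "\<exists>e>0. \<forall>x\<in>?Z. x \<noteq> z \<longrightarrow> 2 * e \<le> dist z x" for z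
  proof -
    obtain e where "e > 0" "\<forall>x\<in>?Z. x \<noteq> z \<longrightarrow> e \<le> dist z x"
      using finite_set_avoid[OF fin] by blast
    then show ?thesis by (intro exI[of _ "e / 2"]) auto
  qed
  then obtain e where e: "\<And>z. e z > 0" "\<And>z x. x \<in> ?Z \<Longrightarrow> x \<noteq> z \<Longrightarrow> 2 * e z \<le> dist z x"
    by metis
  have disj: "z = x" if "z \<in> ?Z" "x \<in> ?Z" "w \<in> ball z (e z)" "w \<in> ball x (e x)" for z x w
  proof (rule ccontr)
    assume "z \<noteq> x"
    then show False
      using e(2)[of x z] e(2)[of z x] that dist_triangle[of z x w] by (auto simp: dist_commute)
  qed
  have "\<exists>\<delta>>0. \<forall>U. dist U0 U < \<delta> \<longrightarrow> (\<exists>w\<in>ball z (e z). w \<in> hpoly_zeros U)" if "z \<in> ?Z" for z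
    using hpoly_zero_persists[OF U0 that e(1)] by metis
  then obtain \<delta> where \<delta>: "\<And>z. z \<in> ?Z \<Longrightarrow> \<delta> z > 0"
    "\<And>z U. z \<in> ?Z \<Longrightarrow> dist U0 U < \<delta> z \<Longrightarrow> \<exists>w\<in>ball z (e z). w \<in> hpoly_zeros U"
    by metis
  define \<delta>1 where "\<delta>1 = Min (insert \<delta>0 (\<delta> ` ?Z))"
  have \<delta>1: "\<delta>1 > 0" "\<delta>1 \<le> \<delta>0" "\<And>z. z \<in> ?Z \<Longrightarrow> \<delta>1 \<le> \<delta> z"
    using fin \<delta>0(1) \<delta>(1) by (auto simp: \<delta>1_def)
  show ?thesis
  proof (rule that[OF \<delta>1(1)])
    fix U assume U: "dist U0 U < \<delta>1"
    then have "U \<in> ball U0 \<delta>0" using \<delta>1(2) by simp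
    then have g: "generic U" using \<delta>0(2) by blast
    have "\<forall>z\<in>?Z. \<exists>w\<in>ball z (e z). w \<in> hpoly_zeros U"
      using \<delta>(2) \<delta>1(3) U by (meson less_le_trans)
    then obtain \<zeta> where \<zeta>: "\<And>z. z \<in> ?Z \<Longrightarrow> \<zeta> z \<in> ball z (e z)" "\<And>z. z \<in> ?Z \<Longrightarrow> \<zeta> z \<in> hpoly_zeros U"
      by metis
    have "inj_on \<zeta> ?Z" using disj \<zeta>(1) by (metis inj_onI)
    then have "card ?Z \<le> card (hpoly_zeros U)"
      using \<zeta>(2) finite_hpoly_zeros_generic[OF g d] by (intro card_inj_on_le[of \<zeta>]) auto
    then show "generic U \<and> card ?Z \<le> card (hpoly_zeros U)" using g by blast
  qed
qed

section \<open>The Veronese cone\<close>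

text \<open>The derivative at \<open>t = 0\<close> of the tensor power of
  \<open>u + t *s v\<close>.\<close>

definition tangent_vector :: "complex ^ 2 \<Rightarrow> complex ^ 2 \<Rightarrow> ('d::finite) tensor"
  where "tangent_vector u v = (\<Sum>k\<in>UNIV. tensor_prod ((\<lambda>_. u)(k := v)))"

lemma tangent_vector_nth:
  "(tangent_vector u v :: 'd::finite tensor) $ j =
    v $ 1 * (of_nat (ones j) * u $ 1 ^ (ones j - 1) * u $ 2 ^ (CARD('d) - ones j)) +
    v $ 2 * (of_nat (CARD('d) - ones j) * u $ 1 ^ ones j * u $ 2 ^ (CARD('d) - ones j - 1))"
  unfolding slot_sum_index[symmetric] tangent_vector_def by (simp add: tensor_prod_def)

lemma poly_fun_diff: "poly_fun f \<Longrightarrow> poly_fun g \<Longrightarrow> poly_fun (\<lambda>x. f x - g x)"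
  using poly_fun.add[OF _ poly_fun.mult[OF poly_fun.const[of "- 1"]], of f g] by simp

text \<open>One representative of every line through the origin, so that a nonzero point of the cone
  is described by a scalar and a normalized vector.\<close>

definition charts :: "(complex ^ 2) set"
  where "charts = insert (vector [1, 0]) (range (\<lambda>t. vector [t, 1]))"

text \<open>In terms of \<open>ones\<close> the coordinates form a sequence, and the minors say that
  consecutive terms are in one ratio. The sequence is geometric if its first term is nonzero;
  otherwise only the last term survives.\<close>

lemma two_by_two_minors_imp_cone:
  fixes A :: "'d::finite tensor"
  assumes d: "CARD('d) \<ge> 2"
    and const: "\<And>j j'. ones j = ones j' \<Longrightarrow> A $ j = A $ j'"
    and minor: "\<And>j j' l l'. ones j' = Suc (ones j) \<Longrightarrow> ones l' = Suc (ones l) \<Longrightarrow> A $ j * A $ l' = A $ j' * A $ l"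
    and "A \<noteq> 0"
  obtains c w where "c \<noteq> 0" "w \<in> charts" "A = c *s tensor_power w"
proof -
  have "\<exists>\<alpha>. \<forall>j. A $ j = \<alpha> (ones j)"
  proof (intro exI allI)
    fix j :: "'d \<Rightarrow> 2"
    have "ones (SOME i :: 'd \<Rightarrow> 2. ones i = ones j) = ones j" by (rule someI[where P = "\<lambda>i. ones i = ones j"]) (rule refl)
    then show "A $ j = A $ (SOME i. ones i = ones j)" by (intro const) simp
  qed
  then obtain \<alpha> where \<alpha>: "\<And>j. A $ j = \<alpha> (ones j)" by blast
  have m: "\<alpha> k * \<alpha> (Suc l) = \<alpha> (Suc k) * \<alpha> l" if kl: "k < CARD('d)" "l < CARD('d)" for k l
  proof -
    obtain j :: "'d \<Rightarrow> 2" where j: "ones j = k" using kl by (meson less_imp_le ones_exists)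
    obtain j' :: "'d \<Rightarrow> 2" where j': "ones j' = Suc k" using kl by (meson Suc_leI ones_exists)
    obtain l1 :: "'d \<Rightarrow> 2" where l1: "ones l1 = l" using kl by (meson less_imp_le ones_exists)
    obtain l' :: "'d \<Rightarrow> 2" where l': "ones l' = Suc l" using kl by (meson Suc_leI ones_exists)
    show ?thesis using minor[of j' j l' l1] by (simp add: \<alpha> j j' l1 l')
  qed
  show ?thesis
  proof (cases "\<alpha> 0 = 0")
    case False
    define t where "t = \<alpha> 1 / \<alpha> 0"
    have pow: "\<alpha> k = \<alpha> 0 * t ^ k" if "k \<le> CARD('d)" for k
      using that
    proof (induction k)
      case (Suc k)
      then have "\<alpha> 0 * \<alpha> (Suc k) = \<alpha> 1 * \<alpha> k" using m[of 0 k] d by simp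
      then show ?case using Suc False by (simp add: t_def field_simps)
    qed simp
    have "A = \<alpha> 0 *s tensor_power (vector [t, 1])"
      unfolding vec_eq_iff scaled_tensor_power_nth using \<alpha> pow[OF ones_le] by simp
    then show ?thesis using that False by (auto simp: charts_def)
  next
    case True
    \<comment> \<open>The minor of neighbouring indices equates the square of
      \<open>\<alpha> (Suc k)\<close> with \<open>\<alpha> k * \<alpha> (Suc (Suc k))\<close>, so
      the zero propagates up to the last index but one.\<close>
    have 0: "\<alpha> k = 0" if "k < CARD('d)" for k
      using that
    proof (induction k)
      case (Suc k)
      then show ?case using m[of k "Suc k"] by simp
    qed (use True in simp)
    have A: "A = \<alpha> CARD('d) *s tensor_power (vector [1, 0])"
      unfolding vec_eq_iff scaled_tensor_power_nth
    proof
      fix j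
      show "A $ j = \<alpha> CARD('d) * ((vector [1, 0] :: complex ^ 2) $ 1 ^ ones j * (vector [1, 0] :: complex ^ 2) $ 2 ^ (CARD('d) - ones j))"
        using 0[of "ones j"] ones_le[of j] \<alpha>[of j] by (cases "ones j = CARD('d)") (auto simp: power_0_left)
    qed
    then have "\<alpha> CARD('d) \<noteq> 0" using \<open>A \<noteq> 0\<close> by auto
    then show ?thesis using that A by (auto simp: charts_def)
  qed
qed

text \<open>Invariance under permutations of the slots, together with the minors of the two-row
  Hankel matrix of the coordinates: the classical equations of the rational normal curve.\<close>

definition minor_eqs :: "(('d::finite) tensor \<Rightarrow> complex) set"
  where "minor_eqs = {(\<lambda>A. A $ j - A $ j') | j j'. ones j = ones j'} \<union>
    {(\<lambda>A. A $ j * A $ l' - A $ j' * A $ l) | j j' l l'. ones j' = Suc (ones j) \<and> ones l' = Suc (ones l)}"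

lemma veronese_cone_const:
  assumes "A \<in> (veronese_cone :: 'd::finite tensor set)" "ones j = ones j'"
  shows "A $ j = A $ j'"
proof -
  obtain c z where A: "A = c *s tensor_power z" using assms(1) by (auto simp: veronese_cone_def)
  show ?thesis unfolding A scaled_tensor_power_nth assms(2) ..
qed

lemma veronese_cone_minor:
  assumes "A \<in> (veronese_cone :: 'd::finite tensor set)" "ones j' = Suc (ones j)" "ones l' = Suc (ones l)"
  shows "A $ j * A $ l' = A $ j' * A $ l"
proof -
  obtain c z where A: "A = c *s tensor_power z" using assms(1) by (auto simp: veronese_cone_def)
  have "CARD('d) - ones j = Suc (CARD('d) - Suc (ones j))" "CARD('d) - ones l = Suc (CARD('d) - Suc (ones l))"
    using ones_le[of j'] ones_le[of l'] assms by simp_all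
  then show ?thesis unfolding A scaled_tensor_power_nth by (simp add: assms)
qed

lemma veronese_cone_eq:
  assumes "CARD('d::finite) \<ge> 2"
  shows "(veronese_cone :: 'd tensor set) = {A. \<forall>f\<in>minor_eqs. f A = 0}"
proof (intro equalityI subsetI)
  fix A :: "'d tensor" assume "A \<in> veronese_cone"
  show "A \<in> {A. \<forall>f\<in>minor_eqs. f A = 0}"
  proof (intro CollectI ballI)
    fix f :: "'d tensor \<Rightarrow> complex" assume "f \<in> minor_eqs"
    then consider j j' where "f = (\<lambda>A. A $ j - A $ j')" "ones j = ones j'"
      | j j' l l' where "f = (\<lambda>A. A $ j * A $ l' - A $ j' * A $ l)" "ones j' = Suc (ones j)" "ones l' = Suc (ones l)"
      unfolding minor_eqs_def by blast
    then show "f A = 0"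
    proof cases
      case (1 j j')
      then show ?thesis using veronese_cone_const[OF \<open>A \<in> veronese_cone\<close> 1(2)] by simp
    next
      case (2 j j' l l')
      then show ?thesis using veronese_cone_minor[OF \<open>A \<in> veronese_cone\<close> 2(2,3)] by simp
    qed
  qed
next
  fix A :: "'d tensor" assume "A \<in> {A. \<forall>f\<in>minor_eqs. f A = 0}"
  then have A: "\<And>f. f \<in> minor_eqs \<Longrightarrow> f A = 0" by blast
  have 1: "A $ j = A $ j'" if "ones j = ones j'" for j j'
  proof -
    have "(\<lambda>A. A $ j - A $ j') \<in> minor_eqs" unfolding minor_eqs_def using that by blast
    then show ?thesis using A by fastforce
  qed
  have 2: "A $ j * A $ l' = A $ j' * A $ l" if "ones j' = Suc (ones j)" "ones l' = Suc (ones l)" for j j' l l'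
  proof -
    have "(\<lambda>A. A $ j * A $ l' - A $ j' * A $ l) \<in> minor_eqs" unfolding minor_eqs_def using that by blast
    then show ?thesis using A by fastforce
  qed
  show "A \<in> veronese_cone"
  proof (cases "A = 0")
    case True
    then have "A = 0 *s tensor_power 0" by simp
    then show ?thesis unfolding veronese_cone_def by blast
  next
    case False
    obtain c w where "A = c *s tensor_power w"
      using two_by_two_minors_imp_cone[OF assms 1 2 False] by metis
    then show ?thesis unfolding veronese_cone_def by blast
  qed
qed

lemma poly_fun_minor_eqs: "f \<in> minor_eqs \<Longrightarrow> poly_fun f"
  unfolding minor_eqs_def by (auto intro!: poly_fun_diff poly_fun.intros)

lemma veronese_cone_cases:
  fixes A :: "'d::finite tensor"
  assumes "CARD('d) \<ge> 2" "A \<in> veronese_cone" "A \<noteq> 0"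
  obtains c w where "c \<noteq> 0" "w \<in> charts" "A = c *s tensor_power w"
  using two_by_two_minors_imp_cone[OF assms(1) veronese_cone_const[OF assms(2)]
      veronese_cone_minor[OF assms(2)] assms(3)] that by blast

lemma algebraic_set_veronese_cone:
  "CARD('d::finite) \<ge> 2 \<Longrightarrow> algebraic_set (veronese_cone :: 'd tensor set)"
  unfolding algebraic_set_def using veronese_cone_eq poly_fun_minor_eqs by blast

section \<open>Tangent spaces of the cone\<close>

text \<open>\<open>tangent_space\<close> is defined by the real Frechet derivative; for polynomials
  this ties it to complex derivatives along curves with a complex parameter.\<close>

lemma poly_fun_along_curve:
  assumes "poly_fun f"
  obtains f' where "\<And>x. (f has_derivative f' x) (at x)"
    "\<And>\<gamma> v t. (\<And>j. ((\<lambda>t. \<gamma> t $ j) has_field_derivative v $ j) (at t)) \<Longrightarrow>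
      ((\<lambda>t. f (\<gamma> t)) has_field_derivative f' (\<gamma> t) v) (at (t :: complex))"
proof -
  have "\<exists>f'. (\<forall>x. (f has_derivative f' x) (at x)) \<and>
    (\<forall>\<gamma> v t. (\<forall>j. ((\<lambda>t. \<gamma> t $ j) has_field_derivative v $ j) (at t)) \<longrightarrow>
      ((\<lambda>t. f (\<gamma> t)) has_field_derivative f' (\<gamma> t) v) (at (t :: complex)))"
    using assms
  proof induction
    case (const c)
    show ?case by (intro exI[of _ "\<lambda>_ _. 0"]) auto
  next
    case (coord i)
    show ?case
      by (intro exI[of _ "\<lambda>_ v. v $ i"]) (auto intro!: bounded_linear_imp_has_derivative bounded_linear_vec_nth)
  next
    case (add f g)
    then obtain f' g' where "\<forall>x. (f has_derivative f' x) (at x)" "\<forall>x. (g has_derivative g' x) (at x)"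
      "\<forall>\<gamma> v t. (\<forall>j. ((\<lambda>t. \<gamma> t $ j) has_field_derivative v $ j) (at t)) \<longrightarrow>
        ((\<lambda>t. f (\<gamma> t)) has_field_derivative f' (\<gamma> t) v) (at (t :: complex))"
      "\<forall>\<gamma> v t. (\<forall>j. ((\<lambda>t. \<gamma> t $ j) has_field_derivative v $ j) (at t)) \<longrightarrow>
        ((\<lambda>t. g (\<gamma> t)) has_field_derivative g' (\<gamma> t) v) (at (t :: complex))"
      by blast
    then show ?case
      by (intro exI[of _ "\<lambda>x v. f' x v + g' x v"]) (auto intro!: has_derivative_add DERIV_add)
  next
    case (mult f g)
    then obtain f' g' where "\<forall>x. (f has_derivative f' x) (at x)" "\<forall>x. (g has_derivative g' x) (at x)"
      "\<forall>\<gamma> v t. (\<forall>j. ((\<lambda>t. \<gamma> t $ j) has_field_derivative v $ j) (at t)) \<longrightarrow>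
        ((\<lambda>t. f (\<gamma> t)) has_field_derivative f' (\<gamma> t) v) (at (t :: complex))"
      "\<forall>\<gamma> v t. (\<forall>j. ((\<lambda>t. \<gamma> t $ j) has_field_derivative v $ j) (at t)) \<longrightarrow>
        ((\<lambda>t. g (\<gamma> t)) has_field_derivative g' (\<gamma> t) v) (at (t :: complex))"
      by blast
    then show ?case
      by (intro exI[of _ "\<lambda>x v. f x * g' x v + f' x v * g x"] conjI allI impI)
        (auto intro!: has_derivative_mult DERIV_mult')
  qed
  then show ?thesis using that by blast
qed

lemma tangent_space_curve:
  assumes "\<And>t. \<gamma> t \<in> X" "\<gamma> (0 :: complex) = z"
    and "\<And>j. ((\<lambda>t. \<gamma> t $ j) has_field_derivative v $ j) (at 0)"
  shows "v \<in> tangent_space X z"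
  unfolding tangent_space_def
proof (intro CollectI allI impI)
  fix f assume f: "poly_fun f \<and> (\<forall>x\<in>X. f x = 0)"
  then obtain f' where f': "\<And>x. (f has_derivative f' x) (at x)"
    "((\<lambda>t. f (\<gamma> t)) has_field_derivative f' (\<gamma> 0) v) (at 0)"
    using poly_fun_along_curve[of f] assms(3) by metis
  have "(\<lambda>t. f (\<gamma> t)) = (\<lambda>t. 0)" using f assms(1) by auto
  then have "f' (\<gamma> 0) v = 0" using f'(2) DERIV_unique[OF _ DERIV_const] by metis
  then show "frechet_derivative f (at z) v = 0"
    using frechet_derivative_at[OF f'(1)[of z]] assms(2) by simp
qed

lemma tangent_space_mono: "X \<subseteq> Y \<Longrightarrow> tangent_space X z \<subseteq> tangent_space Y z"
  unfolding tangent_space_def by blast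

lemma tangent_vector_in_tangent_space:
  "(tangent_vector u v :: 'd::finite tensor) \<in> tangent_space veronese_cone (c *s tensor_power u)" if "c \<noteq> 0"
proof -
  have T: "c *s tangent_vector u v' \<in> tangent_space veronese_cone (c *s tensor_power u :: 'd tensor)" for v'
  proof (rule tangent_space_curve)
    let ?\<gamma> = "\<lambda>t. c *s tensor_power (u + t *s v') :: 'd tensor"
    show "?\<gamma> t \<in> veronese_cone" for t by (auto simp: veronese_cone_def)
    show "((\<lambda>t. ?\<gamma> t $ j) has_field_derivative (c *s tangent_vector u v' :: 'd tensor) $ j) (at 0)" for j
    proof -
      have "((\<lambda>t. c * ((u + t *s v') $ 1 ^ ones j * (u + t *s v') $ 2 ^ (CARD('d) - ones j)))
          has_field_derivative c * (tangent_vector u v' :: 'd tensor) $ j) (at 0)"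
        unfolding tangent_vector_nth by (auto intro!: derivative_eq_intros simp: algebra_simps)
      then show ?thesis
        unfolding scaled_tensor_power_nth vector_smult_component[of c "tangent_vector u v'"] .
    qed
  qed simp
  have "c *s tangent_vector u ((1 / c) *s v) = (tangent_vector u v :: 'd tensor)"
    using that by (simp add: vec_eq_iff tangent_vector_nth field_simps)
  then show ?thesis using T[of "(1 / c) *s v"] by simp
qed

lemma tangent_space_eqs:
  assumes "v \<in> tangent_space X z" "poly_fun f" "\<And>x. x \<in> X \<Longrightarrow> f x = 0" "(f has_derivative f') (at z)"
  shows "f' v = 0"
  using assms frechet_derivative_at[OF assms(4)] unfolding tangent_space_def by auto

text \<open>The differentiated minors are a linear recursion for the coordinates of
  \<open>B\<close>, whose solutions have two free parameters, as many as \<open>v\<close>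
  has.\<close>

lemma tangent_space_veronese_subset:
  fixes B :: "'d::finite tensor"
  assumes d: "CARD('d) \<ge> 2" and c: "c \<noteq> 0" and w: "w \<in> charts"
    and B: "B \<in> tangent_space veronese_cone (c *s tensor_power w)"
  obtains v where "B = tangent_vector w v"
proof -
  let ?d = "CARD('d)"
  let ?A = "c *s tensor_power w :: 'd tensor"
  have zero: "f x = 0" if "f \<in> minor_eqs" "x \<in> veronese_cone" for f and x :: "'d tensor"
    using that veronese_cone_eq[OF d] by auto
  have nth: "((\<lambda>A :: 'd tensor. A $ j) has_derivative (\<lambda>v. v $ j)) (at x)" for j x
    by (rule bounded_linear_imp_has_derivative[OF bounded_linear_vec_nth])
  have 1: "B $ j = B $ j'" if "ones j = ones j'" for j j'
  proof -
    have f: "(\<lambda>A :: 'd tensor. A $ j - A $ j') \<in> minor_eqs" unfolding minor_eqs_def using that by blast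
    have "B $ j - B $ j' = 0"
      using B poly_fun_minor_eqs[OF f] zero[OF f]
      by (rule tangent_space_eqs) (assumption, intro has_derivative_diff nth)
    then show ?thesis by simp
  qed
  have 2: "?A $ j * B $ l' + B $ j * ?A $ l' = ?A $ j' * B $ l + B $ j' * ?A $ l"
    if "ones j' = Suc (ones j)" "ones l' = Suc (ones l)" for j j' l l'
  proof -
    have f: "(\<lambda>A :: 'd tensor. A $ j * A $ l' - A $ j' * A $ l) \<in> minor_eqs"
      unfolding minor_eqs_def using that by blast
    have "(?A $ j * B $ l' + B $ j * ?A $ l') - (?A $ j' * B $ l + B $ j' * ?A $ l) = 0"
      using B poly_fun_minor_eqs[OF f] zero[OF f]
      by (rule tangent_space_eqs) (assumption, intro has_derivative_diff has_derivative_mult nth)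
    then show ?thesis by simp
  qed
  have "\<exists>\<beta>. \<forall>j. B $ j = \<beta> (ones j)"
  proof (intro exI allI)
    fix j :: "'d \<Rightarrow> 2"
    have "ones (SOME i :: 'd \<Rightarrow> 2. ones i = ones j) = ones j" by (rule someI[where P = "\<lambda>i. ones i = ones j"]) (rule refl)
    then show "B $ j = B $ (SOME i. ones i = ones j)" by (intro 1) simp
  qed
  then obtain \<beta> where \<beta>: "\<And>j. B $ j = \<beta> (ones j)" by blast
  define \<alpha> where "\<alpha> k = c * (w $ 1 ^ k * w $ 2 ^ (?d - k))" for k
  have A: "?A $ j = \<alpha> (ones j)" for j
    unfolding scaled_tensor_power_nth \<alpha>_def ..
  have m: "\<alpha> k * \<beta> (Suc l) + \<beta> k * \<alpha> (Suc l) = \<alpha> (Suc k) * \<beta> l + \<beta> (Suc k) * \<alpha> l"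
    if kl: "k < ?d" "l < ?d" for k l
  proof -
    obtain j :: "'d \<Rightarrow> 2" where j: "ones j = k" using kl by (meson less_imp_le ones_exists)
    obtain j' :: "'d \<Rightarrow> 2" where j': "ones j' = Suc k" using kl by (meson Suc_leI ones_exists)
    obtain l1 :: "'d \<Rightarrow> 2" where l1: "ones l1 = l" using kl by (meson less_imp_le ones_exists)
    obtain l' :: "'d \<Rightarrow> 2" where l': "ones l' = Suc l" using kl by (meson Suc_leI ones_exists)
    show ?thesis using 2[of j' j l' l1] by (simp only: \<beta> A j j' l1 l')
  qed
  from w consider "w = vector [1, 0]" | t where "w = vector [t, 1]" by (auto simp: charts_def)
  then show ?thesis
  proof cases
    case 1
    have \<alpha>0: "\<alpha> k = 0" if "k < ?d" for k using that by (simp add: \<alpha>_def 1)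
    have \<alpha>d: "\<alpha> ?d = c" by (simp add: \<alpha>_def 1)
    \<comment> \<open>With second index \<open>?d - 1\<close>, only the product
      \<open>\<beta> k * \<alpha> ?d\<close> survives in the differentiated minor.\<close>
    have "\<beta> k = 0" if "k < ?d - 1" for k
      using m[of k "?d - 1"] that \<alpha>0 \<alpha>d c by simp
    then have "B = tangent_vector w (vector [\<beta> ?d / of_nat ?d, \<beta> (?d - 1)])"
    proof -
      have \<beta>_eq: "\<beta> k = \<beta> ?d / of_nat ?d * (of_nat k * 0 ^ (?d - k)) + \<beta> (?d - 1) * (of_nat (?d - k) * 0 ^ (?d - k - 1))"
        if "k \<le> ?d" for k
      proof -
        consider "k = ?d" | "k = ?d - 1" "k < ?d" | "k < ?d - 1" using \<open>k \<le> ?d\<close> by linarith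
        then show ?thesis using \<open>\<And>k. k < ?d - 1 \<Longrightarrow> \<beta> k = 0\<close> by cases (auto simp: power_0_left)
      qed
      show ?thesis
        unfolding vec_eq_iff tangent_vector_nth \<beta> using \<beta>_eq[OF ones_le] by (simp add: 1)
    qed
    then show ?thesis by (rule that)
  next
    case (2 t)
    \<comment> \<open>Read off from the coordinates with \<open>ones\<close> equal to 0 and 1, which
      are \<open>?d * v2\<close> and \<open>v1 + (?d - 1) * t * v2\<close>.\<close>
    define v2 where "v2 = \<beta> 0 / of_nat ?d"
    define v1 where "v1 = \<beta> 1 - of_nat (?d - 1) * t * v2"
    have \<beta>0: "\<beta> 0 = of_nat ?d * v2" by (simp add: v2_def)
    have \<beta>_eq: "\<beta> k = v1 * (of_nat k * t ^ (k - 1)) + v2 * (of_nat (?d - k) * t ^ k)" if "k \<le> ?d" for k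
      using that
    proof (induction k)
      case 0
      then show ?case by (simp add: \<beta>0)
    next
      case (Suc k)
      have "c * (\<beta> (Suc k) + \<beta> 0 * t ^ Suc k) = c * (t * \<beta> k + \<beta> 1 * t ^ k)"
        using m[of 0 k] Suc.prems d by (simp add: \<alpha>_def 2 algebra_simps)
      then have "\<beta> (Suc k) + \<beta> 0 * t ^ Suc k = t * \<beta> k + \<beta> 1 * t ^ k"
        unfolding mult_left_cancel[OF c] .
      then have "\<beta> (Suc k) = t * \<beta> k + (\<beta> 1 - t * \<beta> 0) * t ^ k"
        by (simp add: algebra_simps)
      also have "\<beta> 1 - t * \<beta> 0 = v1 - t * v2"
        using d by (simp add: v1_def \<beta>0 of_nat_diff algebra_simps)
      also have "\<beta> k = v1 * (of_nat k * t ^ (k - 1)) + v2 * (of_nat (?d - k) * t ^ k)"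
        using Suc by simp
      also have "t * (v1 * (of_nat k * t ^ (k - 1)) + v2 * (of_nat (?d - k) * t ^ k)) + (v1 - t * v2) * t ^ k =
          v1 * (of_nat (Suc k) * t ^ (Suc k - 1)) + v2 * (of_nat (?d - Suc k) * t ^ Suc k)"
        using Suc.prems by (cases k) (simp_all add: of_nat_diff algebra_simps)
      finally show ?case .
    qed
    have "B = tangent_vector w (vector [v1, v2])"
      unfolding vec_eq_iff tangent_vector_nth \<beta> using \<beta>_eq[OF ones_le] by (simp add: 2)
    then show ?thesis by (rule that)
  qed
qed

lemma tangent_space_veronese:
  assumes "CARD('d::finite) \<ge> 2" "c \<noteq> 0" "w \<in> charts"
  shows "tangent_space veronese_cone (c *s tensor_power w :: 'd tensor) = range (tangent_vector w)"
proof
  show "tangent_space veronese_cone (c *s tensor_power w :: 'd tensor) \<subseteq> range (tangent_vector w)"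
    using tangent_space_veronese_subset[OF assms] by blast
qed (use tangent_vector_in_tangent_space assms(2) in blast)

lemma tangent_vector_eq_0:
  assumes d: "CARD('d::finite) \<ge> 2" and w: "w \<in> charts" and 0: "(tangent_vector w v :: 'd tensor) = 0"
  shows "v $ 1 = 0 \<and> v $ 2 = 0"
proof -
  let ?d = "CARD('d)"
  obtain i0 :: "'d \<Rightarrow> 2" where i0: "ones i0 = 0" by (rule ones_exists[of 0]) auto
  obtain i1 :: "'d \<Rightarrow> 2" where i1: "ones i1 = 1" by (rule ones_exists[of 1]) (use d in auto)
  obtain j0 :: "'d \<Rightarrow> 2" where j0: "ones j0 = ?d" by (rule ones_exists[of ?d]) auto
  obtain j1 :: "'d \<Rightarrow> 2" where j1: "ones j1 = ?d - 1" by (rule ones_exists[of "?d - 1"]) auto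
  have z: "(tangent_vector w v :: 'd tensor) $ j = 0" for j using 0 by simp
  from w consider "w = vector [1, 0]" | t where "w = vector [t, 1]" by (auto simp: charts_def)
  then show ?thesis
  proof cases
    case 1
    then show ?thesis using z[of j0] z[of j1] d by (auto simp: tangent_vector_nth j0 j1 power_0_left)
  next
    case (2 t)
    then show ?thesis using z[of i0] z[of i1] d by (auto simp: tangent_vector_nth i0 i1)
  qed
qed

lemma tangent_vector_expand:
  "tangent_vector w v = v $ 1 *s tangent_vector w (axis 1 1) + v $ 2 *s tangent_vector w (axis 2 1)"
  by (simp add: vec_eq_iff tangent_vector_nth axis_def)

lemma dim_range_tangent_vector:
  assumes d: "CARD('d::finite) \<ge> 2" and w: "w \<in> charts"
  shows "vec.dim (range (tangent_vector w :: _ \<Rightarrow> 'd tensor)) = 2"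
proof -
  let ?T = "tangent_vector w :: _ \<Rightarrow> 'd tensor"
  let ?a = "?T (axis 1 1)" and ?b = "?T (axis 2 1)"
  have lin: "x = 0 \<and> y = 0" if "x *s ?a + y *s ?b = 0" for x y
  proof -
    have "?T (vector [x, y]) = 0" using that tangent_vector_expand[of w "vector [x, y]", where 'a = 'd] by simp
    then show ?thesis using tangent_vector_eq_0[OF d w] by fastforce
  qed
  have b0: "?b \<noteq> 0" using lin[of 0 1] by auto
  have ab: "?a \<notin> vec.span {?b}"
  proof
    assume "?a \<in> vec.span {?b}"
    then obtain k where "?a = k *s ?b" by (auto simp: vec.span_singleton)
    then have "1 *s ?a + (- k) *s ?b = 0" by simp
    then show False using lin[of 1 "- k"] by simp
  qed
  then have "?a \<noteq> ?b" using vec.span_base[of ?b "{?b}"] by auto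
  have ind: "vec.independent {?a, ?b}"
    using ab b0 by (simp add: vec.independent_insert vec.dependent_single)
  have "range ?T = vec.span {?a, ?b}"
  proof (intro equalityI subsetI)
    fix x assume "x \<in> range ?T"
    then obtain v where "x = ?T v" by blast
    then show "x \<in> vec.span {?a, ?b}"
      using tangent_vector_expand[of w v, where 'a = 'd]
      by (simp add: vec.span_add vec.span_scale vec.span_base)
  next
    fix x assume "x \<in> vec.span {?a, ?b}"
    then obtain k l where "x - k *s ?a = l *s ?b"
      by (auto simp: vec.span_insert[of ?a] vec.span_singleton)
    then have "x = ?T (vector [k, l])"
      using tangent_vector_expand[of w "vector [k, l]", where 'a = 'd] by (simp add: algebra_simps)
    then show "x \<in> range ?T" by blast
  qed
  then have "vec.dim (range ?T) = card {?a, ?b}"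
    using vec.dim_span_eq_card_independent[OF ind] by simp
  then show ?thesis using \<open>?a \<noteq> ?b\<close> by simp
qed

lemma dim_tangent_space_veronese:
  assumes "CARD('d::finite) \<ge> 2" "A \<in> (veronese_cone :: 'd tensor set)" "A \<noteq> 0"
  shows "vec.dim (tangent_space veronese_cone A) = 2"
  using veronese_cone_cases[OF assms] tangent_space_veronese[OF assms(1)] dim_range_tangent_vector[OF assms(1)]
  by metis

text \<open>Every tensor power is tangent at the vertex, and three of them are linearly independent.
  Elsewhere the dimension is 2, so the vertex is not regular.\<close>

lemma dim_tangent_space_veronese_0:
  assumes d: "CARD('d::finite) \<ge> 2"
  shows "vec.dim (tangent_space veronese_cone (0 :: 'd tensor)) \<ge> 3"
proof -
  let ?d = "CARD('d)"
  let ?P = "tensor_power (vector [1, 0]) :: 'd tensor"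
  let ?Q = "tensor_power (vector [0, 1]) :: 'd tensor"
  let ?R = "tensor_power (vector [1, 1]) :: 'd tensor"
  obtain i0 :: "'d \<Rightarrow> 2" where i0: "ones i0 = 0" by (rule ones_exists[of 0]) auto
  obtain i1 :: "'d \<Rightarrow> 2" where i1: "ones i1 = 1" by (rule ones_exists[of 1]) (use d in auto)
  obtain j0 :: "'d \<Rightarrow> 2" where j0: "ones j0 = ?d" by (rule ones_exists[of ?d]) auto
  have nth: "(tensor_power z :: 'd tensor) $ j = z $ 1 ^ ones j * z $ 2 ^ (?d - ones j)" for z j
    by (simp add: tensor_prod_def prod_index_UNIV)
  have sub: "vec.subspace {x :: 'd tensor. x $ j = 0}" for j
    by (auto simp: vec.subspace_def)
  have "?Q \<noteq> 0"
  proof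
    assume "?Q = 0"
    then show False using nth[of "vector [0, 1]" i0] by (simp add: i0)
  qed
  moreover have "?P \<notin> vec.span {?Q}"
  proof
    assume "?P \<in> vec.span {?Q}"
    moreover have "vec.span {?Q} \<subseteq> {x. x $ j0 = 0}"
      by (rule vec.span_minimal[OF _ sub]) (simp add: nth j0)
    ultimately have "?P $ j0 = 0" by blast
    then show False by (simp add: nth j0)
  qed
  moreover have "?R \<notin> vec.span {?P, ?Q}"
  proof
    assume "?R \<in> vec.span {?P, ?Q}"
    moreover have "vec.span {?P, ?Q} \<subseteq> {x. x $ i1 = 0}"
      using d by (intro vec.span_minimal[OF _ sub]) (simp add: nth i1)
    ultimately have "?R $ i1 = 0" by blast
    then show False by (simp add: nth i1)
  qed
  ultimately have "vec.independent {?R, ?P, ?Q}" "card {?R, ?P, ?Q} = 3"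
  proof -
    assume *: "?Q \<noteq> 0" "?P \<notin> vec.span {?Q}" "?R \<notin> vec.span {?P, ?Q}"
    then have ne: "?P \<noteq> ?Q" "?R \<noteq> ?P" "?R \<noteq> ?Q"
      using vec.span_base[of ?Q "{?Q}"] vec.span_base[of ?P "{?P, ?Q}"] vec.span_base[of ?Q "{?P, ?Q}"] by auto
    then show "card {?R, ?P, ?Q} = 3" by simp
    show "vec.independent {?R, ?P, ?Q}"
      using * ne by (simp add: vec.independent_insert vec.dependent_single)
  qed
  moreover have "tensor_power z \<in> tangent_space veronese_cone (0 :: 'd tensor)" for z
  proof (rule tangent_space_curve)
    show "t *s tensor_power z \<in> (veronese_cone :: 'd tensor set)" for t by (auto simp: veronese_cone_def)
    show "((\<lambda>t. (t *s tensor_power z :: 'd tensor) $ j) has_field_derivative (tensor_power z :: 'd tensor) $ j) (at 0)" for j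
      by (auto intro!: derivative_eq_intros)
  qed simp
  then have "{?R, ?P, ?Q} \<subseteq> tangent_space veronese_cone 0" by blast
  ultimately show ?thesis using vec.independent_card_le_dim by metis
qed

section \<open>Irreducibility, dimension and regular points\<close>

lemma poly_fun_along_polynomial_curve:
  assumes "poly_fun f" and \<gamma>: "\<And>j. \<exists>P. \<forall>t. \<gamma> t $ j = poly P t"
  shows "\<exists>P. \<forall>t. f (\<gamma> t) = poly P t"
  using assms(1)
proof induction
  case (const c)
  show ?case by (intro exI[of _ "[:c:]"]) simp
next
  case (coord i)
  show ?case by (rule \<gamma>)
next
  case (add f g)
  then show ?case by (metis poly_add)
next
  case (mult f g)
  then show ?case by (metis poly_mult)
qed

text \<open>Any two points of the cone lie on a polynomial curve inside it. If \<open>f * g\<close>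
  vanishes on the cone, then along the curve a product of univariate polynomials is 0, although
  neither factor is, by the values at the two points.\<close>

lemma irreducible_veronese_cone:
  assumes d: "CARD('d::finite) \<ge> 2"
  shows "irreducible_variety (veronese_cone :: 'd tensor set)"
  unfolding irreducible_variety_def
proof (intro conjI allI impI)
  let ?X = "veronese_cone :: 'd tensor set"
  show "algebraic_set ?X" by (rule algebraic_set_veronese_cone[OF d])
  show "?X \<noteq> {}" by (auto simp: veronese_cone_def)
  fix Y Z assume YZ: "algebraic_set Y \<and> algebraic_set Z \<and> ?X = Y \<union> Z"
  show "?X = Y \<or> ?X = Z"
  proof (rule ccontr)
    assume "\<not> ?thesis"
    then obtain A B where A: "A \<in> ?X" "A \<notin> Y" and B: "B \<in> ?X" "B \<notin> Z" using YZ by blast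
    obtain f where f: "poly_fun f" "\<forall>y\<in>Y. f y = 0" "f A \<noteq> 0"
      using YZ A(2) unfolding algebraic_set_def by blast
    obtain g where g: "poly_fun g" "\<forall>z\<in>Z. g z = 0" "g B \<noteq> 0"
      using YZ B(2) unfolding algebraic_set_def by blast
    obtain a x where a: "A = a *s tensor_power x" using A(1) by (auto simp: veronese_cone_def)
    obtain b y where b: "B = b *s tensor_power y" using B(1) by (auto simp: veronese_cone_def)
    define \<gamma> :: "complex \<Rightarrow> 'd tensor" where "\<gamma> t = (a + t * (b - a)) *s tensor_power (x + t *s (y - x))" for t
    have "\<exists>P. \<forall>t. \<gamma> t $ j = poly P t" for j
      unfolding \<gamma>_def scaled_tensor_power_nth
      by (rule exI[of _ "[:a, b - a:] * ([:x $ 1, y $ 1 - x $ 1:] ^ ones j * [:x $ 2, y $ 2 - x $ 2:] ^ (CARD('d) - ones j))"])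
        (simp only: poly_mult poly_power poly_pCons poly_0 vector_add_component vector_smult_component
          vector_minus_component mult_zero_right add_0_right simp_thms)
    then obtain P Q where P: "\<And>t. f (\<gamma> t) = poly P t" and Q: "\<And>t. g (\<gamma> t) = poly Q t"
      using poly_fun_along_polynomial_curve f(1) g(1) by metis
    have "poly (P * Q) t = 0" for t
    proof -
      have "\<gamma> t \<in> ?X" unfolding veronese_cone_def \<gamma>_def by blast
      then have "\<gamma> t \<in> Y \<union> Z" using YZ by blast
      then show ?thesis using f(2) g(2) P[of t] Q[of t] by auto
    qed
    then have "P * Q = 0" using poly_all_0_iff_0 by blast
    moreover have "\<gamma> 0 = A" "\<gamma> 1 = B" by (simp_all add: \<gamma>_def a b)
    then have "P \<noteq> 0" "Q \<noteq> 0" using P[of 0] Q[of 1] f(3) g(3) by auto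
    ultimately show False by simp
  qed
qed

lemma variety_dim_veronese_cone:
  assumes d: "CARD('d::finite) \<ge> 2"
  shows "variety_dim (veronese_cone :: 'd tensor set) = 2"
  unfolding variety_dim_def
proof (rule Least_equality)
  let ?w = "1 *s tensor_power (vector [1, 0]) :: 'd tensor"
  obtain j0 :: "'d \<Rightarrow> 2" where j0: "ones j0 = CARD('d)" by (rule ones_exists[of "CARD('d)"]) auto
  have "?w $ j0 = 1" unfolding scaled_tensor_power_nth by (simp add: j0)
  then have "?w \<noteq> 0" by (metis zero_index zero_neq_one)
  moreover have "?w \<in> veronese_cone" unfolding veronese_cone_def by blast
  ultimately show "\<exists>w\<in>veronese_cone. 2 = vec.dim (tangent_space veronese_cone (w :: 'd tensor))"
    using dim_tangent_space_veronese[OF d] by metis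
next
  fix r assume "\<exists>w\<in>veronese_cone. r = vec.dim (tangent_space veronese_cone (w :: 'd tensor))"
  then obtain w :: "'d tensor" where w: "w \<in> veronese_cone" "r = vec.dim (tangent_space veronese_cone w)" by blast
  then show "2 \<le> r"
    using dim_tangent_space_veronese[OF d w(1)] dim_tangent_space_veronese_0[OF d] by (cases "w = 0") auto
qed

text \<open>At a nonzero point the tangent space of \<open>Y\<close> lies in that of the cone, of
  dimension 2. The case \<open>Y = {0}\<close> needs its own argument, because the tangent space of
  the cone at the vertex is larger.\<close>

lemma variety_dim_le:
  assumes d: "CARD('d::finite) \<ge> 2" and Y: "Y \<subseteq> (veronese_cone :: 'd tensor set)" "z \<in> Y"
  shows "variety_dim Y \<le> 2"
proof -
  have least: "variety_dim Y \<le> vec.dim (tangent_space Y w)" if "w \<in> Y" for w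
    unfolding variety_dim_def using that by (intro Least_le) blast
  show ?thesis
  proof (cases "\<exists>w\<in>Y. w \<noteq> 0")
    case True
    then obtain w where w: "w \<in> Y" "w \<noteq> 0" by blast
    have "vec.dim (tangent_space Y w) \<le> vec.dim (tangent_space (veronese_cone :: 'd tensor set) w)"
      by (rule vec.dim_subset[OF tangent_space_mono[OF Y(1)]])
    then show ?thesis
      using least[OF w(1)] dim_tangent_space_veronese[OF d _ w(2)] w(1) Y(1) by auto
  next
    case False
    then have "Y = {0}" using Y(2) by auto
    have "tangent_space Y 0 \<subseteq> {0}"
    proof
      fix v :: "'d tensor" assume v: "v \<in> tangent_space Y 0"
      have "v $ j = 0" for j
        by (rule tangent_space_eqs[OF v poly_fun.coord[of j] _ bounded_linear_imp_has_derivative[OF bounded_linear_vec_nth]])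
          (use \<open>Y = {0}\<close> in auto)
      then show "v \<in> {0}" by (simp add: vec_eq_iff)
    qed
    then have "vec.dim (tangent_space Y 0) = 0" by (simp only: vec.dim_eq_0)
    then show ?thesis using least[of 0] \<open>Y = {0}\<close> by (metis insertI1 le_zero_eq zero_le)
  qed
qed

lemma regular_point_veronese_iff:
  assumes d: "CARD('d::finite) \<ge> 2"
  shows "regular_point (veronese_cone :: 'd tensor set) A \<longleftrightarrow> A \<in> veronese_cone \<and> A \<noteq> 0"
proof -
  have "local_dim veronese_cone A = 2" if A: "A \<in> (veronese_cone :: 'd tensor set)"
    unfolding local_dim_def
  proof (rule Max_eqI)
    let ?D = "{variety_dim Y | Y. irreducible_variety Y \<and> Y \<subseteq> (veronese_cone :: 'd tensor set) \<and> A \<in> Y}"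
    show le: "y \<le> 2" if "y \<in> ?D" for y using that variety_dim_le[OF d] by auto
    then show "finite ?D" using finite_subset[of ?D "{..2}"] by blast
    show "2 \<in> ?D" using A irreducible_veronese_cone[OF d] variety_dim_veronese_cone[OF d] by force
  qed
  then show ?thesis
    unfolding regular_point_def
    using dim_tangent_space_veronese[OF d] dim_tangent_space_veronese_0[OF d] by fastforce
qed

section \<open>Critical points on the cone\<close>

lemma contract_tensor_prod:
  fixes a :: "'d::finite \<Rightarrow> complex ^ 2"
  shows "contract (tensor_prod a) x = (\<Prod>k\<in>UNIV. \<Sum>i\<in>UNIV. a k $ i * x k $ i)"
proof -
  have "(\<Prod>k\<in>UNIV. \<Sum>i\<in>UNIV. a k $ i * x k $ i) = (\<Sum>j\<in>PiE UNIV (\<lambda>_. UNIV). \<Prod>k\<in>UNIV. a k $ j k * x k $ j k)"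
    by (rule prod_sum_PiE) auto
  then show ?thesis by (simp add: contract_def tensor_prod_def prod.distrib)
qed

lemma grad_rank_one:
  fixes c :: complex
  shows "grad (c *s tensor_power w :: 'd::finite tensor) x y =
    of_nat CARD('d) * c * (\<Sum>i\<in>UNIV. w $ i * x $ i) ^ (CARD('d) - 1) * (\<Sum>i\<in>UNIV. w $ i * y $ i)"
proof -
  have "contract (c *s tensor_power w :: 'd tensor) ((\<lambda>_. x)(k := y)) =
      c * ((\<Sum>i\<in>UNIV. w $ i * x $ i) ^ (CARD('d) - 1) * (\<Sum>i\<in>UNIV. w $ i * y $ i))" for k
  proof -
    have "contract (c *s tensor_power w :: 'd tensor) ((\<lambda>_. x)(k := y)) =
        c * contract (tensor_power w :: 'd tensor) ((\<lambda>_. x)(k := y))"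
      by (simp add: contract_def sum_distrib_left mult.assoc)
    also have "contract (tensor_power w :: 'd tensor) ((\<lambda>_. x)(k := y)) =
        (\<Sum>i\<in>UNIV. w $ i * x $ i) ^ (CARD('d) - 1) * (\<Sum>i\<in>UNIV. w $ i * y $ i)"
      unfolding contract_tensor_prod
      by (subst prod.remove[of UNIV k]) (simp_all add: card_Diff_singleton mult.commute)
    finally show ?thesis .
  qed
  then show ?thesis by (simp add: grad_def mult_ac)
qed

text \<open>Makes orthogonality to the tangent space a statement about differentials of binary
  forms.\<close>

lemma herm_tangent_vector: "herm U (tangent_vector w v) = grad U (vcnj w) (vcnj v)"
proof -
  have "herm U (tangent_vector w v) = (\<Sum>k\<in>UNIV. herm U (tensor_prod ((\<lambda>_. w)(k := v))))"
    unfolding herm_def tangent_vector_def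
    by (subst sum.swap) (simp add: sum_distrib_left)
  also have "\<dots> = (\<Sum>k\<in>UNIV. contract U ((\<lambda>_. vcnj w)(k := vcnj v)))"
    unfolding herm_def contract_def tensor_prod_def
    by (intro sum.cong refl) (auto intro!: prod.cong)
  finally show ?thesis by (simp add: grad_def)
qed

lemma herm_diff: "herm (A - B) C = herm A C - herm B C"
  by (simp add: herm_def left_diff_distrib sum_subtractf)

text \<open>\<open>U - A\<close> is orthogonal to the tangent space at
  \<open>A = c *s tensor_power w\<close> iff the forms of \<open>U\<close> and \<open>A\<close> have
  the same differential at \<open>vcnj w\<close>. In the affine chart the two components give the
  planar equation and the value of \<open>c\<close>.\<close>

lemma critical_points_veronese:
  fixes U :: "'d::finite tensor"
  assumes d: "CARD('d) \<ge> 2" and g: "generic U"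
  shows "critical_points veronese_cone U = point U ` hpoly_zeros U"
proof -
  let ?d = "CARD('d)"
  have crit: "(\<forall>B\<in>tangent_space veronese_cone A. herm (U - A) B = 0) \<longleftrightarrow>
      (\<forall>v. grad U (vcnj w) v = of_nat ?d * c * (w $ 1 * cnj (w $ 1) + w $ 2 * cnj (w $ 2)) ^ (?d - 1) * (w $ 1 * v $ 1 + w $ 2 * v $ 2))"
    if A: "A = c *s tensor_power w" "c \<noteq> 0" "w \<in> charts" for A c w
  proof -
    have "(\<forall>B\<in>tangent_space veronese_cone A. herm (U - A) B = 0) \<longleftrightarrow>
        (\<forall>v. grad U (vcnj w) (vcnj v) = grad A (vcnj w) (vcnj v))"
      using A(2,3) by (simp add: A(1) tangent_space_veronese[OF d] herm_diff herm_tangent_vector)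
    also have "\<dots> \<longleftrightarrow> (\<forall>v. grad U (vcnj w) v = grad A (vcnj w) v)"
    proof -
      have "vcnj (vcnj v) = v" for v :: "complex ^ 2" by (simp add: vec_eq_iff)
      then show ?thesis by metis
    qed
    finally show ?thesis by (simp add: A(1) grad_rank_one sum_2)
  qed
  show ?thesis
  proof (intro equalityI subsetI)
    fix A assume A: "A \<in> critical_points veronese_cone U"
    then have AX: "A \<in> veronese_cone" "A \<noteq> 0" and ort: "\<forall>B\<in>tangent_space veronese_cone A. herm (U - A) B = 0"
      by (auto simp: critical_points_def regular_point_veronese_iff[OF d])
    obtain c w where w: "c \<noteq> 0" "w \<in> charts" "A = c *s tensor_power w"
      using veronese_cone_cases[OF d AX] .
    define S where "S = w $ 1 * cnj (w $ 1) + w $ 2 * cnj (w $ 2)"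
    have eq: "grad U (vcnj w) v = of_nat ?d * c * S ^ (?d - 1) * (w $ 1 * v $ 1 + w $ 2 * v $ 2)" for v
      using crit[OF w(3,1,2)] ort by (simp add: S_def)
    from w(2) consider "w = vector [1, 0]" | t where "w = vector [t, 1]" by (auto simp: charts_def)
    then show "A \<in> point U ` hpoly_zeros U"
    proof cases
      case 1
      have "grad U (vcnj w) (axis 2 1) = 0" using eq[of "axis 2 1"] 1 by (simp add: axis_def)
      moreover have "grad U (vcnj w) (axis 2 1) = form_coeff U (?d - 1)"
        using grad_infinity[of "vcnj w" U] 1 by simp
      ultimately show ?thesis using g by (simp add: generic_def)
    next
      case (2 t)
      define \<omega> where "\<omega> = cnj t"
      have S: "S = 1 + \<omega> * cnj \<omega>" by (simp add: S_def 2 \<omega>_def)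
      have gr: "grad U (vcnj w) v = v $ 1 * poly (form_x U) \<omega> + v $ 2 * poly (form_y U) \<omega>" for v
        using grad_dehomogenize[of "vcnj w" U v] by (simp add: 2 \<omega>_def)
      have x: "poly (form_x U) \<omega> = of_nat ?d * c * S ^ (?d - 1) * t"
        using eq[of "axis 1 1"] unfolding gr by (simp add: axis_def 2)
      have y: "poly (form_y U) \<omega> = of_nat ?d * c * S ^ (?d - 1)"
        using eq[of "axis 2 1"] unfolding gr by (simp add: axis_def 2)
      have zero: "\<omega> \<in> hpoly_zeros U"
        using x y by (simp add: hpoly_zeros_def hpoly_def \<omega>_def)
      have "S ^ ?d = S ^ (?d - 1) * S" by (metis power_minus_mult zero_less_card_finite)
      then have "of_nat ?d * (c * S ^ ?d) = of_nat ?d * poly (form U) \<omega>"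
        using hpoly_zero_euler(1)[OF zero] y S by (simp add: mult_ac)
      then have "c * S ^ ?d = poly (form U) \<omega>" by simp
      moreover have "S \<noteq> 0" using S one_plus_ne_0 by simp
      ultimately have "c = poly (form U) \<omega> / S ^ ?d" by (simp add: field_simps)
      then have "A = point U \<omega>" by (simp add: w(3) point_def S 2 \<omega>_def)
      then show ?thesis using zero by blast
    qed
  next
    fix A assume "A \<in> point U ` hpoly_zeros U"
    then obtain \<omega> where zero: "\<omega> \<in> hpoly_zeros U" and A: "A = point U \<omega>" by blast
    define S where "S = 1 + \<omega> * cnj \<omega>"
    define c where "c = poly (form U) \<omega> / S ^ ?d"
    define w :: "complex ^ 2" where "w = vector [cnj \<omega>, 1]"
    have S: "S \<noteq> 0" using one_plus_ne_0 by (simp add: S_def)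
    have c: "c \<noteq> 0" using generic_form_nonzero[OF g zero] S by (simp add: c_def)
    have w: "w \<in> charts" by (simp add: charts_def w_def)
    have A': "A = c *s tensor_power w" by (simp add: A point_def c_def S_def w_def)
    have "A \<noteq> 0"
    proof -
      obtain j :: "'d \<Rightarrow> 2" where j: "ones j = 0" by (rule ones_exists[of 0]) auto
      have "A $ j = c" unfolding A' scaled_tensor_power_nth by (simp add: j w_def)
      then show ?thesis using c by auto
    qed
    moreover have "A \<in> veronese_cone" by (auto simp: A' veronese_cone_def)
    moreover have "\<forall>B\<in>tangent_space veronese_cone A. herm (U - A) B = 0"
      unfolding crit[OF A' c w]
    proof
      fix v
      have "S ^ ?d = S ^ (?d - 1) * S" by (metis power_minus_mult zero_less_card_finite)
      then have "of_nat ?d * c * S ^ (?d - 1) = of_nat ?d * poly (form U) \<omega> / S"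
        using S by (simp add: c_def)
      also have "\<dots> = poly (form_y U) \<omega>"
        using hpoly_zero_euler(1)[OF zero] S by (simp add: S_def[symmetric] field_simps)
      finally have y: "of_nat ?d * c * S ^ (?d - 1) = poly (form_y U) \<omega>" .
      have nw: "w $ 1 * cnj (w $ 1) + w $ 2 * cnj (w $ 2) = S" by (simp add: w_def S_def)
      have gr: "grad U (vcnj w) v = v $ 1 * poly (form_x U) \<omega> + v $ 2 * poly (form_y U) \<omega>"
        using grad_dehomogenize[of "vcnj w" U v] by (simp add: w_def)
      show "grad U (vcnj w) v = of_nat ?d * c * (w $ 1 * cnj (w $ 1) + w $ 2 * cnj (w $ 2)) ^ (?d - 1) * (w $ 1 * v $ 1 + w $ 2 * v $ 2)"
        unfolding nw gr y hpoly_zero_euler(2)[OF zero] by (simp add: w_def algebra_simps)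
    qed
    ultimately show "A \<in> critical_points veronese_cone U"
      by (simp add: critical_points_def regular_point_veronese_iff[OF d])
  qed
qed

section \<open>Bounds on the counts and the Hermitian distance degree\<close>

lemma card_hpoly_zeros_generic:
  fixes U :: "'d::finite tensor"
  assumes "generic U" and d: "CARD('d) \<ge> 3"
  shows "CARD('d) - 2 \<le> card (hpoly_zeros U)" "card (hpoly_zeros U) \<le> 5 * CARD('d) - 10"
proof -
  have deg: "degree (form_x U) \<le> CARD('d) - 1" "degree (form_y U) = CARD('d) - 1"
    using degree_form_x[of U] degree_form_y[of U] assms(1) by (auto simp: generic_def)
  have nd: "norm (poly (wronskian (form_x U) (form_y U)) w) \<noteq> (norm (poly (form_y U) w))\<^sup>2"
    if "hpoly (form_x U) (form_y U) w = 0" for w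
    using assms(1) that by (simp add: generic_def)
  have "CARD('d) - 1 \<ge> 2" using d by linarith
  from card_hpoly_zeros_bounds[OF deg this nd]
  show "CARD('d) - 2 \<le> card (hpoly_zeros U)" "card (hpoly_zeros U) \<le> 5 * CARD('d) - 10"
    unfolding hpoly_zeros_def by linarith+
qed

lemma nowhere_dense_not_generic:
  assumes "CARD('d::finite) \<ge> 3"
  shows "nowhere_dense {U :: 'd tensor. \<not> generic U}"
proof -
  have "{U :: 'd tensor. \<not> generic U} = - {U. generic U}" by auto
  then have "closed {U :: 'd tensor. \<not> generic U}"
    using open_generic[where 'd = 'd] assms by (simp add: open_closed)
  moreover have "interior {U :: 'd tensor. \<not> generic U} = {}"
  proof (rule ccontr)
    assume "interior {U :: 'd tensor. \<not> generic U} \<noteq> {}"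
    then obtain U :: "'d tensor" where "U \<in> interior {U. \<not> generic U}" by blast
    then obtain \<epsilon> where \<epsilon>: "\<epsilon> > 0" "ball U \<epsilon> \<subseteq> {U. \<not> generic U}"
      unfolding mem_interior by blast
    obtain V where "generic V" "dist U V < \<epsilon>"
      using generic_dense[OF assms \<epsilon>(1)] by metis
    then show False using \<epsilon>(2) by auto
  qed
  ultimately show ?thesis by (simp add: nowhere_dense_def)
qed

text \<open>A nonempty relatively open set of symmetric tensors contains a generic one, where the
  count is bounded.\<close>

lemma HDdeg_veronese_subset:
  assumes d: "CARD('d::finite) \<ge> 3"
  shows "HDdeg symmetric_tensors (veronese_cone :: 'd tensor set) \<subseteq> {CARD('d) - 2..5 * CARD('d) - 10}"
proof
  fix m assume "m \<in> HDdeg symmetric_tensors (veronese_cone :: 'd tensor set)"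
  then obtain G :: "'d tensor set" where G: "openin (top_of_set symmetric_tensors) G" "G \<noteq> {}"
    "\<And>U. U \<in> G \<Longrightarrow> card (critical_points veronese_cone U) = m"
    unfolding HDdeg_def by blast
  obtain U where U: "U \<in> G" using G(2) by blast
  obtain \<epsilon> where \<epsilon>: "\<epsilon> > 0" "ball U \<epsilon> \<inter> symmetric_tensors \<subseteq> G"
    using G(1) U by (meson openin_contains_ball)
  have "U \<in> symmetric_tensors" using G(1) U openin_imp_subset by blast
  then obtain V where V: "generic V" "dist U V < \<epsilon>" "V \<in> symmetric_tensors"
    using generic_dense[OF d \<epsilon>(1)] by metis
  then have "V \<in> G" using \<epsilon>(2) by auto
  then have "m = card (point V ` hpoly_zeros V)"
    using G(3)[of V] critical_points_veronese[OF _ V(1)] d by simp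
  also have "\<dots> = card (hpoly_zeros V)"
    by (rule card_image[OF inj_on_point[OF V(1)]])
  finally show "m \<in> {CARD('d) - 2..5 * CARD('d) - 10}"
    using card_hpoly_zeros_generic[OF V(1) d] by simp
qed

text \<open>The number of critical points is bounded and lower semicontinuous on generic tensors, hence
  constant near a tensor where it is maximal.\<close>

lemma HDdeg_veronese_nonempty:
  assumes d: "CARD('d::finite) \<ge> 3"
  shows "HDdeg symmetric_tensors (veronese_cone :: 'd tensor set) \<noteq> {}"
proof -
  let ?S = "symmetric_tensors :: 'd tensor set"
  have d2: "CARD('d) \<ge> 2" using d by simp
  have "0 \<in> ?S" by (simp add: symmetric_tensors_def)
  then obtain V0 where "generic V0" "V0 \<in> ?S"
    using generic_dense[OF d, of 1 "0 :: 'd tensor"] by auto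
  then have "generic V0 \<and> V0 \<in> ?S" by blast
  moreover have "\<forall>U. generic U \<and> U \<in> ?S \<longrightarrow> card (hpoly_zeros U) < Suc (5 * CARD('d) - 10)"
    unfolding less_Suc_eq_le using card_hpoly_zeros_generic(2)[OF _ d] by blast
  ultimately have "\<exists>V. (generic V \<and> V \<in> ?S) \<and>
      (\<forall>U. generic U \<and> U \<in> ?S \<longrightarrow> card (hpoly_zeros U) \<le> card (hpoly_zeros V))"
    by (rule ex_has_greatest_nat[where P = "\<lambda>U. generic U \<and> U \<in> ?S" and f = "\<lambda>U. card (hpoly_zeros U)"])
  then obtain V where V: "generic V" "V \<in> ?S"
    and max: "\<And>U. generic U \<Longrightarrow> U \<in> ?S \<Longrightarrow> card (hpoly_zeros U) \<le> card (hpoly_zeros V)"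
    by blast
  obtain \<delta> where \<delta>: "\<delta> > 0"
    "\<And>U. dist V U < \<delta> \<Longrightarrow> generic U \<and> card (hpoly_zeros V) \<le> card (hpoly_zeros U)"
    using card_hpoly_zeros_lower_semicontinuous[OF V(1) d2] by metis
  let ?G = "?S \<inter> ball V \<delta>"
  have "finite (critical_points veronese_cone U) \<and> card (critical_points veronese_cone U) = card (hpoly_zeros V)"
    if "U \<in> ?G" for U
  proof -
    have U: "generic U" "card (hpoly_zeros U) = card (hpoly_zeros V)"
      using that \<delta>(2)[of U] max[of U] by auto
    then show ?thesis
      using critical_points_veronese[OF d2 U(1)] finite_hpoly_zeros_generic[OF U(1) d2]
        card_image[OF inj_on_point[OF U(1)]] by simp
  qed
  moreover have "openin (top_of_set ?S) ?G" by (rule openin_open_Int) simp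
  moreover have "V \<in> ?G" using V(2) \<delta>(1) by simp
  ultimately show ?thesis unfolding HDdeg_def by blast
qed

theorem corollary4p10:
  fixes d :: nat
  assumes "CARD('d::finite) = d" and "d > 2"
  shows "(\<exists>E :: 'd tensor set. nowhere_dense E \<and>
            (\<forall>U. U \<notin> E \<longrightarrow>
              finite (eigen_points U) \<and>
              d - 2 \<le> card (eigen_points U) \<and> card (eigen_points U) \<le> 5 * d - 10))
       \<and> (let H = HDdeg symmetric_tensors (veronese_cone :: 'd tensor set) in
            finite H \<and> H \<noteq> {} \<and>
            d - 2 \<le> Min H \<and> Min H \<le> Max H \<and> Max H \<le> 5 * d - 10)"
proof
  have d: "CARD('d) \<ge> 3" using assms by simp
  have "finite (eigen_points U) \<and> d - 2 \<le> card (eigen_points U) \<and> card (eigen_points U) \<le> 5 * d - 10"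
    if "generic U" for U :: "'d tensor"
    using that card_hpoly_zeros_generic[OF that d] finite_hpoly_zeros_generic[OF that] d
    by (simp add: eigen_points_eq card_image inj_on_point assms(1))
  then show "\<exists>E :: 'd tensor set. nowhere_dense E \<and> (\<forall>U. U \<notin> E \<longrightarrow>
      finite (eigen_points U) \<and> d - 2 \<le> card (eigen_points U) \<and> card (eigen_points U) \<le> 5 * d - 10)"
    using nowhere_dense_not_generic[OF d] by blast
  let ?H = "HDdeg symmetric_tensors (veronese_cone :: 'd tensor set)"
  have sub: "?H \<subseteq> {d - 2..5 * d - 10}" using HDdeg_veronese_subset[OF d] assms(1) by simp
  then have fin: "finite ?H" by (rule finite_subset) simp
  have ne: "?H \<noteq> {}" by (rule HDdeg_veronese_nonempty[OF d])
  have "Min ?H \<in> ?H" "Max ?H \<in> ?H" using fin ne by simp_all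
  then show "let H = ?H in finite H \<and> H \<noteq> {} \<and>
      d - 2 \<le> Min H \<and> Min H \<le> Max H \<and> Max H \<le> 5 * d - 10"
    using sub fin ne by (auto simp: Let_def)
qed

end
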